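(* Let $T$ and $T_0$ be two contractions on an infinite dimensional separable Hilbert space $\mathcal{H}$ such that their Sch\"affer matrix unitary dilations satisfy $U_T-U_{T_0}\in\mathcal{B}_2(\ell^2_{\mathbb{Z}}(\mathcal{H}))$. Put $T_s=T_0+s(T-T_0)$, $s\in[0,1]$. Then for every complex polynomial $p$, $$p(T)-p(T_0)-\frac{d}{ds}\Big|_{s=0}p(T_s)\in\mathcal{B}_1(\mathcal{H}),$$ and there exists a function $\eta\in L^1(\mathbb{T})$, unique up to an analytic term (i.e. unique modulo $H^1(\mathbb{T})$), such that for every complex polynomial $p$, $$\operatorname{Tr}\Big\{p(T)-p(T_0)-\frac{d}{ds}\Big|_{s=0}p(T_s)\Big\}=\int_{\mathbb{T}}p''(z)\,\eta(z)\,dz.\qquad( * )$$ Moreover, for every given $\epsilon>0$, the function $\eta$ satisfying $( * )$ can be chosen so that $\|\eta\|_{L^1(\mathbb{T})}\le\big(\frac12+\epsilon\big)\|V\|_2^2$, where $V:=T-T_0$.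
   Context: $\mathcal{B}_1$ and $\mathcal{B}_2$ denote trace class and Hilbert-Schmidt operators; $\|\cdot\|_2$ is the Hilbert-Schmidt norm. A contraction is a bounded operator of norm at most $1$. $\ell^2_{\mathbb{Z}}(\mathcal{H})$ is the Hilbert space of square-summable two-sided $\mathcal{H}$-valued sequences. For a contraction $T$ on $\mathcal{H}$, the Sch\"affer matrix unitary dilation $U_T$ is the unitary operator on $\ell^2_{\mathbb{Z}}(\mathcal{H})$ whose block matrix $(U_T(i,j))_{i,j\in\mathbb{Z}}$ has entries $$U_T(0,0)=T,\quad U_T(-1,0)=D_T,\quad U_T(-1,1)=-T^*,\quad U_T(0,1)=D_{T^*},\quad U_T(j,j+1)=I\ \ (j\ne0,-1),$$ all other entries being $0$, where $D_T=(I-T^*T)^{1/2}$ and $D_{T^*}=(I-TT^* )^{1/2}$. The derivative in $s$ is taken in operator norm (one-sided at $s=0$ on $[0,1]$). $\mathbb{T}$ is the unit circle; $\int_{\mathbb{T}}f(z)\,dz=\int_0^{2\pi}f(e^{it})\,ie^{it}\,dt$, and $\|f\|_{L^1(\mathbb{T})}=\int_0^{2\pi}|f(e^{it})|\,dt$ (arc length). $H^1(\mathbb{T})=\{f\in L^1(\mathbb{T}):\hat f(n)=0\text{ for all }n<0\}$. *)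

theory Defs
  imports "HOL-Analysis.Analysis" "HOL-Computational_Algebra.Polynomial"
begin

text \<open>
  A complex Hilbert space is presented as a complete real inner product space with a compatible
  complex scalar multiplication and a Hermitian form \<open>cinner\<close>, linear in the \<^emph>\<open>first\<close> argument,
  whose real part is the real inner product. In particular \<open>(norm x)\<^sup>2 = cinner x x\<close>.
\<close>

class chilbert_space = real_inner + complete_space +
  fixes scaleC :: "complex \<Rightarrow> 'a \<Rightarrow> 'a" (infixr \<open>*\<^sub>C\<close> 75)
    and cinner :: "'a \<Rightarrow> 'a \<Rightarrow> complex"
  assumes scaleC_add_right: "c *\<^sub>C (x + y) = c *\<^sub>C x + c *\<^sub>C y"
    and scaleC_add_left: "(c + d) *\<^sub>C x = c *\<^sub>C x + d *\<^sub>C x"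
    and scaleC_scaleC: "c *\<^sub>C (d *\<^sub>C x) = (c * d) *\<^sub>C x"
    and scaleC_of_real: "complex_of_real r *\<^sub>C x = r *\<^sub>R x"
    and cinner_commute: "cinner x y = cnj (cinner y x)"
    and cinner_add_left: "cinner (x + y) z = cinner x z + cinner y z"
    and cinner_scaleC_left: "cinner (c *\<^sub>C x) y = c * cinner x y"
    and inner_eq_Re_cinner: "inner x y = Re (cinner x y)"

lemma scaleC_one: "1 *\<^sub>C x = x" for x :: "'a::chilbert_space"
  using scaleC_of_real[of 1 x] by simp

interpretation complex_vector: vector_space "scaleC :: complex \<Rightarrow> 'a \<Rightarrow> 'a::chilbert_space"
  by unfold_locales (simp_all add: scaleC_add_right scaleC_add_left scaleC_scaleC scaleC_one)

lemma norm_scaleC: "norm (c *\<^sub>C x) = cmod c * norm x" for x :: "'a::chilbert_space"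
proof -
  have "cinner x (c *\<^sub>C x) = cnj c * cinner x x"
    by (subst cinner_commute) (simp add: cinner_scaleC_left cinner_commute[of x x, symmetric])
  hence "cinner (c *\<^sub>C x) (c *\<^sub>C x) = complex_of_real ((cmod c)\<^sup>2) * cinner x x"
    unfolding cinner_scaleC_left complex_norm_square by (simp add: mult.assoc)
  hence "inner (c *\<^sub>C x) (c *\<^sub>C x) = (cmod c)\<^sup>2 * inner x x"
    by (simp only: inner_eq_Re_cinner Re_complex_of_real Im_complex_of_real times_complex.sel)
  thus ?thesis by (simp add: norm_eq_sqrt_inner real_sqrt_mult)
qed

lemma cmod_cinner_le: "cmod (cinner x y) \<le> norm x * norm y" for x y :: "'a::chilbert_space"
proof (cases "cinner x y = 0")
  case False
  define c where "c = cnj (cinner x y) / cmod (cinner x y)"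
  have c1: "cmod c = 1" using False by (simp add: c_def norm_divide)
  have "c * cinner x y = complex_of_real (cmod (cinner x y))"
    using False
    by (simp add: c_def mult.commute[of "cnj _"] power2_eq_square flip: complex_norm_square)
  hence "cmod (cinner x y) = inner (c *\<^sub>C x) y"
    by (simp add: inner_eq_Re_cinner cinner_scaleC_left)
  also have "\<dots> \<le> norm (c *\<^sub>C x) * norm y" by (rule norm_cauchy_schwarz)
  finally show ?thesis by (simp add: norm_scaleC c1)
qed simp

lemma bounded_linear_scaleC: "bounded_linear (\<lambda>x. c *\<^sub>C x)" for c
  by (rule bounded_linear_intro[where K="cmod c"])
    (simp_all add: scaleC_add_right norm_scaleC mult.commute scaleC_scaleC flip: scaleC_of_real)

instantiation complex :: chilbert_space
begin
definition "scaleC_complex (c::complex) (x::complex) = c * x"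
definition "cinner_complex (x::complex) (y::complex) = x * cnj y"
instance
  by standard (simp_all add: scaleC_complex_def cinner_complex_def algebra_simps scaleR_conv_of_real
      inner_complex_def)
end

typedef (overloaded) 'a ell2Z =
  "{f :: int \<Rightarrow> 'a::chilbert_space. (\<lambda>n. (norm (f n))\<^sup>2) summable_on UNIV}"
  morphisms coord Abs_ell2Z
  by (rule exI[of _ "\<lambda>_. 0"]) simp

setup_lifting type_definition_ell2Z

lemma ell2Z_eqI: "(\<And>n. coord f n = coord g n) \<Longrightarrow> f = g"
  by (simp add: coord_inject[symmetric] fun_eq_iff)

lemma summable_coord: "(\<lambda>n. (norm (coord f n))\<^sup>2) summable_on UNIV"
  using coord[of f] by simp

lemma norm_add_sq_le: "(norm (a + b))\<^sup>2 \<le> 2 * (norm a)\<^sup>2 + 2 * (norm b)\<^sup>2"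
  for a b :: "'a::real_inner"
proof -
  have "(norm (a + b))\<^sup>2 + (norm (a - b))\<^sup>2 = 2 * (norm a)\<^sup>2 + 2 * (norm b)\<^sup>2"
    by (simp add: power2_norm_eq_inner inner_diff_left inner_diff_right inner_add_left inner_add_right)
  thus ?thesis by (smt (verit) zero_le_power2)
qed

lemma sq_summable_add:
  fixes f g :: "'i \<Rightarrow> 'a::real_inner"
  assumes "(\<lambda>n. (norm (f n))\<^sup>2) summable_on A" "(\<lambda>n. (norm (g n))\<^sup>2) summable_on A"
  shows "(\<lambda>n. (norm (f n + g n))\<^sup>2) summable_on A"
  by (rule summable_on_comparison_test[where f="\<lambda>n. 2 * (norm (f n))\<^sup>2 + 2 * (norm (g n))\<^sup>2"])
    (auto intro!: summable_on_add summable_on_cmult_right assms norm_add_sq_le)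

lemma cinner_abs_summable:
  "(\<lambda>n. norm (cinner (coord f n) (coord g n))) summable_on UNIV"
proof (rule summable_on_comparison_test[where f="\<lambda>n. (norm (coord f n))\<^sup>2 + (norm (coord g n))\<^sup>2"])
  fix n
  have "2 * (norm (coord f n) * norm (coord g n)) \<le> (norm (coord f n))\<^sup>2 + (norm (coord g n))\<^sup>2"
    using sum_squares_bound[of "norm (coord f n)" "norm (coord g n)"] by (simp add: mult.assoc)
  moreover have "0 \<le> norm (coord f n) * norm (coord g n)" by simp
  ultimately show "norm (cinner (coord f n) (coord g n)) \<le> (norm (coord f n))\<^sup>2 + (norm (coord g n))\<^sup>2"
    using cmod_cinner_le[of "coord f n" "coord g n"] by linarith
qed (auto intro!: summable_on_add summable_coord)

lemma cinner_summable: "(\<lambda>n. cinner (coord f n) (coord g n)) summable_on UNIV"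
  by (rule abs_summable_summable[OF cinner_abs_summable])

lemma inner_summable: "(\<lambda>n. inner (coord f n) (coord g n)) summable_on UNIV"
  unfolding inner_eq_Re_cinner by (rule summable_on_Re[OF cinner_summable])

instantiation ell2Z :: (chilbert_space) real_inner
begin

lift_definition zero_ell2Z :: "'a ell2Z" is "\<lambda>_. 0" by simp
lift_definition plus_ell2Z :: "'a ell2Z \<Rightarrow> 'a ell2Z \<Rightarrow> 'a ell2Z" is "\<lambda>f g n. f n + g n"
  by (rule sq_summable_add)
lift_definition uminus_ell2Z :: "'a ell2Z \<Rightarrow> 'a ell2Z" is "\<lambda>f n. - f n" by simp
lift_definition minus_ell2Z :: "'a ell2Z \<Rightarrow> 'a ell2Z \<Rightarrow> 'a ell2Z" is "\<lambda>f g n. f n - g n"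
  using sq_summable_add[where g="\<lambda>n. - (g n)" for g] by fastforce
lift_definition scaleR_ell2Z :: "real \<Rightarrow> 'a ell2Z \<Rightarrow> 'a ell2Z" is "\<lambda>r f n. r *\<^sub>R f n"
  by (simp add: power_mult_distrib summable_on_cmult_right)
definition "inner_ell2Z (f :: 'a ell2Z) g = (\<Sum>\<^sub>\<infinity>n. inner (coord f n) (coord g n))"
definition "norm_ell2Z (f :: 'a ell2Z) = sqrt (inner f f)"
definition "sgn_ell2Z (f :: 'a ell2Z) = inverse (norm f) *\<^sub>R f"
definition "dist_ell2Z (f :: 'a ell2Z) g = norm (f - g)"
definition [code del]: "(uniformity :: ('a ell2Z \<times> 'a ell2Z) filter)
  = (INF e\<in>{0 <..}. principal {(x, y). dist x y < e})"
definition [code del]: "open (S :: 'a ell2Z set)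
  \<longleftrightarrow> (\<forall>x\<in>S. \<forall>\<^sub>F (x', y) in uniformity. x' = x \<longrightarrow> y \<in> S)"

lemmas coord_simps = zero_ell2Z.rep_eq plus_ell2Z.rep_eq uminus_ell2Z.rep_eq minus_ell2Z.rep_eq
  scaleR_ell2Z.rep_eq

instance
proof
  fix f g h :: "'a ell2Z" and r s :: real
  show "f + g + h = f + (g + h)" "f + g = g + f" "0 + f = f" "- f + f = 0" "f - g = f + - g"
    "r *\<^sub>R (f + g) = r *\<^sub>R f + r *\<^sub>R g" "(r + s) *\<^sub>R f = r *\<^sub>R f + s *\<^sub>R f"
    "r *\<^sub>R (s *\<^sub>R f) = (r * s) *\<^sub>R f" "1 *\<^sub>R f = f"
    by (rule ell2Z_eqI; simp add: coord_simps algebra_simps)+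
  show "inner f g = inner g f"
    by (simp add: inner_ell2Z_def inner_commute)
  show "inner (f + g) h = inner f h + inner g h"
    by (simp add: inner_ell2Z_def coord_simps inner_add_left infsum_add inner_summable)
  show "inner (r *\<^sub>R f) g = r * inner f g"
    by (simp add: inner_ell2Z_def coord_simps infsum_cmult_right inner_summable)
  show "0 \<le> inner f f"
    by (simp add: inner_ell2Z_def infsum_nonneg)
  show "inner f f = 0 \<longleftrightarrow> f = 0"
  proof
    assume "inner f f = 0"
    hence "inner (coord f n) (coord f n) = 0" for n
      using nonneg_infsum_le_0D[of "\<lambda>n. inner (coord f n) (coord f n)" UNIV n] inner_summable[of f f]
      by (auto simp: inner_ell2Z_def)
    thus "f = 0" by (intro ell2Z_eqI) (simp add: coord_simps)
  qed (simp add: inner_ell2Z_def coord_simps)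
qed (simp_all add: norm_ell2Z_def sgn_ell2Z_def dist_ell2Z_def uniformity_ell2Z_def open_ell2Z_def)

end

lemma norm_ell2Z_sq: "(norm f)\<^sup>2 = (\<Sum>\<^sub>\<infinity>n. (norm (coord f n))\<^sup>2)"
  by (simp add: power2_norm_eq_inner inner_ell2Z_def)

lemma norm_coord_le: "norm (coord f n) \<le> norm f"
proof -
  have "(\<Sum>n\<in>{n}. (norm (coord f n))\<^sup>2) \<le> (norm f)\<^sup>2"
    unfolding norm_ell2Z_sq by (rule finite_sum_le_infsum) (auto intro: summable_coord)
  thus ?thesis by (simp add: abs_le_square_iff flip: abs_le_square_iff)
qed

instance ell2Z :: (chilbert_space) complete_space
proof
  fix X :: "nat \<Rightarrow> 'a ell2Z"
  assume X: "Cauchy X"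
  have "Cauchy (\<lambda>k. coord (X k) n)" for n
    using X unfolding Cauchy_altdef2 dist_norm
    by (metis minus_ell2Z.rep_eq norm_coord_le order_le_less_trans)
  hence "\<exists>l. (\<lambda>k. coord (X k) n) \<longlonglongrightarrow> l" for n
    by (simp add: Cauchy_convergent_iff convergent_def)
  then obtain l where l: "\<And>n. (\<lambda>k. coord (X k) n) \<longlonglongrightarrow> l n" by metis
  have fin: "(\<Sum>n\<in>F. (norm (coord (X k) n - l n))\<^sup>2) \<le> e\<^sup>2"
    if e: "\<And>m. m \<ge> k \<Longrightarrow> norm (X k - X m) \<le> e" for F k e
  proof (rule LIMSEQ_le_const2)
    show "(\<lambda>m. \<Sum>n\<in>F. (norm (coord (X k) n - coord (X m) n))\<^sup>2)
        \<longlonglongrightarrow> (\<Sum>n\<in>F. (norm (coord (X k) n - l n))\<^sup>2)"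
      by (intro tendsto_intros l)
    have "(\<Sum>n\<in>F. (norm (coord (X k) n - coord (X m) n))\<^sup>2) \<le> e\<^sup>2" if "m \<ge> k" for m
    proof (cases "finite F")
      case True
      have "(\<Sum>n\<in>F. (norm (coord (X k - X m) n))\<^sup>2) \<le> (norm (X k - X m))\<^sup>2"
        unfolding norm_ell2Z_sq by (rule finite_sum_le_infsum) (auto intro: summable_coord True)
      also have "\<dots> \<le> e\<^sup>2" using e[OF that] by (simp add: power_mono)
      finally show ?thesis by (simp add: minus_ell2Z.rep_eq)
    qed simp
    thus "\<exists>N. \<forall>m\<ge>N. (\<Sum>n\<in>F. (norm (coord (X k) n - coord (X m) n))\<^sup>2) \<le> e\<^sup>2" by blast
  qed
  have summ: "(\<lambda>n. (norm (coord (X k) n - l n))\<^sup>2) summable_on UNIV"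
    if e: "\<And>m. m \<ge> k \<Longrightarrow> norm (X k - X m) \<le> e" for k e
    by (rule nonneg_bdd_above_summable_on) (auto intro!: bdd_aboveI2 fin[OF that])
  have ev: "\<exists>K. \<forall>k\<ge>K. \<forall>m\<ge>k. norm (X k - X m) \<le> e" if "e > 0" for e
    using X that unfolding Cauchy_def dist_norm by (meson dual_order.trans less_imp_le)
  obtain K where K: "\<And>m. m \<ge> K \<Longrightarrow> norm (X K - X m) \<le> 1"
    using ev[of 1] by auto
  have "(\<lambda>n. (norm (coord (X K) n + - (coord (X K) n - l n)))\<^sup>2) summable_on UNIV"
    by (rule sq_summable_add) (use summ[OF K] summable_coord in \<open>auto simp: norm_minus_commute\<close>)
  hence lin: "(\<lambda>n. (norm (l n))\<^sup>2) summable_on UNIV" by simp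
  define L where "L = Abs_ell2Z l"
  have cL: "coord L n = l n" for n using lin by (simp add: L_def Abs_ell2Z_inverse)
  have "X \<longlonglongrightarrow> L"
  proof (rule LIMSEQ_I)
    fix r :: real assume r: "r > 0"
    then obtain K where K: "\<And>k m. k \<ge> K \<Longrightarrow> m \<ge> k \<Longrightarrow> norm (X k - X m) \<le> r/2"
      using ev[of "r/2"] by auto
    have "norm (X k - L) < r" if k: "k \<ge> K" for k
    proof -
      have "(norm (X k - L))\<^sup>2 \<le> (r/2)\<^sup>2"
        unfolding norm_ell2Z_sq minus_ell2Z.rep_eq cL
        by (rule infsum_le_finite_sums) (use summ[OF K[OF k]] fin[OF K[OF k]] in auto)
      hence "norm (X k - L) \<le> r/2" by (rule power2_le_imp_le) (use r in simp)
      thus ?thesis using r by simp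
    qed
    thus "\<exists>no. \<forall>n\<ge>no. norm (X n - L) < r" by blast
  qed
  thus "convergent X" by (auto simp: convergent_def)
qed

instantiation ell2Z :: (chilbert_space) chilbert_space
begin

lift_definition scaleC_ell2Z :: "complex \<Rightarrow> 'a ell2Z \<Rightarrow> 'a ell2Z" is "\<lambda>c f n. c *\<^sub>C f n"
  by (simp add: norm_scaleC power_mult_distrib summable_on_cmult_right)

definition "cinner_ell2Z (f :: 'a ell2Z) g = (\<Sum>\<^sub>\<infinity>n. cinner (coord f n) (coord g n))"

instance
proof
  fix f g h :: "'a ell2Z" and c d :: complex and r :: real
  show "c *\<^sub>C (f + g) = c *\<^sub>C f + c *\<^sub>C g" "(c + d) *\<^sub>C f = c *\<^sub>C f + d *\<^sub>C f"
    "c *\<^sub>C (d *\<^sub>C f) = (c * d) *\<^sub>C f" "complex_of_real r *\<^sub>C f = r *\<^sub>R f"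
    by (rule ell2Z_eqI; simp add: coord_simps scaleC_ell2Z.rep_eq scaleC_add_left scaleC_add_right
        scaleC_scaleC scaleC_of_real)+
  show "cinner f g = cnj (cinner g f)"
    unfolding cinner_ell2Z_def infsum_cnj[symmetric] by (subst cinner_commute) simp
  show "cinner (f + g) h = cinner f h + cinner g h"
    by (simp add: cinner_ell2Z_def coord_simps cinner_add_left infsum_add cinner_summable)
  show "cinner (c *\<^sub>C f) g = c * cinner f g"
    by (simp add: cinner_ell2Z_def scaleC_ell2Z.rep_eq cinner_scaleC_left infsum_cmult_right
        cinner_summable)
  show "inner f g = Re (cinner f g)"
    by (simp add: cinner_ell2Z_def inner_ell2Z_def inner_eq_Re_cinner infsum_Re cinner_summable)
qed

end

lift_definition single :: "int \<Rightarrow> 'a \<Rightarrow> 'a::chilbert_space ell2Z" is "\<lambda>j v n. if n = j then v else 0"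
  by (rule finite_nonzero_values_imp_summable_on) simp

lemma norm_single: "norm (single j v) = norm v"
proof -
  have "(norm (single j v))\<^sup>2 = (\<Sum>\<^sub>\<infinity>n. if n = j then (norm v)\<^sup>2 else 0)"
    unfolding norm_ell2Z_sq by (rule infsum_cong) (simp add: single.rep_eq)
  also have "\<dots> = (\<Sum>\<^sub>\<infinity>n\<in>{j}. (norm v)\<^sup>2)"
    by (rule infsum_cong_neutral) auto
  finally show ?thesis by simp
qed

lemma bounded_linear_single: "bounded_linear (single j)"
  by (rule bounded_linear_intro[where K=1])
    (auto intro!: ell2Z_eqI simp: norm_single coord_simps single.rep_eq)

lemma bounded_linear_coord: "bounded_linear (\<lambda>x. coord x j)"
  by (rule bounded_linear_intro[where K=1]) (auto simp: norm_coord_le coord_simps)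

lemma coord_sum: "coord (sum f A) n = (\<Sum>a\<in>A. coord (f a) n)"
  by (rule linear_sum[OF bounded_linear.linear[OF bounded_linear_coord]])

lemma ell2Z_approx:
  assumes "e > 0"
  obtains F where "finite F" "norm (x - (\<Sum>n\<in>F. single n (coord x n))) < e"
proof -
  let ?f = "\<lambda>n. (norm (coord x n))\<^sup>2"
  have "(sum ?f \<longlongrightarrow> (norm x)\<^sup>2) (finite_subsets_at_top UNIV)"
    using has_sum_infsum[OF summable_coord[of x]] by (simp add: has_sum_def norm_ell2Z_sq)
  hence "\<forall>\<^sub>F F in finite_subsets_at_top UNIV. dist (sum ?f F) ((norm x)\<^sup>2) < e\<^sup>2"
    by (rule tendstoD) (use assms in simp)
  then obtain F where F: "finite F" "dist (sum ?f F) ((norm x)\<^sup>2) < e\<^sup>2"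
    by (auto simp: eventually_finite_subsets_at_top)
  let ?y = "x - (\<Sum>n\<in>F. single n (coord x n))"
  have c: "coord ?y n = (if n \<in> F then 0 else coord x n)" for n
    using F(1) by (simp add: coord_simps coord_sum single.rep_eq)
  have "(norm ?y)\<^sup>2 = infsum ?f (UNIV - F)"
    unfolding norm_ell2Z_sq c by (rule infsum_cong_neutral) auto
  also have "\<dots> = (norm x)\<^sup>2 - sum ?f F"
    unfolding norm_ell2Z_sq using F(1) by (subst infsum_Diff) (auto simp: summable_coord)
  also have "\<dots> < e\<^sup>2" using F(2) by (simp add: dist_real_def)
  finally have "norm ?y < e" by (rule power2_less_imp_less) (use assms in simp)
  thus thesis using that F(1) by blast
qed

text \<open>
  The type \<open>'a \<Rightarrow>\<^sub>L 'b\<close> consists of the bounded \<^emph>\<open>real\<close>-linear maps with the operator norm;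
  bounded operators between complex Hilbert spaces are its complex linear elements.
\<close>

definition complex_linear :: "'a::chilbert_space \<Rightarrow>\<^sub>L 'b::chilbert_space \<Rightarrow> bool" where
  "complex_linear A \<longleftrightarrow> (\<forall>c x. A (c *\<^sub>C x) = c *\<^sub>C A x)"

definition contraction :: "'a::chilbert_space \<Rightarrow>\<^sub>L 'b::chilbert_space \<Rightarrow> bool" where
  "contraction A \<longleftrightarrow> complex_linear A \<and> norm A \<le> 1"

lift_definition op_scaleC ::
  "complex \<Rightarrow> 'a::real_normed_vector \<Rightarrow>\<^sub>L 'b::chilbert_space \<Rightarrow> 'a \<Rightarrow>\<^sub>L 'b" is "\<lambda>c A x. c *\<^sub>C A x"
  by (rule bounded_linear_compose[OF bounded_linear_scaleC])

definition op_power :: "'a::chilbert_space \<Rightarrow>\<^sub>L 'a \<Rightarrow> nat \<Rightarrow> 'a \<Rightarrow>\<^sub>L 'a" where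
  "op_power A n = ((\<lambda>B. A o\<^sub>L B) ^^ n) id_blinfun"

definition op_poly :: "complex poly \<Rightarrow> 'a::chilbert_space \<Rightarrow>\<^sub>L 'a \<Rightarrow> 'a \<Rightarrow>\<^sub>L 'a" where
  "op_poly p A = (\<Sum>i\<le>degree p. op_scaleC (coeff p i) (op_power A i))"

definition op_adjoint :: "'a::chilbert_space \<Rightarrow>\<^sub>L 'b::chilbert_space \<Rightarrow> 'b \<Rightarrow>\<^sub>L 'a" where
  "op_adjoint A = (THE B :: 'b \<Rightarrow>\<^sub>L 'a. \<forall>x y. cinner (A x) y = cinner x (B y))"

definition op_positive :: "'a::chilbert_space \<Rightarrow>\<^sub>L 'a \<Rightarrow> bool" where
  "op_positive A \<longleftrightarrow> complex_linear A \<and> (\<forall>x. cinner (A x) x \<in> \<real> \<and> 0 \<le> Re (cinner (A x) x))"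

definition op_sqrt :: "'a::chilbert_space \<Rightarrow>\<^sub>L 'a \<Rightarrow> 'a \<Rightarrow>\<^sub>L 'a" where
  "op_sqrt A = (THE B. op_positive B \<and> B o\<^sub>L B = A)"

definition op_abs :: "'a::chilbert_space \<Rightarrow>\<^sub>L 'b::chilbert_space \<Rightarrow> 'a \<Rightarrow>\<^sub>L 'a" where
  "op_abs A = op_sqrt (op_adjoint A o\<^sub>L A)"

definition is_onb :: "'a::chilbert_space set \<Rightarrow> bool" where
  "is_onb B \<longleftrightarrow> (\<forall>e\<in>B. \<forall>f\<in>B. cinner e f = (if e = f then 1 else 0))
    \<and> closure (complex_vector.span B) = UNIV"

definition some_onb :: "'a::chilbert_space set" where
  "some_onb = (SOME B. is_onb B)"

text \<open>
  The notions below do not depend on the orthonormal basis: one basis suffices for membership in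
  the Hilbert--Schmidt and trace classes, and norm and trace are computed in an arbitrary fixed one.
\<close>

definition hilbert_schmidt :: "'a::chilbert_space \<Rightarrow>\<^sub>L 'b::chilbert_space \<Rightarrow> bool" where
  "hilbert_schmidt A \<longleftrightarrow> complex_linear A
    \<and> (\<exists>B. is_onb B \<and> (\<lambda>e. (norm (A e))\<^sup>2) summable_on B)"

definition hs_norm :: "'a::chilbert_space \<Rightarrow>\<^sub>L 'b::chilbert_space \<Rightarrow> real" where
  "hs_norm A = sqrt (\<Sum>\<^sub>\<infinity>e\<in>some_onb. (norm (A e))\<^sup>2)"

definition trace_class :: "'a::chilbert_space \<Rightarrow>\<^sub>L 'b::chilbert_space \<Rightarrow> bool" where
  "trace_class A \<longleftrightarrow> complex_linear A
    \<and> (\<exists>B. is_onb B \<and> (\<lambda>e. cinner (op_abs A e) e) summable_on B)"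

definition op_trace :: "'a::chilbert_space \<Rightarrow>\<^sub>L 'a \<Rightarrow> complex" where
  "op_trace A = (\<Sum>\<^sub>\<infinity>e\<in>some_onb. cinner (A e) e)"

definition has_block_matrix ::
  "'a::chilbert_space ell2Z \<Rightarrow>\<^sub>L 'a ell2Z \<Rightarrow> (int \<Rightarrow> int \<Rightarrow> 'a \<Rightarrow>\<^sub>L 'a) \<Rightarrow> bool" where
  "has_block_matrix U M \<longleftrightarrow> (\<forall>i j v. coord (U (single j v)) i = M i j v)"

definition defect :: "'a::chilbert_space \<Rightarrow>\<^sub>L 'a \<Rightarrow> 'a \<Rightarrow>\<^sub>L 'a" where
  "defect T = op_sqrt (id_blinfun - (op_adjoint T o\<^sub>L T))"

definition schaeffer_entry :: "'a::chilbert_space \<Rightarrow>\<^sub>L 'a \<Rightarrow> int \<Rightarrow> int \<Rightarrow> 'a \<Rightarrow>\<^sub>L 'a" where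
  "schaeffer_entry T i j =
    (if (i, j) = (0, 0) then T
     else if (i, j) = (-1, 0) then defect T
     else if (i, j) = (-1, 1) then - op_adjoint T
     else if (i, j) = (0, 1) then op_sqrt (id_blinfun - (T o\<^sub>L op_adjoint T))
     else if i \<noteq> 0 \<and> i \<noteq> -1 \<and> j = i + 1 then id_blinfun
     else 0)"

definition schaeffer :: "'a::chilbert_space \<Rightarrow>\<^sub>L 'a \<Rightarrow> 'a ell2Z \<Rightarrow>\<^sub>L 'a ell2Z" where
  "schaeffer T = (THE U. has_block_matrix U (schaeffer_entry T))"

lemma has_block_matrix_unique:
  assumes "has_block_matrix U M" "has_block_matrix U' M"
  shows "U = U'"
proof (rule blinfun_eqI)
  fix x
  define W where "W = U - U'"
  have W0: "W (single j v) = 0" for j v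
    using assms by (intro ell2Z_eqI)
      (simp add: W_def has_block_matrix_def blinfun.diff_left coord_simps)
  have "norm (W x) \<le> 0 + e" if e: "e > 0" for e
  proof -
    have pos: "norm W + 1 > 0" using norm_ge_zero[of W] by linarith
    then obtain F where "finite F"
      and F: "norm (x - (\<Sum>n\<in>F. single n (coord x n))) < e / (norm W + 1)"
      using ell2Z_approx[of "e / (norm W + 1)" x] e by auto
    have "W x = W (x - (\<Sum>n\<in>F. single n (coord x n)))"
      by (simp add: blinfun.diff_right blinfun.sum_right W0)
    also have "norm \<dots> \<le> norm W * norm (x - (\<Sum>n\<in>F. single n (coord x n)))"
      by (rule norm_blinfun)
    also have "\<dots> \<le> (norm W + 1) * (e / (norm W + 1))"
      using F by (intro mult_mono) auto
    finally show ?thesis using pos by simp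
  qed
  hence "norm (W x) \<le> 0" by (rule field_le_epsilon)
  thus "U x = U' x" by (simp add: W_def blinfun.diff_left)
qed

lift_definition shift :: "'a::chilbert_space ell2Z \<Rightarrow> 'a ell2Z" is "\<lambda>f n. f (n + 1)"
proof -
  fix f :: "int \<Rightarrow> 'a" assume "(\<lambda>n. (norm (f n))\<^sup>2) summable_on UNIV"
  thus "(\<lambda>n. (norm (f (n + 1)))\<^sup>2) summable_on UNIV"
    using summable_on_reindex_bij_betw[OF bij_plus_right, of "\<lambda>n. (norm (f n))\<^sup>2" 1] by blast
qed

lemma norm_shift: "norm (shift x) = norm x"
proof -
  have "(norm (shift x))\<^sup>2 = (norm x)\<^sup>2"
    unfolding norm_ell2Z_sq shift.rep_eq
    by (rule infsum_reindex_bij_betw[of "\<lambda>n. n + 1" UNIV UNIV]) (rule bij_plus_right)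
  thus ?thesis by simp
qed

lemma bounded_linear_shift: "bounded_linear shift"
  by (rule bounded_linear_intro[where K=1])
    (auto intro!: ell2Z_eqI simp: norm_shift coord_simps shift.rep_eq)

lemma has_block_matrix_schaeffer: "has_block_matrix (schaeffer T) (schaeffer_entry T)"
proof -
  let ?M = "schaeffer_entry T"
  define u where "u x = shift (x - single 0 (coord x 0) - single 1 (coord x 1))
    + single 0 (?M 0 0 (coord x 0) + ?M 0 1 (coord x 1))
    + single (-1) (?M (-1) 0 (coord x 0) + ?M (-1) 1 (coord x 1))" for x
  have "bounded_linear u"
    unfolding u_def
    by (intro bounded_linear_add bounded_linear_sub bounded_linear_ident
        bounded_linear_compose[OF bounded_linear_shift]
        bounded_linear_compose[OF bounded_linear_single]
        bounded_linear_compose[OF blinfun.bounded_linear_right] bounded_linear_coord)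
  hence B: "has_block_matrix (Blinfun u) ?M"
    by (auto simp: has_block_matrix_def bounded_linear_Blinfun_apply u_def coord_simps
        shift.rep_eq single.rep_eq schaeffer_entry_def)
  thus ?thesis
    unfolding schaeffer_def by (rule theI) (rule has_block_matrix_unique[OF _ B])
qed

text \<open>
  Differentiation is in \<open>'a \<Rightarrow>\<^sub>L 'a\<close>, i.e.\ in operator norm, and one-sided at \<open>0\<close>.
\<close>

definition remainder2 ::
  "complex poly \<Rightarrow> 'a::chilbert_space \<Rightarrow>\<^sub>L 'a \<Rightarrow> 'a \<Rightarrow>\<^sub>L 'a \<Rightarrow> 'a \<Rightarrow>\<^sub>L 'a" where
  "remainder2 p T0 T = op_poly p T - op_poly p T0
    - vector_derivative (\<lambda>s. op_poly p (T0 + s *\<^sub>R (T - T0))) (at 0 within {0..1})"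

lemma bounded_linear_op_scaleC: "bounded_linear (op_scaleC c)"
proof (rule bounded_linear_intro[where K="cmod c"])
  fix A :: "'a \<Rightarrow>\<^sub>L 'b"
  have "norm (op_scaleC c A x) \<le> cmod c * norm A * norm x" for x
    using mult_left_mono[OF norm_blinfun[of A x], of "cmod c"]
    by (simp add: op_scaleC.rep_eq norm_scaleC mult.assoc)
  thus "norm (op_scaleC c A) \<le> norm A * cmod c"
    by (intro norm_blinfun_bound) (simp_all add: mult.commute)
qed (auto intro!: blinfun_eqI simp: op_scaleC.rep_eq blinfun.add_left blinfun.scaleR_left
    scaleC_add_right bounded_linear.linear[OF bounded_linear_scaleC, THEN linear_scale])

lemma op_poly_line_differentiable:
  "(\<lambda>s. op_poly p (T0 + s *\<^sub>R V)) differentiable at r within S" for r :: real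
proof -
  have pw: "(\<lambda>s. op_power (T0 + s *\<^sub>R V) n) differentiable at r within S" for n
  proof (induction n)
    case (Suc n)
    have l: "(\<lambda>s. T0 + s *\<^sub>R V) differentiable at r within S"
      by (intro derivative_intros)
    show ?case
      using bounded_bilinear.FDERIV[OF bounded_bilinear_blinfun_compose] l Suc.IH
      unfolding op_power_def differentiable_def funpow.simps o_def by blast
  qed (simp add: op_power_def)
  show ?thesis
    unfolding op_poly_def
  proof (intro differentiable_sum ballI finite_atMost)
    fix i
    show "(\<lambda>s. op_scaleC (coeff p i) (op_power (T0 + s *\<^sub>R V) i)) differentiable at r within S"
      using pw[of i] bounded_linear.has_derivative[OF bounded_linear_op_scaleC]
      unfolding differentiable_def by blast
  qed
qed

lemma remainder2_derivative:
  "((\<lambda>s. op_poly p (T0 + s *\<^sub>R (T - T0))) has_vector_derivative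
      op_poly p T - op_poly p T0 - remainder2 p T0 T) (at 0 within {0..1})"
  using vector_derivative_works[THEN iffD1, OF op_poly_line_differentiable[of p T0 "T - T0" 0 "{0..1}"]]
  by (simp add: remainder2_def)

text \<open>
  A function on the unit circle is represented by a function on \<open>\<complex>\<close>; only its values on the circle matter.
\<close>

definition L1_circle :: "(complex \<Rightarrow> complex) \<Rightarrow> bool" where
  "L1_circle f \<longleftrightarrow> (\<lambda>t. f (cis t)) absolutely_integrable_on {0..2*pi}"

definition L1_circle_norm :: "(complex \<Rightarrow> complex) \<Rightarrow> real" where
  "L1_circle_norm f = (LINT t:{0..2*pi}|lebesgue. cmod (f (cis t)))"

definition circle_integral :: "(complex \<Rightarrow> complex) \<Rightarrow> complex" where
  "circle_integral f = (LINT t:{0..2*pi}|lebesgue. f (cis t) * (\<i> * cis t))"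

definition fourier_coeff :: "(complex \<Rightarrow> complex) \<Rightarrow> int \<Rightarrow> complex" where
  "fourier_coeff f n =
    (LINT t:{0..2*pi}|lebesgue. f (cis t) * cis (- (of_int n * t))) / of_real (2 * pi)"

definition H1_circle :: "(complex \<Rightarrow> complex) \<Rightarrow> bool" where
  "H1_circle f \<longleftrightarrow> L1_circle f \<and> (\<forall>n<0. fourier_coeff f n = 0)"

definition second_order_trace_formula ::
  "'a::chilbert_space \<Rightarrow>\<^sub>L 'a \<Rightarrow> 'a \<Rightarrow>\<^sub>L 'a \<Rightarrow> (complex \<Rightarrow> complex) \<Rightarrow> bool" where
  "second_order_trace_formula T0 T \<eta> \<longleftrightarrow>
    (\<forall>p :: complex poly. op_trace (remainder2 p T0 T)
        = circle_integral (\<lambda>z. poly (pderiv (pderiv p)) z * \<eta> z))"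

end

theory Submission
  imports Defs
begin

text \<open>
  Only \<open>V = T - T\<^sub>0\<close> being Hilbert--Schmidt is used. On the Hilbert space of Hilbert--Schmidt operators
  the maps \<open>C\<^sub>s\<^sub>,\<^sub>u X = u T\<^sub>s X + (1 - u) X T\<^sub>s\<close> are contractions, and two integrations give
  \<open>Tr (T\<^sup>n - T\<^sub>0\<^sup>n - (d/ds) T\<^sub>s\<^sup>n) = n (n - 1) \<integral>\<integral> (1 - s) \<langle>C\<^sub>s\<^sub>,\<^sub>u\<^sup>n\<^sup>-\<^sup>2 V, V\<^sup>*\<rangle> du ds\<close>. So, up to a factor \<open>2 \<pi> i\<close>,
  the negative Fourier coefficients of \<open>\<eta>\<close> must be \<open>g\<^sub>m = \<integral>\<integral> (1 - s) \<langle>C\<^sub>s\<^sub>,\<^sub>u\<^sup>m V, V\<^sup>*\<rangle> du ds\<close>.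
  The Fejer sums of the powers of a contraction are positive, hence the Fejer means of \<open>g\<close> extend to
  trigonometric polynomials of normalised \<open>L\<^sup>1\<close> norm at most \<open>\<parallel>V\<parallel>\<^sub>2\<^sup>2 / 2\<close>. They converge in \<open>L\<^sup>1\<close> modulo
  analytic terms because \<open>g\<close> is a limit of square-summable sequences: strict convexity gives
  \<open>s (1 - s) V V\<^sup>* \<le> I - T\<^sub>s T\<^sub>s\<^sup>*\<close>, so for \<open>P\<close> of finite rank \<open>\<Sum>\<^sub>m \<bar>\<langle>C\<^sup>m V P, V\<^sup>*\<rangle>\<bar>\<^sup>2\<close> telescopes.
\<close>

section \<open>Orthonormal bases and adjoints\<close>

text \<open>The maps \<open>X \<mapsto> T_s X\<close> and \<open>X \<mapsto> X T_s\<close> commute,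
  so the divided differences of a power, sums of \<open>T_s^d V T_s^(m-d)\<close>, are
  \<open>m + 1\<close> times an average of powers of one contraction. This brings a problem about
  two noncommuting operators within reach of the Fejer positivity valid for a single contraction.

  Uniform boundedness of the Fejer means is not enough: a weak limit is only a measure, and analytic
  terms cannot remove its singular part. Staying in \<open>L^1\<close> requires convergence in the
  quotient norm, hence approximants for which the Fejer means converge strongly. The products
  \<open>V P\<close> serve because \<open>V\<close> can be moved across the pairing, where its
  adjoint acts on an orbit of the adjoint contraction; that is exactly the quantity which strict
  convexity makes square-summable.

  The constant \<open>1/2\<close> is the total mass of \<open>(1 - s) du ds\<close>, as
  \<open>V\<close> and its adjoint have equal norms. The \<epsilon> pays for the approximation, so
  that an actual function is produced and not only an infimum.\<close>

instance chilbert_space \<subseteq> banach ..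

lemma cinner_commute': "cnj (cinner x y) = cinner y x"
  using cinner_commute[of y x] by simp

lemma cinner_add_right: "cinner x (y + z) = cinner x y + cinner x z"
  by (subst (1 2 3) cinner_commute) (simp add: cinner_add_left)

lemma cinner_scaleC_right: "cinner x (c *\<^sub>C y) = cnj c * cinner x y"
  by (subst (1 2) cinner_commute) (simp add: cinner_scaleC_left)

lemma scaleC_real: "r *\<^sub>R x = complex_of_real r *\<^sub>C x" for x :: "'a::chilbert_space"
  by (simp add: scaleC_of_real)

lemma bounded_bilinear_cinner: "bounded_bilinear (cinner :: 'a::chilbert_space \<Rightarrow> 'a \<Rightarrow> complex)"
proof
  fix a b :: 'a and r :: real
  show "\<exists>K. \<forall>a b::'a. cmod (cinner a b) \<le> norm a * norm b * K"
    by (rule exI[of _ 1]) (simp add: cmod_cinner_le)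
  show "cinner (r *\<^sub>R a) b = r *\<^sub>R cinner a b" "cinner a (r *\<^sub>R b) = r *\<^sub>R cinner a b"
    unfolding scaleC_real[where 'a='a] scaleR_conv_of_real
    by (simp_all add: cinner_scaleC_left cinner_scaleC_right)
qed (simp_all add: cinner_add_left cinner_add_right)

interpretation cinner: bounded_bilinear "cinner :: 'a::chilbert_space \<Rightarrow> 'a \<Rightarrow> complex"
  by (rule bounded_bilinear_cinner)

lemma cinner_self: "cinner x x = complex_of_real ((norm x)\<^sup>2)"
proof -
  have "cinner x x \<in> \<real>"
    using cinner_commute[of x x] by (metis Reals_cnj_iff)
  thus ?thesis
    using inner_eq_Re_cinner[of x x] by (simp add: power2_norm_eq_inner)
qed

lemma cinner_self_zero_iff [simp]: "cinner x x = 0 \<longleftrightarrow> x = 0"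
  by (simp add: cinner_self)

lemma cinner_eqI_right: "(\<And>z. cinner z x = cinner z y) \<Longrightarrow> x = y"
  by (metis cinner.diff_right cinner_self_zero_iff right_minus_eq)

section \<open>Bessel's inequality, basis expansions and existence of orthonormal bases\<close>

definition orthonormal :: "'a::chilbert_space set \<Rightarrow> bool" where
  "orthonormal B \<longleftrightarrow> (\<forall>e\<in>B. \<forall>f\<in>B. cinner e f = (if e = f then 1 else 0))"

lemma is_onb_orthonormal: "is_onb B \<Longrightarrow> orthonormal B"
  by (simp add: is_onb_def orthonormal_def)

lemma orthonormal_norm: "orthonormal B \<Longrightarrow> e \<in> B \<Longrightarrow> norm e = 1"
proof -
  assume "orthonormal B" "e \<in> B"
  hence "complex_of_real ((norm e)\<^sup>2) = 1"
    unfolding cinner_self[symmetric] by (simp add: orthonormal_def)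
  hence "(norm e)\<^sup>2 = 1\<^sup>2" unfolding of_real_eq_1_iff by simp
  thus "norm e = 1" by (subst (asm) power2_eq_iff_nonneg) simp_all
qed

lemma norm_sum_orthonormal:
  assumes "orthonormal B" "F \<subseteq> B" "finite F"
  shows "(norm (\<Sum>e\<in>F. c e *\<^sub>C e))\<^sup>2 = (\<Sum>e\<in>F. (cmod (c e))\<^sup>2)"
proof -
  have "cinner (\<Sum>e\<in>F. c e *\<^sub>C e) (\<Sum>f\<in>F. c f *\<^sub>C f) = (\<Sum>e\<in>F. \<Sum>f\<in>F. c e * cnj (c f) * cinner e f)"
    unfolding cinner.sum_left unfolding cinner.sum_right cinner_scaleC_left cinner_scaleC_right
    by (simp only: mult_ac)
  also have "\<dots> = (\<Sum>e\<in>F. \<Sum>f\<in>F. if e = f then c e * cnj (c f) else 0)"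
    using assms by (intro sum.cong refl) (auto simp: orthonormal_def subset_iff)
  also have "\<dots> = (\<Sum>e\<in>F. of_real ((cmod (c e))\<^sup>2))"
    using assms(3) by (intro sum.cong refl) (simp add: sum.delta' complex_norm_square del: of_real_power)
  finally show ?thesis
    unfolding cinner_self of_real_sum[symmetric] of_real_eq_iff .
qed

lemma bessel_finite:
  assumes "orthonormal B" "F \<subseteq> B" "finite F"
  shows "(\<Sum>e\<in>F. (cmod (cinner x e))\<^sup>2) \<le> (norm x)\<^sup>2"
proof -
  let ?p = "\<Sum>e\<in>F. cinner x e *\<^sub>C e"
  have "cinner x ?p = (\<Sum>e\<in>F. of_real ((cmod (cinner x e))\<^sup>2))"
    by (simp only: cinner.sum_right cinner_scaleC_right complex_norm_square mult.commute)
  hence 1: "cinner x ?p = of_real (\<Sum>e\<in>F. (cmod (cinner x e))\<^sup>2)" by simp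
  have "(norm (x - ?p))\<^sup>2 = (norm x)\<^sup>2 + (norm ?p)\<^sup>2 - 2 * inner x ?p"
    by (simp add: power2_norm_eq_inner inner_diff_left inner_diff_right inner_commute)
  also have "\<dots> = (norm x)\<^sup>2 - (\<Sum>e\<in>F. (cmod (cinner x e))\<^sup>2)"
    unfolding inner_eq_Re_cinner 1 norm_sum_orthonormal[OF assms] by simp
  finally show ?thesis by (smt (verit) zero_le_power2)
qed

lemma bessel_summable:
  assumes "orthonormal B"
  shows "(\<lambda>e. (cmod (cinner x e))\<^sup>2) summable_on B"
  by (rule nonneg_bdd_above_summable_on)
    (auto intro!: bdd_aboveI2[where M="(norm x)\<^sup>2"] bessel_finite[OF assms])

text \<open>Disjoint pieces of an orthogonal series are orthogonal, so it is Cauchy when the coefficients are square-summable.\<close>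

lemma orthonormal_series_summable:
  assumes B: "orthonormal B" and s: "(\<lambda>e. (cmod (c e))\<^sup>2) summable_on B"
  shows "(\<lambda>e. c e *\<^sub>C e) summable_on B"
proof -
  let ?f = "\<lambda>e. c e *\<^sub>C e" and ?g = "\<lambda>e. (cmod (c e))\<^sup>2"
  define L where "L = infsum ?g B"
  have lim: "(sum ?g \<longlongrightarrow> L) (finite_subsets_at_top B)"
    using has_sum_infsum[OF s] by (simp add: has_sum_def L_def)
  have "\<exists>P. eventually P (finite_subsets_at_top B) \<and>
              (\<forall>F F'. P F \<and> P F' \<longrightarrow> dist (sum ?f F) (sum ?f F') < e)" if e: "e > 0" for e
  proof -
    have "\<forall>\<^sub>F F in finite_subsets_at_top B. dist (sum ?g F) L < (e/2)\<^sup>2"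
      by (rule tendstoD[OF lim]) (use e in simp)
    then obtain F0 where F0: "finite F0" "F0 \<subseteq> B"
      and d: "\<And>F. finite F \<Longrightarrow> F0 \<subseteq> F \<Longrightarrow> F \<subseteq> B \<Longrightarrow> dist (sum ?g F) L < (e/2)\<^sup>2"
      by (auto simp: eventually_finite_subsets_at_top)
    have le: "sum ?g F \<le> L" if "finite F" "F \<subseteq> B" for F
      unfolding L_def by (rule finite_sum_le_infsum) (use s that in auto)
    have near: "dist (sum ?f F) (sum ?f F0) < e/2" if F: "finite F" "F0 \<subseteq> F" "F \<subseteq> B" for F
    proof -
      have "(dist (sum ?f F) (sum ?f F0))\<^sup>2 = (norm (sum ?f (F - F0)))\<^sup>2"
        unfolding dist_norm by (simp add: sum_diff F)
      also have "\<dots> = sum ?g (F - F0)"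
        by (rule norm_sum_orthonormal[OF B]) (use F in auto)
      also have "\<dots> = sum ?g F - sum ?g F0" by (simp add: sum_diff F)
      also have "\<dots> < (e/2)\<^sup>2"
        using le[OF F(1,3)] d[OF F0(1) order.refl F0(2)] by (simp add: dist_real_def)
      finally show ?thesis by (rule power2_less_imp_less) (use e in simp)
    qed
    show ?thesis
    proof (intro exI conjI allI impI)
      show "eventually (\<lambda>F. finite F \<and> F0 \<subseteq> F \<and> F \<subseteq> B) (finite_subsets_at_top B)"
        using F0 by (auto simp: eventually_finite_subsets_at_top)
      show "dist (sum ?f F) (sum ?f F') < e" if "(finite F \<and> F0 \<subseteq> F \<and> F \<subseteq> B) \<and> (finite F' \<and> F0 \<subseteq> F' \<and> F' \<subseteq> B)" for F F'
        using near[of F] near[of F'] that dist_triangle2[of "sum ?f F" "sum ?f F'" "sum ?f F0"] by auto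
    qed
  qed
  then have \<open>cauchy_filter (filtermap (sum ?f) (finite_subsets_at_top B))\<close>
    by (simp add: cauchy_filter_metric_filtermap)
  moreover have "complete (UNIV::'a set)"
    by (meson Cauchy_convergent UNIV_I complete_def convergent_def)
  ultimately obtain L' where \<open>(sum ?f \<longlongrightarrow> L') (finite_subsets_at_top B)\<close>
    using complete_uniform[where S=UNIV] by (force simp add: filterlim_def)
  then show ?thesis
    using summable_on_def has_sum_def by blast
qed

lemma has_sum_cinner_left:
  "(f has_sum s) A \<Longrightarrow> ((\<lambda>i. cinner (f i) y) has_sum cinner s y) A"
  by (rule has_sum_bounded_linear[OF cinner.bounded_linear_left])

lemma has_sum_cinner_right:
  "(f has_sum s) A \<Longrightarrow> ((\<lambda>i. cinner y (f i)) has_sum cinner y s) A"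
  by (rule has_sum_bounded_linear[OF cinner.bounded_linear_right])

lemma orthonormal_series_coeff:
  assumes B: "orthonormal B" and s: "((\<lambda>e. c e *\<^sub>C e) has_sum x) B" and f: "f \<in> B"
  shows "cinner x f = c f"
proof -
  have "((\<lambda>e. c e * cinner e f) has_sum cinner x f) B"
    using has_sum_cinner_left[OF s, of f] by (simp add: cinner_scaleC_left)
  moreover have "((\<lambda>e. c e * cinner e f) has_sum c f) B \<longleftrightarrow> ((\<lambda>e. c e) has_sum c f) {f}"
    by (rule has_sum_cong_neutral) (use B f in \<open>auto simp: orthonormal_def\<close>)
  moreover have "((\<lambda>e. c e) has_sum c f) {f}"
    by (rule has_sum_finiteI) auto
  ultimately show ?thesis using has_sum_unique by blast
qed

text \<open>\<open>p\<close> is the orthogonal projection to the closed span of \<open>B\<close>.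
  The residue \<open>x - p\<close> is used twice: it vanishes for a basis, and it would enlarge a
  maximal orthonormal set.\<close>

lemma orthonormal_residue:
  assumes B: "orthonormal B"
  obtains p where "((\<lambda>e. cinner x e *\<^sub>C e) has_sum p) B" "\<And>e. e \<in> B \<Longrightarrow> cinner (x - p) e = 0"
proof -
  have "((\<lambda>e. cinner x e *\<^sub>C e) has_sum infsum (\<lambda>e. cinner x e *\<^sub>C e) B) B"
    by (rule has_sum_infsum[OF orthonormal_series_summable[OF B bessel_summable[OF B]]])
  from that[OF this] orthonormal_series_coeff[OF B this] show thesis
    by (simp add: cinner.diff_left)
qed

text \<open>The vectors orthogonal to \<open>x\<close> form a closed subspace containing
  \<open>B\<close>, hence the whole space.\<close>

lemma onb_zero:
  assumes B: "is_onb B" and z: "\<And>e. e \<in> B \<Longrightarrow> cinner x e = 0"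
  shows "x = 0"
proof -
  have "complex_vector.span B \<subseteq> {y. cinner x y = 0}"
  proof
    fix y assume "y \<in> complex_vector.span B"
    then show "y \<in> {y. cinner x y = 0}"
    proof (induction rule: complex_vector.span_induct_alt)
      case base
      show ?case by (simp add: cinner.zero_right)
    next
      case (step c a y)
      then show ?case using z by (simp add: cinner_add_right cinner_scaleC_right)
    qed
  qed
  moreover have "closed {y. cinner x y = 0}"
    by (intro closed_Collect_eq continuous_intros linear_continuous_on cinner.bounded_linear_right)
  ultimately have "closure (complex_vector.span B) \<subseteq> {y. cinner x y = 0}"
    by (rule closure_minimal)
  moreover have "closure (complex_vector.span B) = UNIV" using B by (simp add: is_onb_def)
  ultimately have "x \<in> {y. cinner x y = 0}" by blast
  thus ?thesis by simp
qed

lemma onb_expansion: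
  assumes "is_onb B"
  shows "((\<lambda>e. cinner x e *\<^sub>C e) has_sum x) B"
proof -
  obtain p where p: "((\<lambda>e. cinner x e *\<^sub>C e) has_sum p) B" "\<And>e. e \<in> B \<Longrightarrow> cinner (x - p) e = 0"
    using orthonormal_residue[OF is_onb_orthonormal[OF assms]] by blast
  from onb_zero[OF assms p(2)] p(1) show ?thesis by simp
qed

lemma onb_cinner:
  assumes "is_onb B"
  shows "((\<lambda>e. cinner x e * cinner e y) has_sum cinner x y) B"
  using has_sum_cinner_left[OF onb_expansion[OF assms]] by (simp add: cinner_scaleC_left)

lemma parseval:
  assumes "is_onb B"
  shows "((\<lambda>e. (cmod (cinner x e))\<^sup>2) has_sum (norm x)\<^sup>2) B"
proof -
  have "((\<lambda>e. of_real ((cmod (cinner x e))\<^sup>2)) has_sum complex_of_real ((norm x)\<^sup>2)) B"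
    using onb_cinner[OF assms, of x x]
    by (simp only: complex_norm_square cinner_commute'[of x] flip: cinner_self)
  thus ?thesis by (simp only: has_sum_of_real_iff)
qed

text \<open>A maximal orthonormal set, given by Zorn's lemma, is total: a nonzero residue could be
  normalised and adjoined.\<close>

lemma onb_exists: "\<exists>B :: 'a::chilbert_space set. is_onb B"
proof -
  let ?A = "{B :: 'a set. orthonormal B}"
  have "\<exists>M\<in>?A. \<forall>X\<in>?A. M \<subseteq> X \<longrightarrow> X = M"
  proof (rule subset_Zorn_nonempty)
    show "?A \<noteq> {}" by (auto simp: orthonormal_def intro!: exI[of _ "{}"])
  next
    fix \<C> assume C: "\<C> \<noteq> {}" "subset.chain ?A \<C>"
    show "\<Union>\<C> \<in> ?A"
      unfolding mem_Collect_eq orthonormal_def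
    proof (intro ballI)
      fix e f assume "e \<in> \<Union>\<C>" "f \<in> \<Union>\<C>"
      then obtain X where "X \<in> \<C>" "e \<in> X" "f \<in> X"
        using C by (auto simp: subset_chain_def) (metis subsetD)
      moreover have "orthonormal X" using C \<open>X \<in> \<C>\<close> by (auto simp: subset_chain_def)
      ultimately show "cinner e f = (if e = f then 1 else 0)" by (simp add: orthonormal_def)
    qed
  qed
  then obtain M :: "'a set" where M: "orthonormal M"
    and max: "\<And>X. orthonormal X \<Longrightarrow> M \<subseteq> X \<Longrightarrow> X = M" by blast
  have "x \<in> closure (complex_vector.span M)" for x
  proof -
    obtain p where p: "((\<lambda>e. cinner x e *\<^sub>C e) has_sum p) M" "\<And>e. e \<in> M \<Longrightarrow> cinner (x - p) e = 0"
      using orthonormal_residue[OF M] by blast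
    have "x = p"
    proof (rule ccontr)
      assume ne: "x \<noteq> p"
      define r where "r = complex_of_real (inverse (norm (x - p))) *\<^sub>C (x - p)"
      have 1: "cinner r r = 1"
        using ne by (simp add: cinner_self r_def norm_scaleC norm_inverse)
      have 2: "cinner r e = 0" "cinner e r = 0" if "e \<in> M" for e
        using p(2)[OF that] cinner_commute'[of "x - p" e]
        by (simp_all add: r_def cinner_scaleC_left cinner_scaleC_right)
      have "orthonormal (insert r M)"
        using M 1 2 by (auto simp: orthonormal_def)
      from max[OF this] have "r \<in> M" by auto
      from 2(1)[OF this] 1 show False by simp
    qed
    moreover have "p \<in> closure (complex_vector.span M)"
    proof (rule Lim_in_closed_set[OF closed_closure])
      show "(sum (\<lambda>e. cinner x e *\<^sub>C e) \<longlongrightarrow> p) (finite_subsets_at_top M)"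
        using p(1) by (simp add: has_sum_def)
      show "\<forall>\<^sub>F F in finite_subsets_at_top M. (\<Sum>e\<in>F. cinner x e *\<^sub>C e) \<in> closure (complex_vector.span M)"
        by (intro eventually_finite_subsets_at_top_weakI subsetD[OF closure_subset]
            complex_vector.span_sum complex_vector.span_scale complex_vector.span_base) auto
    qed simp
    ultimately show ?thesis by simp
  qed
  hence "is_onb M" using M by (auto simp: is_onb_def orthonormal_def)
  thus ?thesis ..
qed

lemma is_onb_some_onb: "is_onb some_onb"
  unfolding some_onb_def by (rule someI_ex[OF onb_exists])

subsection \<open>Complex linear operators\<close>

lemma complex_linearD: "complex_linear A \<Longrightarrow> A (c *\<^sub>C x) = c *\<^sub>C A x"
  by (simp add: complex_linear_def)

lemma complex_linear_zero [simp]: "complex_linear 0"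
  by (simp add: complex_linear_def scaleC_add_left complex_vector.scale_zero_right)

lemma complex_linear_id [simp]: "complex_linear id_blinfun"
  by (simp add: complex_linear_def)

lemma complex_linear_add: "complex_linear A \<Longrightarrow> complex_linear B \<Longrightarrow> complex_linear (A + B)"
  by (simp add: complex_linear_def blinfun.add_left scaleC_add_right)

lemma complex_linear_diff: "complex_linear A \<Longrightarrow> complex_linear B \<Longrightarrow> complex_linear (A - B)"
  by (simp add: complex_linear_def blinfun.diff_left complex_vector.scale_right_diff_distrib)

lemma complex_linear_compose: "complex_linear A \<Longrightarrow> complex_linear B \<Longrightarrow> complex_linear (A o\<^sub>L B)"
  by (simp add: complex_linear_def)

lemma complex_linear_scaleC: "complex_linear A \<Longrightarrow> complex_linear (op_scaleC c A)"
  by (simp add: complex_linear_def op_scaleC.rep_eq scaleC_scaleC mult.commute)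

lemma op_scaleC_of_real: "op_scaleC (complex_of_real r) A = r *\<^sub>R A"
  by (rule blinfun_eqI) (simp add: op_scaleC.rep_eq scaleC_of_real blinfun.scaleR_left)

lemma complex_linear_scaleR: "complex_linear A \<Longrightarrow> complex_linear (r *\<^sub>R A)"
  using complex_linear_scaleC[of A "complex_of_real r"] by (simp add: op_scaleC_of_real)

lemma complex_linear_uminus: "complex_linear A \<Longrightarrow> complex_linear (- A)"
  using complex_linear_scaleR[of A "-1"] by simp

lemma complex_linear_sum: "(\<And>i. i \<in> I \<Longrightarrow> complex_linear (f i)) \<Longrightarrow> complex_linear (\<Sum>i\<in>I. f i)"
  by (induction I rule: infinite_finite_induct) (auto intro: complex_linear_add)

lemma complex_linear_lim:
  assumes "X \<longlonglongrightarrow> A" "\<And>n. complex_linear (X n)"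
  shows "complex_linear A"
  unfolding complex_linear_def
proof (intro allI)
  fix c x
  have "(\<lambda>n. X n (c *\<^sub>C x)) \<longlonglongrightarrow> A (c *\<^sub>C x)"
    by (intro tendsto_intros assms)
  moreover have "(\<lambda>n. c *\<^sub>C X n x) \<longlonglongrightarrow> c *\<^sub>C A x"
    by (intro bounded_linear.tendsto[OF bounded_linear_scaleC] tendsto_intros assms)
  ultimately show "A (c *\<^sub>C x) = c *\<^sub>C A x"
    using assms(2) by (simp add: complex_linear_def LIMSEQ_unique)
qed

section \<open>Existence and algebra of adjoints\<close>

lemma norm_adjoint_value_le:
  fixes A :: "'a::chilbert_space \<Rightarrow>\<^sub>L 'b::chilbert_space"
  assumes "cinner (blinfun_apply A z) y = cinner z z"
  shows "norm z \<le> norm A * norm y"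
proof -
  have "(norm z)\<^sup>2 = cmod (cinner (A z) y)" by (simp add: assms cinner_self norm_power)
  also have "\<dots> \<le> norm (A z) * norm y" by (rule cmod_cinner_le)
  also have "\<dots> \<le> norm A * norm z * norm y" by (intro mult_right_mono norm_blinfun) auto
  finally have "norm z * norm z \<le> (norm A * norm y) * norm z"
    by (simp add: power2_eq_square mult_ac)
  thus ?thesis by (cases "norm z = 0") (auto simp: mult_le_cancel_right)
qed

text \<open>The adjoint is assembled from its coefficients: its value at \<open>y\<close> must have
  coefficient \<open>cinner y (A e)\<close> at \<open>e\<close>. If \<open>S\<close> is a partial
  sum of their squares, applying \<open>A\<close> to the partial series gives
  \<open>S \<le> norm A * norm y * sqrt S\<close>, which bounds \<open>S\<close>.\<close>

lemma adjoint_exists: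
  fixes A :: "'a::chilbert_space \<Rightarrow>\<^sub>L 'b::chilbert_space"
  assumes A: "complex_linear A"
  shows "\<exists>B. \<forall>x y. cinner (A x) y = cinner x (blinfun_apply B y)"
proof -
  let ?B = "some_onb :: 'a set"
  have B: "orthonormal ?B" by (rule is_onb_orthonormal[OF is_onb_some_onb])
  have fin: "(\<Sum>e\<in>F. (cmod (cinner y (A e)))\<^sup>2) \<le> (norm A * norm y)\<^sup>2" if F: "F \<subseteq> ?B" "finite F" for F y
  proof -
    define w where "w = (\<Sum>e\<in>F. cinner y (A e) *\<^sub>C e)"
    define S where "S = (\<Sum>e\<in>F. (cmod (cinner y (A e)))\<^sup>2)"
    have "cinner (A w) y = (\<Sum>e\<in>F. of_real ((cmod (cinner y (A e)))\<^sup>2))"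
      unfolding w_def by (simp only: blinfun.sum_right cinner.sum_left complex_linearD[OF A]
          cinner_scaleC_left complex_norm_square cinner_commute'[of y])
    hence "cinner (A w) y = of_real S" by (simp add: S_def)
    moreover have S0: "S \<ge> 0" by (simp add: S_def sum_nonneg)
    ultimately have "S \<le> norm (A w) * norm y"
      using cmod_cinner_le[of "A w" y] by simp
    also have "\<dots> \<le> norm A * norm w * norm y"
      by (intro mult_right_mono norm_blinfun) auto
    also have "norm w = sqrt S"
      unfolding S_def norm_sum_orthonormal[OF B F, symmetric] w_def by simp
    finally have le: "S \<le> norm A * norm y * sqrt S" by (simp add: mult_ac)
    have "sqrt S \<le> norm A * norm y"
    proof (cases "S = 0")
      case False
      hence "sqrt S > 0" using S0 by simp
      moreover have "sqrt S * sqrt S \<le> norm A * norm y * sqrt S" using le S0 by simp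
      ultimately show ?thesis by (rule mult_right_le_imp_le[rotated])
    qed simp
    hence "(sqrt S)\<^sup>2 \<le> (norm A * norm y)\<^sup>2" by (rule power_mono) (simp add: S0)
    thus ?thesis using S0 by (simp add: S_def)
  qed
  have "(\<lambda>e. (cmod (cinner y (A e)))\<^sup>2) summable_on ?B" for y
    by (rule nonneg_bdd_above_summable_on) (auto intro!: bdd_aboveI2 fin)
  note summ = has_sum_infsum[OF orthonormal_series_summable[OF B this]]
  define g where "g y = infsum (\<lambda>e. cinner y (A e) *\<^sub>C e) ?B" for y
  have g: "((\<lambda>e. cinner y (A e) *\<^sub>C e) has_sum g y) ?B" for y
    unfolding g_def by (rule summ)
  have adj: "cinner (A x) y = cinner x (g y)" for x y
  proof -
    have "((\<lambda>e. cinner (A (cinner x e *\<^sub>C e)) y) has_sum cinner (A x) y) ?B"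
      by (intro has_sum_cinner_left has_sum_bounded_linear[OF blinfun.bounded_linear_right]
          onb_expansion is_onb_some_onb)
    moreover have "((\<lambda>e. cinner x (cinner y (A e) *\<^sub>C e)) has_sum cinner x (g y)) ?B"
      by (rule has_sum_cinner_right[OF g])
    moreover have "cinner (A (cinner x e *\<^sub>C e)) y = cinner x (cinner y (A e) *\<^sub>C e)" for e
      by (simp add: complex_linearD[OF A] cinner_scaleC_left cinner_scaleC_right cinner_commute' mult.commute)
    ultimately show ?thesis by (simp only: has_sum_unique)
  qed
  have "bounded_linear g"
  proof (rule bounded_linear_intro)
    show "g (x + y) = g x + g y" for x y
      by (rule cinner_eqI_right) (simp add: cinner_add_right flip: adj)
    show "g (r *\<^sub>R x) = r *\<^sub>R g x" for r x
      by (rule cinner_eqI_right) (simp add: cinner.scaleR_right flip: adj)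
    show "norm (g y) \<le> norm y * norm A" for y
      using norm_adjoint_value_le[of A "g y" y, OF adj] by (simp add: mult.commute)
  qed
  thus ?thesis using adj by (intro exI[of _ "Blinfun g"]) (simp add: bounded_linear_Blinfun_apply)
qed

lemma op_adjoint:
  assumes "complex_linear A"
  shows "cinner (A x) y = cinner x (op_adjoint A y)"
proof -
  have "\<forall>x y. cinner (A x) y = cinner x (op_adjoint A y)"
    unfolding op_adjoint_def
  proof (rule theI')
    show "\<exists>!B. \<forall>x y. cinner (A x) y = cinner x (blinfun_apply B y)"
    proof (rule ex_ex1I[OF adjoint_exists[OF assms]])
      fix B C assume B: "\<forall>x y. cinner (A x) y = cinner x (blinfun_apply B y)"
        and C: "\<forall>x y. cinner (A x) y = cinner x (blinfun_apply C y)"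
      have "cinner x (blinfun_apply B y) = cinner x (blinfun_apply C y)" for x y
        using B[rule_format, of x y] C[rule_format, of x y] by simp
      hence "blinfun_apply B y = blinfun_apply C y" for y by (rule cinner_eqI_right)
      thus "B = C" by (rule blinfun_eqI)
    qed
  qed
  thus ?thesis by blast
qed

lemma op_adjoint': "complex_linear A \<Longrightarrow> cinner (op_adjoint A x) y = cinner x (A y)"
  using op_adjoint[of A y x] cinner_commute'[of "A y" x] cinner_commute'[of y "op_adjoint A x"] by simp

lemma op_adjoint_unique:
  assumes "complex_linear A" "\<And>x y. cinner (A x) y = cinner x (blinfun_apply B y)"
  shows "op_adjoint A = B"
  by (rule blinfun_eqI, rule cinner_eqI_right) (simp only: assms(2) flip: op_adjoint[OF assms(1)])

lemma complex_linear_adjoint: "complex_linear A \<Longrightarrow> complex_linear (op_adjoint A)"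
proof -
  assume A: "complex_linear A"
  have "op_adjoint A (c *\<^sub>C y) = c *\<^sub>C op_adjoint A y" for c y
    by (rule cinner_eqI_right) (simp only: cinner_scaleC_right op_adjoint[OF A, symmetric])
  thus ?thesis by (simp add: complex_linear_def)
qed

lemma adjoint_adjoint [simp]: "complex_linear A \<Longrightarrow> op_adjoint (op_adjoint A) = A"
  by (rule op_adjoint_unique[OF complex_linear_adjoint]) (auto simp: op_adjoint')

lemma norm_adjoint_le: "complex_linear A \<Longrightarrow> norm (op_adjoint A) \<le> norm A"
  by (intro norm_blinfun_bound norm_adjoint_value_le) (simp_all add: op_adjoint)

lemma adjoint_compose:
  "complex_linear A \<Longrightarrow> complex_linear B \<Longrightarrow> op_adjoint (A o\<^sub>L B) = op_adjoint B o\<^sub>L op_adjoint A"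
  by (rule op_adjoint_unique) (auto simp: complex_linear_compose op_adjoint)

lemma adjoint_add:
  "complex_linear A \<Longrightarrow> complex_linear B \<Longrightarrow> op_adjoint (A + B) = op_adjoint A + op_adjoint B"
  by (rule op_adjoint_unique)
    (auto simp: complex_linear_add op_adjoint blinfun.add_left cinner_add_left cinner_add_right)

lemma adjoint_scaleR: "complex_linear A \<Longrightarrow> op_adjoint (r *\<^sub>R A) = r *\<^sub>R op_adjoint A"
  by (rule op_adjoint_unique)
    (auto simp: complex_linear_scaleR op_adjoint blinfun.scaleR_left cinner.scaleR_left cinner.scaleR_right)

section \<open>Positive square roots\<close>

text \<open>Polarization: reality of the form at \<open>x + y\<close> and at \<open>x + i y\<close>
  makes it Hermitian.\<close>

lemma op_positive_symmetric:
  assumes "op_positive A" shows "cinner (A x) y = cinner x (A y)"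
proof -
  let ?a = "cinner (A x) y" and ?b = "cinner (A y) x"
  have r: "Im (cinner (A z) z) = 0" for z
    using assms by (simp add: op_positive_def complex_is_Real_iff)
  have lin: "A (c *\<^sub>C z) = c *\<^sub>C A z" for c z
    using assms by (simp add: op_positive_def complex_linear_def)
  have "Im (?a + ?b) = 0"
    using r[of "x + y"] r[of x] r[of y]
    by (simp add: blinfun.add_right cinner_add_left cinner_add_right)
  moreover have "Re (?b - ?a) = 0"
    using r[of "x + \<i> *\<^sub>C y"] r[of x] r[of y]
    by (simp add: blinfun.add_right lin cinner_add_left cinner_add_right cinner_scaleC_left cinner_scaleC_right)
  ultimately have "?a = cnj ?b" by (simp add: complex_eq_iff)
  thus ?thesis by (simp add: cinner_commute')
qed

lemma op_positive_zero:
  assumes A: "op_positive A" and z: "cinner (A x) x = 0"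
  shows "A x = 0"
proof -
  define n k where "n = (norm (A x))\<^sup>2" and "k = Re (cinner (A (A x)) (A x))"
  have k: "k \<ge> 0" using A by (simp add: op_positive_def k_def)
  \<comment> \<open>Nearly the minimiser \<open>n / k\<close> of \<open>t^2 k - 2 t n\<close>; the
    summand \<open>1\<close> guards against \<open>k = 0\<close>.\<close>
  define t where "t = n / (k + 1)"
  have "0 \<le> Re (cinner (A (x - t *\<^sub>R A x)) (x - t *\<^sub>R A x))"
    using A by (simp add: op_positive_def)
  also have "\<dots> = t\<^sup>2 * k - 2 * t * n"
    by (simp add: blinfun.diff_right blinfun.scaleR_right cinner.diff_left cinner.diff_right cinner.scaleR_left
        cinner.scaleR_right z k_def n_def cinner_self op_positive_symmetric[OF A, of "A x" x] power2_eq_square algebra_simps)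
  finally have "2 * t * n \<le> t\<^sup>2 * k" by simp
  also have "\<dots> \<le> t\<^sup>2 * (k + 1)" by (simp add: mult_left_mono)
  also have "\<dots> = t * n" using k by (simp add: t_def power2_eq_square)
  finally have "t * n \<le> 0" by (simp add: mult_ac)
  moreover have "t * n = n\<^sup>2 / (k + 1)" by (simp add: t_def power2_eq_square)
  ultimately have "n\<^sup>2 \<le> 0" using k by (simp add: divide_le_0_iff)
  thus ?thesis by (simp add: n_def)
qed

text \<open>
  The iteration \<open>Y \<mapsto> (B + Y\<^sup>2) / 2\<close> from \<open>0\<close> converges to \<open>I - (I - B)\<^sup>1\<^sup>/\<^sup>2\<close>;
  it is dominated by the same iteration for the number \<open>1\<close>.
\<close>

primrec sqrt_iter :: "'a::chilbert_space \<Rightarrow>\<^sub>L 'a \<Rightarrow> nat \<Rightarrow> 'a \<Rightarrow>\<^sub>L 'a" where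
  "sqrt_iter B 0 = 0"
| "sqrt_iter B (Suc n) = (1/2) *\<^sub>R (B + (sqrt_iter B n o\<^sub>L sqrt_iter B n))"

primrec sqrt_majorant :: "nat \<Rightarrow> real" where
  "sqrt_majorant 0 = 0"
| "sqrt_majorant (Suc n) = (1 + (sqrt_majorant n)\<^sup>2) / 2"

lemma compose_diff_split: "(A o\<^sub>L A) - (B o\<^sub>L B) = (A o\<^sub>L (A - B)) + ((A - B) o\<^sub>L B)"
  for A :: "'b::real_normed_vector \<Rightarrow>\<^sub>L 'b"
  by (rule blinfun_eqI) (simp add: blinfun.diff_left blinfun.add_left blinfun.diff_right)

lemma sqrt_majorant_bounds: "0 \<le> sqrt_majorant n \<and> sqrt_majorant n \<le> 1"
proof (induction n)
  case (Suc n)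
  hence "(sqrt_majorant n)\<^sup>2 \<le> 1\<^sup>2" by (intro power_mono) auto
  thus ?case by simp
qed simp

lemma norm_half_le: "norm ((1/2::real) *\<^sub>R x) \<le> b" if "norm x \<le> 2 * b" for x :: "'b::real_normed_vector"
  using that by simp

text \<open>The splitting \<open>compose_diff_split\<close> respects the noncommutative order, so
  each operator increment is bounded by the scalar one. The scalar increments are thereby
  nonnegative and sum to at most \<open>1\<close>.\<close>

lemma sqrt_iter_step:
  assumes B: "norm B \<le> 1"
  shows "norm (sqrt_iter B n) \<le> sqrt_majorant n \<and>
    norm (sqrt_iter B (Suc n) - sqrt_iter B n) \<le> sqrt_majorant (Suc n) - sqrt_majorant n"
proof (induction n)
  case 0
  show ?case using B by simp
next
  case (Suc n)
  let ?Y = "sqrt_iter B" and ?y = sqrt_majorant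
  have b: "norm (?Y n) \<le> ?y n" "norm (?Y (Suc n) - ?Y n) \<le> ?y (Suc n) - ?y n" using Suc by auto
  have 1: "norm (?Y (Suc n)) \<le> ?y (Suc n)"
    using norm_triangle_ineq[of "?Y (Suc n) - ?Y n" "?Y n"] b
    by (simp del: sqrt_iter.simps sqrt_majorant.simps)
  have "?Y (Suc (Suc n)) - ?Y (Suc n)
      = (1/2) *\<^sub>R ((?Y (Suc n) o\<^sub>L ?Y (Suc n)) - (?Y n o\<^sub>L ?Y n))"
    unfolding sqrt_iter.simps(2)[of B "Suc n"] sqrt_iter.simps(2)[of B n]
    by (subst scaleR_diff_right[symmetric]) (simp add: algebra_simps)
  also have "norm \<dots> \<le> ?y (Suc (Suc n)) - ?y (Suc n)"
  proof (rule norm_half_le)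
    let ?D = "?Y (Suc n) - ?Y n" and ?d = "?y (Suc n) - ?y n"
    have "norm ((?Y (Suc n) o\<^sub>L ?D) + (?D o\<^sub>L ?Y n)) \<le> norm (?Y (Suc n)) * norm ?D + norm ?D * norm (?Y n)"
      by (rule norm_triangle_le[OF add_mono[OF norm_blinfun_compose norm_blinfun_compose]])
    also have "\<dots> \<le> ?y (Suc n) * ?d + ?d * ?y n"
      using b 1 sqrt_majorant_bounds[of n] sqrt_majorant_bounds[of "Suc n"] order.trans[OF norm_ge_zero b(2)]
      by (intro add_mono mult_mono) (auto simp del: sqrt_iter.simps sqrt_majorant.simps)
    also have "\<dots> = 2 * (?y (Suc (Suc n)) - ?y (Suc n))"
      unfolding sqrt_majorant.simps(2)[of "Suc n"] sqrt_majorant.simps(2)[of n]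
      by (simp add: power2_eq_square algebra_simps field_simps)
    finally show "norm ((?Y (Suc n) o\<^sub>L ?Y (Suc n)) - (?Y n o\<^sub>L ?Y n)) \<le> 2 * (?y (Suc (Suc n)) - ?y (Suc n))"
      unfolding compose_diff_split .
  qed
  finally show ?case using 1 by simp
qed

lemma sqrt_iter_convergent:
  assumes B: "norm B \<le> 1"
  obtains Y where "sqrt_iter B \<longlonglongrightarrow> Y"
proof -
  let ?y = sqrt_majorant
  have inc: "?y n \<le> ?y (Suc n)" for n
    using sqrt_iter_step[OF B, of n] norm_ge_zero[of "sqrt_iter B (Suc n) - sqrt_iter B n"] by linarith
  have "incseq ?y" using inc by (rule incseq_SucI)
  then obtain l where "?y \<longlonglongrightarrow> l"
    using incseq_convergent[of ?y 1] sqrt_majorant_bounds by blast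
  from telescope_summable[OF this] have "summable (\<lambda>n. ?y (Suc n) - ?y n)" .
  hence "summable (\<lambda>n. sqrt_iter B (Suc n) - sqrt_iter B n)"
    by (rule summable_comparison_test'[where N=0]) (use sqrt_iter_step[OF B] in blast)
  hence "(\<lambda>n. \<Sum>i<n. sqrt_iter B (Suc i) - sqrt_iter B i) \<longlonglongrightarrow> (\<Sum>i. sqrt_iter B (Suc i) - sqrt_iter B i)"
    by (rule summable_LIMSEQ)
  thus thesis
    using that by (simp add: sum_lessThan_telescope del: sqrt_iter.simps(2))
qed

text \<open>Every iterate is a real polynomial in \<open>B\<close>, so symmetry and commutation with
  any \<open>D\<close> commuting with \<open>B\<close> survive in the limit. The last property is
  what uniqueness of the square root rests on.\<close>

lemma sqrt_iter_limit:
  fixes B D :: "'a::chilbert_space \<Rightarrow>\<^sub>L 'a"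
  assumes lim: "sqrt_iter B \<longlonglongrightarrow> Y" and B: "norm B \<le> 1" "complex_linear B"
    and sym: "\<And>x y. cinner (B x) y = cinner x (B y)"
  shows "norm Y \<le> 1" "complex_linear Y" "Y = (1/2) *\<^sub>R (B + (Y o\<^sub>L Y))"
    "cinner (Y x) y = cinner x (Y y)" "(\<And>x. D (B x) = B (D x)) \<Longrightarrow> D (Y x) = Y (D x)"
proof -
  have "norm (sqrt_iter B n) \<le> 1" for n
    using sqrt_iter_step[OF B(1), of n] sqrt_majorant_bounds[of n] by linarith
  thus "norm Y \<le> 1" by (intro LIMSEQ_le_const2[OF tendsto_norm[OF lim]]) auto
  have "complex_linear (sqrt_iter B n)" for n
    by (induction n) (auto intro!: complex_linear_scaleR complex_linear_add complex_linear_compose B(2))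
  thus "complex_linear Y" by (rule complex_linear_lim[OF lim])
  have "(\<lambda>n. sqrt_iter B (Suc n)) \<longlonglongrightarrow> (1/2) *\<^sub>R (B + (Y o\<^sub>L Y))"
    unfolding sqrt_iter.simps
    by (intro tendsto_intros bounded_bilinear.tendsto[OF bounded_bilinear_blinfun_compose] lim)
  from LIMSEQ_unique[OF LIMSEQ_Suc[OF lim] this] show "Y = (1/2) *\<^sub>R (B + (Y o\<^sub>L Y))" .
  have ev: "(\<lambda>n. sqrt_iter B n z) \<longlonglongrightarrow> Y z" for z by (intro tendsto_intros lim)
  have s: "cinner (sqrt_iter B n x) y = cinner x (sqrt_iter B n y)" for n x y
    by (induction n arbitrary: x y)
      (simp_all add: cinner.zero_left cinner.zero_right blinfun.scaleR_left blinfun.add_left cinner.scaleR_left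
        cinner.scaleR_right cinner_add_left cinner_add_right sym)
  have "(\<lambda>n. cinner (sqrt_iter B n x) y) \<longlonglongrightarrow> cinner (Y x) y"
    by (intro cinner.tendsto ev tendsto_const)
  moreover have "(\<lambda>n. cinner x (sqrt_iter B n y)) \<longlonglongrightarrow> cinner x (Y y)"
    by (intro cinner.tendsto ev tendsto_const)
  ultimately show "cinner (Y x) y = cinner x (Y y)" unfolding s by (rule LIMSEQ_unique)
  assume D: "\<And>x. D (B x) = B (D x)"
  have c: "D (sqrt_iter B n z) = sqrt_iter B n (D z)" for n z
    by (induction n arbitrary: z)
      (simp_all add: blinfun.scaleR_left blinfun.add_left blinfun.scaleR_right blinfun.add_right D)
  have "(\<lambda>n. D (sqrt_iter B n x)) \<longlonglongrightarrow> D (Y x)" by (intro tendsto_intros ev)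
  from LIMSEQ_unique[OF this[unfolded c] ev] show "D (Y x) = Y (D x)" by simp
qed

text \<open>The description operator in \<open>op_sqrt\<close> is discharged by existence and
  uniqueness. The form \<open>c (I - Y)\<close> is recorded because it lets
  \<open>op_abs A + \<epsilon>\<close> be inverted by a Neumann series.\<close>

lemma op_abs_props:
  fixes A :: "'a::chilbert_space \<Rightarrow>\<^sub>L 'b::chilbert_space"
  assumes A: "complex_linear A"
  obtains c Y where "c > 0" "norm Y \<le> 1" "complex_linear Y" "op_abs A = c *\<^sub>R (id_blinfun - Y)"
    "op_positive (op_abs A)" "op_abs A o\<^sub>L op_abs A = op_adjoint A o\<^sub>L A"
proof -
  \<comment> \<open>Scaling by \<open>c\<close> makes \<open>A\<close> a contraction; the summand
    \<open>1\<close> covers \<open>A = 0\<close>.\<close>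
  define c where "c = norm A + 1"
  have c: "c > 0" by (simp add: c_def add_nonneg_pos)
  define P where "P = op_adjoint A o\<^sub>L A"
  define A' where "A' = (1/c) *\<^sub>R A"
  have A': "complex_linear A'" unfolding A'_def by (rule complex_linear_scaleR[OF A])
  have "norm A' \<le> 1" using c by (simp add: A'_def c_def)
  hence bA': "norm (A' x) \<le> norm x" for x
    using norm_blinfun[of A' x] mult_right_mono[of "norm A'" 1 "norm x"] by simp
  have bA'': "norm (op_adjoint A' x) \<le> norm x" for x
    using norm_blinfun[of "op_adjoint A'" x] mult_right_mono[of "norm (op_adjoint A')" 1 "norm x"]
      norm_adjoint_le[OF A'] \<open>norm A' \<le> 1\<close> by simp
  define B where "B = id_blinfun - (op_adjoint A' o\<^sub>L A')"
  have Bx: "B x = x - op_adjoint A' (A' x)" for x by (simp add: B_def blinfun.diff_left)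
  have B1: "norm B \<le> 1"
  proof (rule norm_blinfun_bound)
    fix x
    have "cinner x (op_adjoint A' (A' x)) = of_real ((norm (A' x))\<^sup>2)"
      by (simp add: cinner_self flip: op_adjoint[OF A'])
    hence "inner x (op_adjoint A' (A' x)) = (norm (A' x))\<^sup>2"
      by (simp add: inner_eq_Re_cinner)
    hence "(norm (B x))\<^sup>2 = (norm x)\<^sup>2 - 2 * (norm (A' x))\<^sup>2 + (norm (op_adjoint A' (A' x)))\<^sup>2"
      unfolding Bx by (simp add: power2_norm_eq_inner inner_diff_left inner_diff_right inner_commute)
    moreover have "(norm (op_adjoint A' (A' x)))\<^sup>2 \<le> (norm (A' x))\<^sup>2"
      by (intro power_mono bA'') auto
    ultimately have "(norm (B x))\<^sup>2 \<le> (norm x)\<^sup>2"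
      using zero_le_power2[of "norm (A' x)"] by linarith
    thus "norm (B x) \<le> 1 * norm x" by (simp add: power2_le_iff_abs_le)
  qed simp
  have B2: "complex_linear B"
    unfolding B_def by (intro complex_linear_diff complex_linear_id complex_linear_compose
        complex_linear_adjoint A')
  have B3: "cinner (B x) y = cinner x (B y)" for x y
    by (simp add: Bx cinner.diff_left cinner.diff_right op_adjoint'[OF A'] flip: op_adjoint[OF A'])
  have PB: "P x = c\<^sup>2 *\<^sub>R (x - B x)" for x
    using c by (simp add: P_def Bx A'_def adjoint_scaleR[OF A] blinfun.scaleR_left blinfun.scaleR_right
        power2_eq_square)
  obtain Y where lim: "sqrt_iter B \<longlonglongrightarrow> Y" using sqrt_iter_convergent[OF B1] .
  note Y = sqrt_iter_limit[OF lim B1 B2 B3]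
  define S where "S = c *\<^sub>R (id_blinfun - Y)"
  have Sx: "S x = c *\<^sub>R (x - Y x)" for x by (simp add: S_def blinfun.scaleR_left blinfun.diff_left)
  have Slin: "complex_linear S"
    unfolding S_def by (intro complex_linear_scaleR complex_linear_diff complex_linear_id Y)
  have YY: "Y (Y x) = 2 *\<^sub>R Y x - B x" for x
  proof -
    have "2 *\<^sub>R Y x = 2 *\<^sub>R ((1/2) *\<^sub>R (B + (Y o\<^sub>L Y))) x" using Y(3) by simp
    also have "\<dots> = B x + Y (Y x)" by (simp add: blinfun.scaleR_left blinfun.add_left)
    finally show ?thesis by simp
  qed
  have SS: "S (S x) = P x" for x
  proof -
    have "S (S x) = c\<^sup>2 *\<^sub>R (x - Y x - Y x + Y (Y x))"
      by (simp add: Sx blinfun.scaleR_right blinfun.diff_right power2_eq_square algebra_simps)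
    thus ?thesis unfolding YY PB by (simp add: scaleR_2)
  qed
  have Spos: "op_positive S"
    unfolding op_positive_def
  proof (intro conjI allI Slin)
    fix x
    have "cnj (cinner (Y x) x) = cinner (Y x) x" using Y(4)[of x x] cinner_commute'[of "Y x" x] by simp
    hence r: "cinner (Y x) x \<in> \<real>" by (simp add: Reals_cnj_iff)
    thus "cinner (S x) x \<in> \<real>"
      by (auto simp: Sx cinner.scaleR_left cinner.diff_left cinner_self scaleR_conv_of_real
          intro!: Reals_mult Reals_diff)
    have "Re (cinner (Y x) x) \<le> norm (Y x) * norm x"
      using cmod_cinner_le[of "Y x" x] complex_Re_le_cmod[of "cinner (Y x) x"] by linarith
    also have "\<dots> \<le> (1 * norm x) * norm x"
      using norm_blinfun[of Y x] mult_right_mono[OF Y(1), of "norm x"] by (intro mult_right_mono) auto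
    finally have "Re (cinner (Y x) x) \<le> (norm x)\<^sup>2" by (simp add: power2_eq_square)
    thus "0 \<le> Re (cinner (S x) x)"
      using c by (simp add: Sx cinner.scaleR_left cinner.diff_left cinner_self)
  qed
  \<comment> \<open>\<open>S'\<close> commutes with its square \<open>P\<close>, hence with
    \<open>B\<close>, \<open>Y\<close> and \<open>S\<close>. So \<open>S + S'\<close> annihilates
    \<open>y = S' x - S x\<close>; by positivity both \<open>S\<close> and \<open>S'\<close> do, and
    then \<open>cinner y y = cinner x (S' y - S y) = 0\<close>.\<close>
  have uniq: "S' = S" if S': "op_positive S'" "S' o\<^sub>L S' = P" for S'
  proof (rule blinfun_eqI)
    fix x
    have SS': "S' (S' z) = P z" for z using S'(2) by (metis blinfun_apply_blinfun_compose)
    have cP: "S' (P z) = P (S' z)" for z by (simp flip: SS')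
    have "c\<^sup>2 \<noteq> 0" using c by simp
    have "S' (B z) = B (S' z)" for z
    proof -
      have "c\<^sup>2 *\<^sub>R S' (z - B z) = c\<^sup>2 *\<^sub>R (S' z - B (S' z))"
        using cP[of z] unfolding PB by (simp add: blinfun.scaleR_right)
      thus ?thesis using \<open>c\<^sup>2 \<noteq> 0\<close> by (simp add: blinfun.diff_right)
    qed
    hence cY: "S' (Y z) = Y (S' z)" for z by (rule Y(5))
    have cS: "S' (S z) = S (S' z)" for z by (simp add: Sx blinfun.scaleR_right blinfun.diff_right cY)
    define y where "y = S' x - S x"
    have "S y + S' y = 0"
      by (simp add: y_def blinfun.diff_right SS SS' cS)
    hence "cinner (S y) y + cinner (S' y) y = 0" by (simp add: cinner.zero_left flip: cinner_add_left)
    hence "Re (cinner (S y) y) + Re (cinner (S' y) y) = 0" by (simp flip: plus_complex.sel)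
    hence "Re (cinner (S y) y) = 0" "Re (cinner (S' y) y) = 0"
      using Spos S'(1) by (auto simp: op_positive_def add_nonneg_eq_0_iff)
    hence "cinner (S y) y = 0" "cinner (S' y) y = 0"
      using Spos S'(1) by (auto simp: op_positive_def complex_is_Real_iff complex_eq_iff)
    hence "S y = 0" "S' y = 0" using op_positive_zero Spos S'(1) by blast+
    moreover have "cinner y y = cinner x (S' y - S y)"
      unfolding y_def[of] cinner.diff_left cinner.diff_right
      by (simp add: op_positive_symmetric[OF Spos, of x] op_positive_symmetric[OF S'(1), of x]
          blinfun.diff_right cinner.diff_right)
    ultimately have "y = 0" by (simp add: cinner.zero_right)
    thus "S' x = S x" by (simp add: y_def)
  qed
  have "op_abs A = S"
    unfolding op_abs_def op_sqrt_def
  proof (rule the_equality)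
    show "op_positive S \<and> S o\<^sub>L S = op_adjoint A o\<^sub>L A"
      using Spos SS by (auto intro!: blinfun_eqI simp: P_def)
  qed (use uniq in \<open>auto simp: P_def\<close>)
  moreover have "S o\<^sub>L S = op_adjoint A o\<^sub>L A"
    using SS by (auto intro!: blinfun_eqI simp: P_def)
  ultimately show thesis
    using that[OF c Y(1,2)] Spos unfolding S_def by metis
qed

lemma neumann_right_inverse:
  fixes Z :: "'a::chilbert_space \<Rightarrow>\<^sub>L 'a"
  assumes Z: "norm Z < 1" "complex_linear Z"
  obtains R where "complex_linear R" "\<forall>x. R x - Z (R x) = x"
proof -
  have S: "op_power Z (Suc n) = Z o\<^sub>L op_power Z n" for n by (simp add: op_power_def)
  have le: "norm (op_power Z n) \<le> norm Z ^ n" for n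
  proof (induction n)
    case 0 show ?case by (simp add: op_power_def norm_blinfun_id_le)
  next
    case (Suc n)
    show ?case unfolding S
      using order.trans[OF norm_blinfun_compose mult_left_mono[OF Suc, of "norm Z"]] by simp
  qed
  have cl: "complex_linear (op_power Z n)" for n
    by (induction n) (auto simp: S complex_linear_compose Z op_power_def[of Z 0])
  have s: "summable (op_power Z)"
    by (rule summable_comparison_test'[OF summable_geometric[of "norm Z"], of 0]) (use Z le in auto)
  define R where "R = suminf (op_power Z)"
  have "(\<lambda>n. \<Sum>i<n. op_power Z i) \<longlonglongrightarrow> R" unfolding R_def by (rule summable_LIMSEQ[OF s])
  hence 1: "complex_linear R" by (rule complex_linear_lim) (intro complex_linear_sum cl)
  have "R = op_power Z 0 + (\<Sum>n. Z o\<^sub>L op_power Z n)"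
    unfolding R_def S[symmetric] using suminf_split_head[OF s] by simp
  also have "(\<Sum>n. Z o\<^sub>L op_power Z n) = Z o\<^sub>L R"
    unfolding R_def
    by (rule bounded_linear.suminf[symmetric, OF bounded_bilinear.bounded_linear_right
          [OF bounded_bilinear_blinfun_compose] s])
  finally have "R x = (op_power Z 0 + (Z o\<^sub>L R)) x" for x by simp
  hence "R x - Z (R x) = x" for x by (simp add: op_power_def blinfun.add_left algebra_simps)
  thus thesis using that[OF 1] by blast
qed

section \<open>Hilbert--Schmidt operators\<close>

lemmas op_left = blinfun.add_left blinfun.diff_left blinfun.scaleR_left
  and op_right = blinfun.add_right blinfun.diff_right blinfun.scaleR_right

text \<open>Both sums equal the double sum of the nonnegative numbers
  \<open>(cmod (cinner (A e) f))^2\<close>, evaluated by Parseval first over \<open>f\<close> and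
  then over \<open>e\<close>.\<close>

lemma hs_has_sum_adjoint:
  fixes A :: "'a::chilbert_space \<Rightarrow>\<^sub>L 'b::chilbert_space"
  assumes A: "complex_linear A" and B: "is_onb B" and C: "is_onb C"
    and s: "((\<lambda>e. (norm (A e))\<^sup>2) has_sum s) B"
  shows "((\<lambda>f. (norm (op_adjoint A f))\<^sup>2) has_sum s) C"
proof -
  let ?F = "\<lambda>(e, f). (cmod (cinner (A e) f))\<^sup>2"
  have p: "((\<lambda>f. ?F (e, f)) has_sum (norm (A e))\<^sup>2) C" for e
    using parseval[OF C, of "A e"] by simp
  have "?F summable_on B \<times> C"
    by (rule summable_on_SigmaI[OF p]) (use s in \<open>auto simp: summable_on_def\<close>)
  from has_sum_SigmaI[OF p s this] have "((\<lambda>(f, e). ?F (e, f)) has_sum s) (C \<times> B)"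
    by (rule has_sum_swap[THEN iffD1])
  moreover have "((\<lambda>e. (\<lambda>(f, e). ?F (e, f)) (f, e)) has_sum (norm (op_adjoint A f))\<^sup>2) B" for f
  proof -
    have "cmod (cinner (A e) f) = cmod (cinner (op_adjoint A f) e)" for e
      unfolding op_adjoint[OF A] by (subst cinner_commute) simp
    thus ?thesis using parseval[OF B, of "op_adjoint A f"] by simp
  qed
  ultimately show ?thesis by (rule has_sum_SigmaD)
qed

text \<open>Two passages to the adjoint: the first trades \<open>B\<close> for the fixed basis, the
  second trades that one for \<open>B'\<close>.\<close>

lemma hs_has_sum_basis:
  assumes "complex_linear A" "is_onb B" "is_onb B'"
    and "((\<lambda>e. (norm (A e))\<^sup>2) has_sum s) B"
  shows "((\<lambda>e. (norm (A e))\<^sup>2) has_sum s) B'"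
  using hs_has_sum_adjoint[OF complex_linear_adjoint[OF assms(1)] is_onb_some_onb assms(3)
      hs_has_sum_adjoint[OF assms(1,2) is_onb_some_onb assms(4)]]
  by (simp add: assms(1))

lemma hilbert_schmidt_iff:
  "hilbert_schmidt A \<longleftrightarrow> complex_linear A \<and> (\<lambda>e. (norm (A e))\<^sup>2) summable_on some_onb"
  unfolding hilbert_schmidt_def summable_on_def
  using hs_has_sum_basis[OF _ _ is_onb_some_onb] is_onb_some_onb by blast

lemma hilbert_schmidt_linear: "hilbert_schmidt A \<Longrightarrow> complex_linear A"
  by (simp add: hilbert_schmidt_def)

lemma hilbert_schmidt_adjoint: "hilbert_schmidt A \<Longrightarrow> hilbert_schmidt (op_adjoint A)"
  unfolding hilbert_schmidt_iff summable_on_def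
  using hs_has_sum_adjoint[OF _ is_onb_some_onb is_onb_some_onb] complex_linear_adjoint by blast

lemma hilbert_schmidt_compose_left:
  assumes "complex_linear A" "hilbert_schmidt X"
  shows "hilbert_schmidt (A o\<^sub>L X)"
  unfolding hilbert_schmidt_iff
proof (intro conjI complex_linear_compose assms hilbert_schmidt_linear)
  show "(\<lambda>e. (norm ((A o\<^sub>L X) e))\<^sup>2) summable_on some_onb"
  proof (rule summable_on_comparison_test)
    show "(\<lambda>e. (norm A)\<^sup>2 * (norm (X e))\<^sup>2) summable_on some_onb"
      using assms by (intro summable_on_cmult_right) (simp add: hilbert_schmidt_iff)
    show "(norm ((A o\<^sub>L X) e))\<^sup>2 \<le> (norm A)\<^sup>2 * (norm (X e))\<^sup>2" for e
      unfolding power_mult_distrib[symmetric] by (intro power_mono) (auto intro: norm_blinfun)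
  qed auto
qed

lemma hilbert_schmidt_compose_right:
  assumes "complex_linear A" "hilbert_schmidt X"
  shows "hilbert_schmidt (X o\<^sub>L A)"
proof -
  have X: "complex_linear X" by (rule hilbert_schmidt_linear[OF assms(2)])
  have "hilbert_schmidt (op_adjoint (op_adjoint A o\<^sub>L op_adjoint X))"
    by (intro hilbert_schmidt_adjoint hilbert_schmidt_compose_left complex_linear_adjoint assms)
  thus ?thesis
    by (simp add: adjoint_compose complex_linear_adjoint assms X)
qed

text \<open>As a type of its own the Hilbert-Schmidt class becomes an instance of
  \<open>chilbert_space\<close>, and left and right multiplications become contractions on a Hilbert
  space.\<close>

typedef (overloaded) 'a hs = "{X :: 'a::chilbert_space \<Rightarrow>\<^sub>L 'a. hilbert_schmidt X}"
  morphisms op_of_hs Abs_hs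
  by (rule exI[of _ 0]) (simp add: hilbert_schmidt_iff)

setup_lifting type_definition_hs

lemma op_of_hs: "hilbert_schmidt (op_of_hs X)"
  using op_of_hs[of X] by simp

lemma op_of_hs_linear: "complex_linear (op_of_hs X)"
  by (rule hilbert_schmidt_linear[OF op_of_hs])

lemma op_of_hs_summable: "(\<lambda>e. (norm (op_of_hs X e))\<^sup>2) summable_on some_onb"
  using op_of_hs[of X] by (simp add: hilbert_schmidt_iff)

lemma hs_eqI: "(\<And>x. op_of_hs X x = op_of_hs Y x) \<Longrightarrow> X = Y"
  by (simp add: op_of_hs_inject[symmetric] blinfun_eqI)

lemma hilbert_schmidt_add: "hilbert_schmidt A \<Longrightarrow> hilbert_schmidt B \<Longrightarrow> hilbert_schmidt (A + B)"
  by (simp add: hilbert_schmidt_iff complex_linear_add blinfun.add_left sq_summable_add)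

lemma hilbert_schmidt_scaleC: "hilbert_schmidt A \<Longrightarrow> hilbert_schmidt (op_scaleC c A)"
  by (simp add: hilbert_schmidt_iff complex_linear_scaleC op_scaleC.rep_eq norm_scaleC power_mult_distrib
      summable_on_cmult_right)

lemma hilbert_schmidt_scaleR: "hilbert_schmidt A \<Longrightarrow> hilbert_schmidt (r *\<^sub>R A)"
  using hilbert_schmidt_scaleC[of A "complex_of_real r"] by (simp add: op_scaleC_of_real)

lemma cmod_cinner_le_squares: "cmod (cinner x y) \<le> (norm x)\<^sup>2 + (norm y)\<^sup>2"
proof -
  have "2 * (norm x * norm y) \<le> (norm x)\<^sup>2 + (norm y)\<^sup>2"
    using sum_squares_bound[of "norm x" "norm y"] by (simp add: mult.assoc)
  moreover have "0 \<le> norm x * norm y" by simp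
  ultimately show ?thesis using cmod_cinner_le[of x y] by linarith
qed

lemma cinner_hs_abs_summable:
  "(\<lambda>e. norm (cinner (op_of_hs X e) (op_of_hs Y e))) summable_on some_onb"
proof (rule summable_on_comparison_test)
  let ?f = "\<lambda>X e. (norm (op_of_hs X e))\<^sup>2"
  show "(\<lambda>e. ?f X e + ?f Y e) summable_on some_onb"
    by (intro summable_on_add op_of_hs_summable)
  show "norm (cinner (op_of_hs X e) (op_of_hs Y e)) \<le> ?f X e + ?f Y e" for e
    by (rule cmod_cinner_le_squares)
qed auto

lemma cinner_hs_summable: "(\<lambda>e. cinner (op_of_hs X e) (op_of_hs Y e)) summable_on some_onb"
  by (rule abs_summable_summable[OF cinner_hs_abs_summable])

lemma inner_hs_summable: "(\<lambda>e. inner (op_of_hs X e) (op_of_hs Y e)) summable_on some_onb"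
  unfolding inner_eq_Re_cinner by (rule summable_on_Re[OF cinner_hs_summable])

instantiation hs :: (chilbert_space) real_inner
begin

lift_definition zero_hs :: "'a hs" is 0 by (simp add: hilbert_schmidt_iff)
lift_definition plus_hs :: "'a hs \<Rightarrow> 'a hs \<Rightarrow> 'a hs" is "(+)" by (rule hilbert_schmidt_add)
lift_definition uminus_hs :: "'a hs \<Rightarrow> 'a hs" is uminus
  using hilbert_schmidt_scaleR[where r="-1"] by simp
lift_definition minus_hs :: "'a hs \<Rightarrow> 'a hs \<Rightarrow> 'a hs" is "(-)"
  using hilbert_schmidt_add hilbert_schmidt_scaleR[where r="-1"] by fastforce
lift_definition scaleR_hs :: "real \<Rightarrow> 'a hs \<Rightarrow> 'a hs" is scaleR by (rule hilbert_schmidt_scaleR)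
definition "inner_hs (X :: 'a hs) Y = (\<Sum>\<^sub>\<infinity>e\<in>some_onb. inner (op_of_hs X e) (op_of_hs Y e))"
definition "norm_hs (X :: 'a hs) = sqrt (inner X X)"
definition "sgn_hs (X :: 'a hs) = inverse (norm X) *\<^sub>R X"
definition "dist_hs (X :: 'a hs) Y = norm (X - Y)"
definition [code del]: "(uniformity :: ('a hs \<times> 'a hs) filter)
  = (INF e\<in>{0 <..}. principal {(x, y). dist x y < e})"
definition [code del]: "open (S :: 'a hs set)
  \<longleftrightarrow> (\<forall>x\<in>S. \<forall>\<^sub>F (x', y) in uniformity. x' = x \<longrightarrow> y \<in> S)"

lemmas op_of_hs_simps = zero_hs.rep_eq plus_hs.rep_eq uminus_hs.rep_eq minus_hs.rep_eq
  scaleR_hs.rep_eq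

instance
proof
  fix f g h :: "'a hs" and r s :: real
  show "f + g + h = f + (g + h)" "f + g = g + f" "0 + f = f" "- f + f = 0" "f - g = f + - g"
    "r *\<^sub>R (f + g) = r *\<^sub>R f + r *\<^sub>R g" "(r + s) *\<^sub>R f = r *\<^sub>R f + s *\<^sub>R f"
    "r *\<^sub>R (s *\<^sub>R f) = (r * s) *\<^sub>R f" "1 *\<^sub>R f = f"
    by (transfer; simp add: algebra_simps)+
  show "inner f g = inner g f"
    by (simp add: inner_hs_def inner_commute)
  show "inner (f + g) h = inner f h + inner g h"
    by (simp add: inner_hs_def op_of_hs_simps blinfun.add_left inner_add_left infsum_add inner_hs_summable)
  show "inner (r *\<^sub>R f) g = r * inner f g"
    by (simp add: inner_hs_def op_of_hs_simps blinfun.scaleR_left infsum_cmult_right inner_hs_summable)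
  show "0 \<le> inner f f"
    by (simp add: inner_hs_def infsum_nonneg)
  show "inner f f = 0 \<longleftrightarrow> f = 0"
  proof
    assume z: "inner f f = 0"
    have 0: "op_of_hs f e = 0" if "e \<in> some_onb" for e
      using nonneg_infsum_le_0D[of "\<lambda>n. inner (op_of_hs f n) (op_of_hs f n)" some_onb e] inner_hs_summable[of f f]
        that z by (auto simp: inner_hs_def)
    have "op_of_hs f x = 0" for x
    proof -
      have "((\<lambda>e. op_of_hs f (cinner x e *\<^sub>C e)) has_sum op_of_hs f x) some_onb"
        by (intro has_sum_bounded_linear[OF blinfun.bounded_linear_right] onb_expansion is_onb_some_onb)
      moreover have "((\<lambda>e. op_of_hs f (cinner x e *\<^sub>C e)) has_sum 0) some_onb"
        by (rule has_sum_0) (simp add: complex_linearD[OF op_of_hs_linear] 0)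
      ultimately show ?thesis by (rule has_sum_unique)
    qed
    thus "f = 0" by (intro hs_eqI) (simp add: op_of_hs_simps)
  qed (simp add: inner_hs_def op_of_hs_simps)
qed (simp_all add: norm_hs_def sgn_hs_def dist_hs_def uniformity_hs_def open_hs_def)

end

lemma norm_hs_sq: "(norm X)\<^sup>2 = (\<Sum>\<^sub>\<infinity>e\<in>some_onb. (norm (op_of_hs X e))\<^sup>2)"
  by (simp add: power2_norm_eq_inner inner_hs_def)

lemma norm_hs_has_sum: "((\<lambda>e. (norm (op_of_hs X e))\<^sup>2) has_sum (norm X)\<^sup>2) some_onb"
  unfolding norm_hs_sq by (rule has_sum_infsum[OF op_of_hs_summable])

lemma norm_hs_eq: "norm X = hs_norm (op_of_hs X)"
  using norm_hs_sq[of X] by (simp add: hs_norm_def real_sqrt_unique)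

text \<open>The coefficient of \<open>X x\<close> at \<open>e\<close> is the pairing of
  \<open>x\<close> with the adjoint of \<open>X\<close> at \<open>e\<close>; Cauchy-Schwarz and
  Parseval then leave the Hilbert-Schmidt norm of the adjoint.\<close>

lemma norm_op_of_hs_le: "norm (op_of_hs X) \<le> norm X"
proof (rule norm_blinfun_bound)
  fix x
  let ?X = "op_of_hs X"
  have a: "((\<lambda>f. (norm (op_adjoint ?X f))\<^sup>2) has_sum (norm X)\<^sup>2) some_onb"
    by (rule hs_has_sum_adjoint[OF op_of_hs_linear is_onb_some_onb is_onb_some_onb norm_hs_has_sum])
  have "(norm (?X x))\<^sup>2 \<le> (norm x)\<^sup>2 * (norm X)\<^sup>2"
  proof (rule has_sum_mono[OF parseval[OF is_onb_some_onb] has_sum_cmult_right[OF a]])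
    show "(cmod (cinner (?X x) e))\<^sup>2 \<le> (norm x)\<^sup>2 * (norm (op_adjoint ?X e))\<^sup>2" for e
      unfolding op_adjoint[OF op_of_hs_linear] power_mult_distrib[symmetric]
      by (intro power_mono cmod_cinner_le) auto
  qed
  hence "(norm (?X x))\<^sup>2 \<le> (norm X * norm x)\<^sup>2" by (simp add: power_mult_distrib mult.commute)
  thus "norm (?X x) \<le> norm X * norm x" by (rule power2_le_imp_le) simp
qed simp

instance hs :: (chilbert_space) complete_space
proof
  fix X :: "nat \<Rightarrow> 'a hs"
  assume X: "Cauchy X"
  have ev: "\<exists>K. \<forall>k\<ge>K. \<forall>m\<ge>k. norm (X k - X m) \<le> e" if "e > 0" for e
    using X that unfolding Cauchy_def dist_norm by (meson dual_order.trans less_imp_le)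
  \<comment> \<open>The limit is found in operator norm first. Finite sums over the basis converge
    to it term by term and carry the Hilbert-Schmidt estimates over.\<close>
  have "Cauchy (\<lambda>k. op_of_hs (X k))"
    using X unfolding Cauchy_altdef2 dist_norm
    by (metis minus_hs.rep_eq norm_op_of_hs_le order_le_less_trans)
  then obtain L where L: "(\<lambda>k. op_of_hs (X k)) \<longlonglongrightarrow> L"
    by (auto simp: Cauchy_convergent_iff convergent_def)
  have lL: "complex_linear L" by (rule complex_linear_lim[OF L op_of_hs_linear])
  have l: "(\<lambda>k. op_of_hs (X k) n) \<longlonglongrightarrow> L n" for n by (intro tendsto_intros L)
  have fin: "(\<Sum>n\<in>F. (norm ((op_of_hs (X k) - L) n))\<^sup>2) \<le> e\<^sup>2"
    if F: "F \<subseteq> some_onb" "finite F" and e: "\<And>m. m \<ge> k \<Longrightarrow> norm (X k - X m) \<le> e" for F k e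
  proof (rule LIMSEQ_le_const2)
    show "(\<lambda>m. \<Sum>n\<in>F. (norm (op_of_hs (X k - X m) n))\<^sup>2)
        \<longlonglongrightarrow> (\<Sum>n\<in>F. (norm ((op_of_hs (X k) - L) n))\<^sup>2)"
      unfolding minus_hs.rep_eq blinfun.diff_left by (intro tendsto_intros l)
    have "(\<Sum>n\<in>F. (norm (op_of_hs (X k - X m) n))\<^sup>2) \<le> e\<^sup>2" if "m \<ge> k" for m
    proof -
      have "(\<Sum>n\<in>F. (norm (op_of_hs (X k - X m) n))\<^sup>2) \<le> (norm (X k - X m))\<^sup>2"
        unfolding norm_hs_sq by (rule finite_sum_le_infsum) (use F in \<open>auto intro: op_of_hs_summable\<close>)
      also have "\<dots> \<le> e\<^sup>2" using e[OF that] by (simp add: power_mono)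
      finally show ?thesis .
    qed
    thus "\<exists>N. \<forall>m\<ge>N. (\<Sum>n\<in>F. (norm (op_of_hs (X k - X m) n))\<^sup>2) \<le> e\<^sup>2" by blast
  qed
  have diff: "hilbert_schmidt (op_of_hs (X k) - L)"
    if e: "\<And>m. m \<ge> k \<Longrightarrow> norm (X k - X m) \<le> e" for k e
    unfolding hilbert_schmidt_iff
  proof (intro conjI complex_linear_diff op_of_hs_linear lL)
    show "(\<lambda>n. (norm ((op_of_hs (X k) - L) n))\<^sup>2) summable_on some_onb"
      by (rule nonneg_bdd_above_summable_on) (auto intro!: bdd_aboveI2 fin[OF _ _ that])
  qed
  obtain K where K: "\<And>m. m \<ge> K \<Longrightarrow> norm (X K - X m) \<le> 1"
    using ev[of 1] by auto
  have "hilbert_schmidt (op_of_hs (X K) + (-1) *\<^sub>R (op_of_hs (X K) - L))"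
    by (intro hilbert_schmidt_add hilbert_schmidt_scaleR op_of_hs diff[OF K])
  hence hL: "hilbert_schmidt L" by simp
  define Y where "Y = Abs_hs L"
  have Y: "op_of_hs Y = L" using hL by (simp add: Y_def Abs_hs_inverse)
  have "X \<longlonglongrightarrow> Y"
  proof (rule LIMSEQ_I)
    fix r :: real assume r: "r > 0"
    then obtain K where K: "\<And>k m. k \<ge> K \<Longrightarrow> m \<ge> k \<Longrightarrow> norm (X k - X m) \<le> r/2"
      using ev[of "r/2"] by auto
    have "norm (X k - Y) < r" if k: "k \<ge> K" for k
    proof -
      have "(norm (X k - Y))\<^sup>2 \<le> (r/2)\<^sup>2"
        unfolding norm_hs_sq
        by (rule infsum_le_finite_sums[OF op_of_hs_summable])
          (use fin[OF _ _ K[OF k]] in \<open>auto simp: minus_hs.rep_eq Y\<close>)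
      hence "norm (X k - Y) \<le> r/2" by (rule power2_le_imp_le) (use r in simp)
      thus ?thesis using r by simp
    qed
    thus "\<exists>no. \<forall>n\<ge>no. norm (X n - Y) < r" by blast
  qed
  thus "convergent X" by (auto simp: convergent_def)
qed

instantiation hs :: (chilbert_space) chilbert_space
begin

lift_definition scaleC_hs :: "complex \<Rightarrow> 'a hs \<Rightarrow> 'a hs" is op_scaleC by (rule hilbert_schmidt_scaleC)

definition "cinner_hs (X :: 'a hs) Y = (\<Sum>\<^sub>\<infinity>e\<in>some_onb. cinner (op_of_hs X e) (op_of_hs Y e))"

instance
proof
  fix f g h :: "'a hs" and c d :: complex and r :: real
  show "c *\<^sub>C (f + g) = c *\<^sub>C f + c *\<^sub>C g" "(c + d) *\<^sub>C f = c *\<^sub>C f + d *\<^sub>C f"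
    "c *\<^sub>C (d *\<^sub>C f) = (c * d) *\<^sub>C f" "complex_of_real r *\<^sub>C f = r *\<^sub>R f"
    by (rule hs_eqI; simp add: op_of_hs_simps scaleC_hs.rep_eq op_scaleC.rep_eq op_left scaleC_add_left scaleC_add_right scaleC_scaleC scaleC_of_real)+
  show "cinner f g = cnj (cinner g f)"
    unfolding cinner_hs_def infsum_cnj[symmetric] by (subst cinner_commute) simp
  show "cinner (f + g) h = cinner f h + cinner g h"
    by (simp add: cinner_hs_def op_of_hs_simps blinfun.add_left cinner_add_left infsum_add cinner_hs_summable)
  show "cinner (c *\<^sub>C f) g = c * cinner f g"
    by (simp add: cinner_hs_def scaleC_hs.rep_eq op_scaleC.rep_eq cinner_scaleC_left infsum_cmult_right
        cinner_hs_summable)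
  show "inner f g = Re (cinner f g)"
    by (simp add: cinner_hs_def inner_hs_def inner_eq_Re_cinner infsum_Re cinner_hs_summable)
qed

end

section \<open>Adjoint, multiplications and trace pairing of Hilbert-Schmidt operators\<close>

lift_definition hs_adj :: "'a::chilbert_space hs \<Rightarrow> 'a hs" is op_adjoint
  by (rule hilbert_schmidt_adjoint)

text \<open>Outside the complex linear operators \<open>lmul\<close> and \<open>rmul\<close> take the junk value \<open>0\<close>.\<close>

lift_definition lmul :: "'a::chilbert_space \<Rightarrow>\<^sub>L 'a \<Rightarrow> 'a hs \<Rightarrow> 'a hs" is
  "\<lambda>A X. if complex_linear A then A o\<^sub>L X else 0"
  by (auto intro: hilbert_schmidt_compose_left) (simp add: hilbert_schmidt_iff)

lift_definition rmul :: "'a::chilbert_space hs \<Rightarrow> 'a \<Rightarrow>\<^sub>L 'a \<Rightarrow> 'a hs" is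
  "\<lambda>X A. if complex_linear A then X o\<^sub>L A else 0"
  by (auto intro: hilbert_schmidt_compose_right) (simp add: hilbert_schmidt_iff)

lemma op_of_lmul: "complex_linear A \<Longrightarrow> op_of_hs (lmul A X) = A o\<^sub>L op_of_hs X"
  by (simp add: lmul.rep_eq)

lemma op_of_rmul: "complex_linear A \<Longrightarrow> op_of_hs (rmul X A) = op_of_hs X o\<^sub>L A"
  by (simp add: rmul.rep_eq)

lemma hs_adj_adj [simp]: "hs_adj (hs_adj X) = X"
  by (rule hs_eqI) (simp add: hs_adj.rep_eq op_of_hs_linear)

lemma hs_adj_lmul: "complex_linear A \<Longrightarrow> hs_adj (lmul A X) = rmul (hs_adj X) (op_adjoint A)"
  by (rule hs_eqI) (simp add: hs_adj.rep_eq op_of_hs_linear op_of_lmul op_of_rmul complex_linear_adjoint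
      adjoint_compose)

lemma hs_adj_rmul: "complex_linear A \<Longrightarrow> hs_adj (rmul X A) = lmul (op_adjoint A) (hs_adj X)"
  by (rule hs_eqI) (simp add: hs_adj.rep_eq op_of_hs_linear op_of_lmul op_of_rmul complex_linear_adjoint
      adjoint_compose)

lemma hs_adj_add: "hs_adj (X + Y) = hs_adj X + hs_adj Y"
  by (rule hs_eqI) (simp add: hs_adj.rep_eq plus_hs.rep_eq adjoint_add op_of_hs_linear)

lemma hs_adj_scaleC: "hs_adj (c *\<^sub>C X) = cnj c *\<^sub>C hs_adj X"
proof -
  have "op_adjoint (op_scaleC c (op_of_hs X)) = op_scaleC (cnj c) (op_adjoint (op_of_hs X))"
    by (rule op_adjoint_unique)
      (auto simp: complex_linear_scaleC op_of_hs_linear op_scaleC.rep_eq cinner_scaleC_left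
        cinner_scaleC_right op_adjoint)
  thus ?thesis by (intro hs_eqI) (simp add: hs_adj.rep_eq scaleC_hs.rep_eq)
qed

lemma norm_hs_adj: "norm (hs_adj X) = norm X"
proof -
  have "((\<lambda>f. (norm (op_of_hs (hs_adj X) f))\<^sup>2) has_sum (norm X)\<^sup>2) some_onb"
    unfolding hs_adj.rep_eq
    by (rule hs_has_sum_adjoint[OF op_of_hs_linear is_onb_some_onb is_onb_some_onb norm_hs_has_sum])
  from has_sum_unique[OF norm_hs_has_sum this] show ?thesis by simp
qed

lemma inner_polarization: "inner x y = ((norm (x + y))\<^sup>2 - (norm x)\<^sup>2 - (norm y)\<^sup>2) / 2"
  by (simp add: power2_norm_eq_inner inner_add_left inner_add_right inner_commute)

text \<open>Real parts agree by polarization, since the adjoint is additive and isometric; imaginary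
  parts are real parts for \<open>-i X\<close>, by antilinearity.\<close>

lemma cinner_hs_adj: "cinner (hs_adj X) (hs_adj Y) = cinner Y X"
proof -
  have re: "Re (cinner (hs_adj A) (hs_adj B)) = Re (cinner B A)" for A B :: "'a hs"
    unfolding inner_eq_Re_cinner[symmetric] inner_polarization hs_adj_add[symmetric] norm_hs_adj
    by (simp add: add.commute)
  have "Im (cinner (hs_adj X) (hs_adj Y)) = - Re (cinner (hs_adj ((-\<i>) *\<^sub>C X)) (hs_adj Y))"
    by (simp add: hs_adj_scaleC cinner_scaleC_left del: complex_vector.scale_minus_left)
  also have "\<dots> = Im (cinner Y X)"
    unfolding re by (simp add: cinner_scaleC_right del: complex_vector.scale_minus_left)
  finally show ?thesis using re by (simp add: complex_eq_iff)
qed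

lemma bounded_linear_lmul: "bounded_linear (lmul A)"
  and norm_lmul: "norm (lmul A X) \<le> norm A * norm X"
proof -
  have n: "norm (lmul A X) \<le> norm A * norm X" for X
  proof (cases "complex_linear A")
    case True
    have "(norm (lmul A X))\<^sup>2 \<le> (norm A)\<^sup>2 * (norm X)\<^sup>2"
    proof (rule has_sum_mono[OF norm_hs_has_sum has_sum_cmult_right[OF norm_hs_has_sum]])
      show "(norm (op_of_hs (lmul A X) e))\<^sup>2 \<le> (norm A)\<^sup>2 * (norm (op_of_hs X e))\<^sup>2" for e
        unfolding power_mult_distrib[symmetric] op_of_lmul[OF True]
        by (intro power_mono) (auto intro: norm_blinfun)
    qed
    hence "(norm (lmul A X))\<^sup>2 \<le> (norm A * norm X)\<^sup>2" by (simp add: power_mult_distrib)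
    thus ?thesis by (rule power2_le_imp_le) simp
  next
    case False
    hence "lmul A X = 0" by transfer simp
    thus ?thesis by simp
  qed
  thus "norm (lmul A X) \<le> norm A * norm X" .
  show "bounded_linear (lmul A)"
  proof (rule bounded_linear_intro[where K="norm A"])
    show "lmul A (X + Y) = lmul A X + lmul A Y" "lmul A (r *\<^sub>R X) = r *\<^sub>R lmul A X" for X Y r
      by (transfer; auto intro!: blinfun_eqI simp: blinfun.add_left blinfun.add_right
          blinfun.scaleR_left blinfun.scaleR_right)+
  qed (use n in \<open>simp add: mult.commute\<close>)
qed

lemma bounded_linear_rmul: "bounded_linear (\<lambda>X. rmul X A)"
  and norm_rmul: "norm (rmul X A) \<le> norm X * norm A"
proof -
  have n: "norm (rmul X A) \<le> norm X * norm A" for X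
  proof (cases "complex_linear A")
    case True
    have "norm (rmul X A) = norm (lmul (op_adjoint A) (hs_adj X))"
      unfolding hs_adj_rmul[OF True, symmetric] norm_hs_adj ..
    also have "\<dots> \<le> norm (op_adjoint A) * norm (hs_adj X)" by (rule norm_lmul)
    also have "\<dots> \<le> norm X * norm A"
      using mult_right_mono[OF norm_adjoint_le[OF True], of "norm X"] by (simp add: norm_hs_adj mult.commute)
    finally show ?thesis .
  next
    case False
    hence "rmul X A = 0" by transfer simp
    thus ?thesis by simp
  qed
  thus "norm (rmul X A) \<le> norm X * norm A" .
  show "bounded_linear (\<lambda>X. rmul X A)"
  proof (rule bounded_linear_intro[where K="norm A"])
    show "rmul (X + Y) A = rmul X A + rmul Y A" "rmul (r *\<^sub>R X) A = r *\<^sub>R rmul X A" for X Y r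
      by (transfer; auto intro!: blinfun_eqI simp: op_left)+
  qed (use n in simp)
qed

lemmas lmul_add = linear_add[OF bounded_linear.linear[OF bounded_linear_lmul]]
  and lmul_scaleR = linear_scale[OF bounded_linear.linear[OF bounded_linear_lmul]]
  and lmul_zero [simp] = linear_0[OF bounded_linear.linear[OF bounded_linear_lmul]]

lemmas rmul_add = linear_add[OF bounded_linear.linear[OF bounded_linear_rmul]]
  and rmul_scaleR = linear_scale[OF bounded_linear.linear[OF bounded_linear_rmul]]
  and rmul_zero [simp] = linear_0[OF bounded_linear.linear[OF bounded_linear_rmul]]

lemma lmul_scaleC: "lmul A (c *\<^sub>C X) = c *\<^sub>C lmul A X"
  by (rule hs_eqI) (auto simp: lmul.rep_eq scaleC_hs.rep_eq op_scaleC.rep_eq complex_linearD)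

lemma rmul_scaleC: "rmul (c *\<^sub>C X) A = c *\<^sub>C rmul X A"
  by (rule hs_eqI) (auto simp: rmul.rep_eq scaleC_hs.rep_eq op_scaleC.rep_eq)

lemma cinner_lmul: "complex_linear A \<Longrightarrow> cinner (lmul A X) Y = cinner X (lmul (op_adjoint A) Y)"
  by (simp add: cinner_hs_def op_of_lmul complex_linear_adjoint op_adjoint)

lemma cinner_rmul: "complex_linear A \<Longrightarrow> cinner (rmul X A) Y = cinner X (rmul Y (op_adjoint A))"
  using cinner_lmul[of "op_adjoint A" "hs_adj X" "hs_adj Y"]
  by (subst (1 2) cinner_hs_adj[symmetric])
    (simp add: hs_adj_rmul complex_linear_adjoint, metis cinner_lmul)

text \<open>Traces of products become inner products, and cyclicity of the trace becomes
  \<open>cinner_hs_adj\<close>.\<close>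

lemma op_trace_compose: "op_trace (op_of_hs X o\<^sub>L op_of_hs Y) = cinner Y (hs_adj X)"
  by (simp add: op_trace_def cinner_hs_def hs_adj.rep_eq op_adjoint op_of_hs_linear)

lemma trace_summable: "(\<lambda>e. cinner ((op_of_hs X o\<^sub>L op_of_hs Y) e) e) summable_on some_onb"
  using cinner_hs_summable[of Y "hs_adj X"] by (simp add: hs_adj.rep_eq op_adjoint op_of_hs_linear)

text \<open>
  Without a polar decomposition: with \<open>S = \<bar>A\<bar>\<close> and \<open>R = (S + \<epsilon>)\<^sup>-\<^sup>1\<close> the operator \<open>W = A R\<close> is a
  contraction and \<open>\<langle>S e, e\<rangle> \<le> Re \<langle>A e, W e\<rangle> + \<epsilon>\<close> for unit vectors.
\<close>

lemma trace_class_sum_products: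
  fixes X Y :: "'i \<Rightarrow> 'a::chilbert_space hs"
  assumes I: "finite I"
  shows "trace_class (\<Sum>i\<in>I. op_of_hs (X i) o\<^sub>L op_of_hs (Y i))"
proof -
  define A where "A = (\<Sum>i\<in>I. op_of_hs (X i) o\<^sub>L op_of_hs (Y i))"
  have A: "complex_linear A"
    unfolding A_def by (intro complex_linear_sum complex_linear_compose op_of_hs_linear)
  define S where "S = op_abs A"
  obtain c Z where c: "c > 0" and Z: "norm Z \<le> 1" "complex_linear Z" and SZ: "S = c *\<^sub>R (id_blinfun - Z)"
    and S: "op_positive S" "S o\<^sub>L S = op_adjoint A o\<^sub>L A"
    unfolding S_def by (rule op_abs_props[OF A])
  have SS: "S (S x) = op_adjoint A (A x)" for x
    using arg_cong[OF S(2), of "\<lambda>B. blinfun_apply B x"] by simp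
  define K where "K = (\<Sum>i\<in>I. (norm (X i))\<^sup>2 + (norm (Y i))\<^sup>2)"
  have bound: "(\<Sum>e\<in>F. Re (cinner (S e) e)) \<le> K + \<delta>"
    if F: "F \<subseteq> some_onb" "finite F" and \<delta>: "\<delta> > 0" for F \<delta>
  proof -
    \<comment> \<open>Each of the \<open>card F\<close> unit vectors will cost an error \<epsilon>;
      together they stay below \<delta>.\<close>
    define \<epsilon> where "\<epsilon> = \<delta> / (real (card F) + 1)"
    have e: "\<epsilon> > 0" using \<delta> by (simp add: \<epsilon>_def add_nonneg_pos)
    define q where "q = 1 + \<epsilon> / c"
    have q: "q > 1" using e c by (simp add: q_def)
    \<comment> \<open>\<open>S + \<epsilon> = c q (I - Z / q)\<close>, and \<open>q > 1\<close>
      makes the Neumann series converge.\<close>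
    have n: "norm ((1/q) *\<^sub>R Z) < 1" using Z(1) q by (simp add: field_simps)
    obtain R0 where R0: "complex_linear R0" "\<forall>x. R0 x - ((1/q) *\<^sub>R Z) (R0 x) = x"
      by (rule neumann_right_inverse[OF n complex_linear_scaleR[OF Z(2)]])
    define R where "R = (1 / (c * q)) *\<^sub>R R0"
    have R: "complex_linear R" unfolding R_def by (rule complex_linear_scaleR[OF R0(1)])
    have SR: "S (R x) + \<epsilon> *\<^sub>R R x = x" for x
    proof -
      have eq: "S y + \<epsilon> *\<^sub>R y = (c * q) *\<^sub>R (y - (1/q) *\<^sub>R Z y)" for y
      proof -
        have "c * q = c + \<epsilon>" using c by (simp add: q_def distrib_left)
        moreover have "c * q * (1 / q) = c" using q by simp
        ultimately show ?thesis
          unfolding scaleR_right_diff_distrib scaleR_scaleR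
          by (simp add: SZ op_left algebra_simps)
      qed
      have "S (R x) + \<epsilon> *\<^sub>R R x = (1 / (c * q)) *\<^sub>R (S (R0 x) + \<epsilon> *\<^sub>R R0 x)"
        by (simp add: R_def blinfun.scaleR_left blinfun.scaleR_right scaleR_add_right)
      also have "\<dots> = R0 x - (1/q) *\<^sub>R Z (R0 x)"
        unfolding eq using c q by simp
      also have "\<dots> = x" using R0(2)[rule_format, of x] by (simp add: blinfun.scaleR_left)
      finally show ?thesis .
    qed
    \<comment> \<open>In the squared norm of \<open>x = S R x + \<epsilon> R x\<close> the cross
      term is nonnegative, as \<open>S\<close> is positive.\<close>
    have SRn: "norm (S (R x)) \<le> norm x" for x
    proof -
      have "0 \<le> inner (S (R x)) (R x)" using S(1) by (simp add: op_positive_def inner_eq_Re_cinner)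
      hence "0 \<le> 2 * \<epsilon> * inner (S (R x)) (R x)" using e by simp
      moreover have "(norm (S (R x) + \<epsilon> *\<^sub>R R x))\<^sup>2
          = (norm (S (R x)))\<^sup>2 + 2 * \<epsilon> * inner (S (R x)) (R x) + \<epsilon>\<^sup>2 * (norm (R x))\<^sup>2"
        unfolding power2_norm_eq_inner
        by (simp add: inner_add_left inner_add_right inner_commute power2_eq_square algebra_simps)
      moreover have "0 \<le> \<epsilon>\<^sup>2 * (norm (R x))\<^sup>2" by simp
      ultimately have "(norm (S (R x)))\<^sup>2 \<le> (norm x)\<^sup>2" unfolding SR by linarith
      thus ?thesis by (rule power2_le_imp_le) simp
    qed
    define W where "W = A o\<^sub>L R"
    have W: "complex_linear W" unfolding W_def by (rule complex_linear_compose[OF A R])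
    have "norm W \<le> 1"
    proof (rule norm_blinfun_bound)
      fix x
      have "cinner (W x) (W x) = cinner (S (R x)) (S (R x))"
        by (simp add: W_def op_adjoint[OF A] op_positive_symmetric[OF S(1)] SS)
      hence "norm (W x) = norm (S (R x))" by (simp add: cinner_self flip: of_real_power)
      thus "norm (W x) \<le> 1 * norm x" using SRn by simp
    qed simp
    have n1: "norm (rmul Z W) \<le> norm Z" for Z :: "'a hs"
      using norm_rmul[of Z W] mult_left_mono[OF \<open>norm W \<le> 1\<close>, of "norm Z"] by simp
    have se: "Re (cinner (S e) e) \<le> Re (cinner (A e) (W e)) + \<epsilon>" if "e \<in> F" for e
    proof -
      have ne: "norm e = 1" using orthonormal_norm[OF is_onb_orthonormal[OF is_onb_some_onb]] that F by blast
      have "cinner (A e) (W e) = cinner (op_adjoint A (A e)) (R e)"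
        by (simp add: W_def op_adjoint'[OF A])
      also have "\<dots> = cinner (S e) (S (R e))"
        by (simp add: op_positive_symmetric[OF S(1), of "S e"] flip: SS)
      also have "S (R e) = e - \<epsilon> *\<^sub>R R e" using SR[of e] by (simp add: algebra_simps)
      finally have "cinner (S e) e = cinner (A e) (W e) + \<epsilon> *\<^sub>R cinner e (S (R e))"
        by (simp add: cinner.diff_right cinner.scaleR_right op_positive_symmetric[OF S(1), of e "R e"])
      moreover have "Re (cinner e (S (R e))) \<le> 1"
        using complex_Re_le_cmod[of "cinner e (S (R e))"] cmod_cinner_le[of e "S (R e)"] SRn[of e] ne by simp
      ultimately show ?thesis using e by simp
    qed
    have "(\<Sum>e\<in>F. Re (cinner (S e) e)) \<le> (\<Sum>e\<in>F. Re (cinner (A e) (W e)) + \<epsilon>)"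
      by (rule sum_mono[OF se])
    also have "\<dots> = (\<Sum>e\<in>F. Re (cinner (A e) (W e))) + real (card F) * \<epsilon>" by (simp add: sum.distrib)
    also have "real (card F) * \<epsilon> \<le> \<delta>" using \<delta> by (simp add: \<epsilon>_def field_simps)
    \<comment> \<open>Moving \<open>X i\<close> to the right factor pairs \<open>Y i\<close> with
      \<open>rmul (hs_adj (X i)) W\<close>, whose norm is at most that of \<open>X i\<close>. So the
      bound depends neither on \<open>F\<close> nor on \<epsilon>.\<close>
    also have "(\<Sum>e\<in>F. Re (cinner (A e) (W e)))
        = (\<Sum>i\<in>I. \<Sum>e\<in>F. Re (cinner (op_of_hs (Y i) e) (op_of_hs (rmul (hs_adj (X i)) W) e)))"
      by (subst sum.swap) (simp add: A_def blinfun.sum_left cinner.sum_left op_of_rmul[OF W] hs_adj.rep_eq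
          op_adjoint[OF op_of_hs_linear])
    also have "\<dots> \<le> (\<Sum>i\<in>I. (norm (X i))\<^sup>2 + (norm (Y i))\<^sup>2)"
    proof (rule sum_mono)
      fix i
      let ?U = "rmul (hs_adj (X i)) W" and ?V = "Y i"
      have le: "(\<Sum>e\<in>F. (norm (op_of_hs U e))\<^sup>2) \<le> (norm U)\<^sup>2" for U :: "'a hs"
        unfolding norm_hs_sq by (rule finite_sum_le_infsum) (use F in \<open>auto intro: op_of_hs_summable\<close>)
      have "Re (cinner (op_of_hs ?V e) (op_of_hs ?U e)) \<le> (norm (op_of_hs ?U e))\<^sup>2 + (norm (op_of_hs ?V e))\<^sup>2" for e
        using cmod_cinner_le_squares[of "op_of_hs ?V e" "op_of_hs ?U e"]
          complex_Re_le_cmod[of "cinner (op_of_hs ?V e) (op_of_hs ?U e)"] by linarith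
      hence "(\<Sum>e\<in>F. Re (cinner (op_of_hs ?V e) (op_of_hs ?U e)))
          \<le> (\<Sum>e\<in>F. (norm (op_of_hs ?U e))\<^sup>2 + (norm (op_of_hs ?V e))\<^sup>2)" by (intro sum_mono)
      also have "\<dots> \<le> (norm ?U)\<^sup>2 + (norm ?V)\<^sup>2"
        unfolding sum.distrib by (intro add_mono le)
      also have "(norm ?U)\<^sup>2 \<le> (norm (X i))\<^sup>2"
        using n1[of "hs_adj (X i)"] by (intro power_mono) (auto simp: norm_hs_adj)
      finally show "(\<Sum>e\<in>F. Re (cinner (op_of_hs (Y i) e) (op_of_hs (rmul (hs_adj (X i)) W) e)))
          \<le> (norm (X i))\<^sup>2 + (norm (Y i))\<^sup>2" by simp
    qed
    finally show ?thesis by (simp add: K_def)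
  qed
  have nn: "0 \<le> Re (cinner (S e) e)" and re: "cinner (S e) e = of_real (Re (cinner (S e) e))" for e
    using S(1) by (auto simp: op_positive_def complex_is_Real_iff complex_eq_iff)
  have "(\<lambda>e. Re (cinner (S e) e)) summable_on some_onb"
    by (rule nonneg_bdd_above_summable_on) (auto intro!: bdd_aboveI2 bound[where \<delta>=1] nn)
  hence "(\<lambda>e. cinner (S e) e) summable_on some_onb"
    by (subst re) (rule summable_on_of_real)
  thus ?thesis
    using A is_onb_some_onb unfolding trace_class_def A_def[symmetric] S_def by blast
qed

section \<open>Analytic parts of Fourier series\<close>

abbreviation circ :: "real measure" where
  "circ \<equiv> lebesgue_on {0..2*pi}"

abbreviation cint :: "(real \<Rightarrow> 'b::{banach, second_countable_topology}) \<Rightarrow> 'b" where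
  "cint \<equiv> integral\<^sup>L circ"

lemma measure_circ: "measure circ (space circ) = 2 * pi"
  by (simp add: measure_restrict_space)

lemma finite_measure_circ: "finite_measure circ"
  by (rule finite_measureI) (simp add: emeasure_restrict_space)

lemma integrable_circ_continuous:
  "continuous_on {0..2*pi} f \<Longrightarrow> integrable circ f" for f :: "real \<Rightarrow> 'a::euclidean_space"
  using continuous_imp_integrable_real by blast

lemma integral_circ_const: "cint (\<lambda>_. c) = (2 * pi) *\<^sub>R c" for c :: "'a::euclidean_space"
  using measure_circ by simp

lemma integral_circ_cis: "cint (\<lambda>t. cis (of_int k * t)) = (if k = 0 then 2 * pi else 0)"
proof (cases "k = 0")
  case True
  thus ?thesis using integral_circ_const[of "1::complex"] by (simp add: scaleR_conv_of_real)
next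
  case False
  have "((\<lambda>t. cis (of_int k * t)) has_integral
      cis (of_int k * (2 * pi)) / (\<i> * of_int k) - cis (of_int k * 0) / (\<i> * of_int k)) {0..2*pi}"
  proof (rule fundamental_theorem_of_calculus)
    fix t :: real
    have "((\<lambda>t. cis (of_int k * t) / (\<i> * of_int k)) has_vector_derivative
        (\<i> * of_int k * cis (of_int k * t)) / (\<i> * of_int k)) (at t within {0..2*pi})"
      unfolding cis_conv_exp
      by (rule has_vector_derivative_real_field derivative_eq_intros refl | simp add: field_simps)+
    thus "((\<lambda>t. cis (of_int k * t) / (\<i> * of_int k)) has_vector_derivative cis (of_int k * t)) (at t within {0..2*pi})"
      using False by simp
  qed simp
  moreover have "cis (of_int k * (2 * pi)) = 1"
    using cis_multiple_2pi[of "of_int k"] by (simp add: mult_ac)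
  ultimately have "integral {0..2*pi} (\<lambda>t. cis (of_int k * t)) = 0"
    by (simp add: integral_unique)
  moreover have "integrable circ (\<lambda>t. cis (of_int k * t))"
    by (intro integrable_circ_continuous continuous_intros)
  ultimately show ?thesis using False by (simp add: lebesgue_integral_eq_integral)
qed

lemma integrable_circ_times_cis:
  assumes "integrable circ h"
  shows "integrable circ (\<lambda>t. h t * cis (r * t))"
proof (rule Bochner_Integration.integrable_bound[OF assms])
  have "(\<lambda>t. cis (r * t)) \<in> borel_measurable circ"
    by (intro borel_measurable_integrable integrable_circ_continuous continuous_intros)
  thus "(\<lambda>t. h t * cis (r * t)) \<in> borel_measurable circ"
    by (rule borel_measurable_times[OF borel_measurable_integrable[OF assms]])
qed (simp add: norm_mult)

text \<open>A bound in the quotient of \<open>L^1\<close> by the functions with only positive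
  frequencies: \<open>g\<close> lists the Fourier coefficients at \<open>0, -1, -2, ...\<close>, and
  the remaining ones are free. The factors \<open>2 * pi\<close> normalise arc length.\<close>

definition analytic_part :: "(nat \<Rightarrow> complex) \<Rightarrow> real \<Rightarrow> bool" where
  "analytic_part g \<delta> \<longleftrightarrow> (\<exists>h. integrable circ h
    \<and> (\<forall>m. cint (\<lambda>t. h t * cis (real m * t)) = of_real (2 * pi) * g m)
    \<and> cint (\<lambda>t. cmod (h t)) \<le> 2 * pi * \<delta>)"

lemma analytic_part_coeff_le:
  assumes "analytic_part g \<delta>" shows "cmod (g m) \<le> \<delta>"
proof -
  obtain h where h: "integrable circ h" "cint (\<lambda>t. h t * cis (real m * t)) = of_real (2 * pi) * g m"
    "cint (\<lambda>t. cmod (h t)) \<le> 2 * pi * \<delta>"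
    using assms by (auto simp: analytic_part_def)
  have "2 * pi * cmod (g m) = cmod (of_real (2 * pi) * g m)" by (simp add: norm_mult)
  also have "\<dots> \<le> cint (\<lambda>t. cmod (h t * cis (real m * t)))"
    unfolding h(2)[symmetric] by (rule integral_norm_bound)
  also have "\<dots> \<le> 2 * pi * \<delta>" using h(3) by (simp add: norm_mult)
  finally show ?thesis by simp
qed

lemma analytic_part_mono: "analytic_part g \<delta> \<Longrightarrow> \<delta> \<le> \<delta>' \<Longrightarrow> analytic_part g \<delta>'"
proof -
  assume *: "analytic_part g \<delta>" "\<delta> \<le> \<delta>'"
  hence "2 * pi * \<delta> \<le> 2 * pi * \<delta>'" by (intro mult_left_mono) auto
  with * show "analytic_part g \<delta>'"
    unfolding analytic_part_def by (blast intro: order.trans)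
qed

lemma analytic_part_add:
  assumes "analytic_part g \<delta>" "analytic_part g' \<delta>'"
  shows "analytic_part (\<lambda>m. g m + g' m) (\<delta> + \<delta>')"
proof -
  obtain h where h: "integrable circ h" "\<And>m. cint (\<lambda>t. h t * cis (real m * t)) = of_real (2 * pi) * g m"
    "cint (\<lambda>t. cmod (h t)) \<le> 2 * pi * \<delta>"
    using assms(1) by (auto simp: analytic_part_def)
  obtain h' where h': "integrable circ h'" "\<And>m. cint (\<lambda>t. h' t * cis (real m * t)) = of_real (2 * pi) * g' m"
    "cint (\<lambda>t. cmod (h' t)) \<le> 2 * pi * \<delta>'"
    using assms(2) by (auto simp: analytic_part_def)
  have "cint (\<lambda>t. cmod (h t + h' t)) \<le> cint (\<lambda>t. cmod (h t) + cmod (h' t))"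
    by (intro integral_mono integrable_norm Bochner_Integration.integrable_add h h' norm_triangle_ineq)
  also have "\<dots> \<le> 2 * pi * (\<delta> + \<delta>')"
    using h h' by (simp add: distrib_left)
  finally show ?thesis
    unfolding analytic_part_def
    by (intro exI[of _ "\<lambda>t. h t + h' t"])
      (use h h' in \<open>simp add: distrib_right distrib_left integrable_circ_times_cis\<close>)
qed

lemma analytic_part_uminus:
  assumes "analytic_part g \<delta>"
  shows "analytic_part (\<lambda>m. - g m) \<delta>"
proof -
  obtain h where h: "integrable circ h" "\<And>m. cint (\<lambda>t. h t * cis (real m * t)) = of_real (2 * pi) * g m"
    "cint (\<lambda>t. cmod (h t)) \<le> 2 * pi * \<delta>"
    using assms(1) by (auto simp: analytic_part_def)
  thus ?thesis
    unfolding analytic_part_def by (intro exI[of _ "\<lambda>t. - h t"]) simp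
qed

text \<open>Completeness of the quotient: representatives with summable norms add up almost
  everywhere to an integrable function, whose coefficients may be computed term by term.\<close>

lemma analytic_part_sums:
  fixes g :: "nat \<Rightarrow> nat \<Rightarrow> complex"
  assumes g: "\<And>k. analytic_part (g k) (d k)" and d: "summable d" and G: "\<And>m. (\<lambda>k. g k m) sums G m"
  shows "analytic_part G (suminf d)"
proof -
  let ?R = "\<lambda>k h. integrable circ h \<and> (\<forall>m. cint (\<lambda>t. h t * cis (real m * t)) = of_real (2 * pi) * g k m)
    \<and> cint (\<lambda>t. cmod (h t)) \<le> 2 * pi * d k"
  have "\<forall>k. \<exists>h. ?R k h" using g by (auto simp: analytic_part_def)
  then obtain h where "\<forall>k. ?R k (h k)" by (rule choice[THEN exE])
  hence h: "integrable circ (h k)" "cint (\<lambda>t. h k t * cis (real m * t)) = of_real (2 * pi) * g k m"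
    "cint (\<lambda>t. cmod (h k t)) \<le> 2 * pi * d k" for k m by auto
  have sn: "summable (\<lambda>k. cint (\<lambda>t. cmod (h k t)))"
    by (rule summable_comparison_test'[OF summable_mult[OF d, of "2 * pi"], of 0])
      (use h(3) in \<open>simp add: integral_nonneg\<close>)
  have "(\<integral>\<^sup>+ t. (\<Sum>k. ennreal (cmod (h k t))) \<partial>circ) = (\<Sum>k. \<integral>\<^sup>+ t. ennreal (cmod (h k t)) \<partial>circ)"
    by (rule nn_integral_suminf) (use h(1) in auto)
  also have "\<dots> = (\<Sum>k. ennreal (cint (\<lambda>t. cmod (h k t))))"
    by (intro arg_cong[where f=suminf] ext nn_integral_eq_integral integrable_norm h) auto
  also have "\<dots> = ennreal (\<Sum>k. cint (\<lambda>t. cmod (h k t)))"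
    by (rule suminf_ennreal2) (use sn in \<open>auto intro: integral_nonneg\<close>)
  finally have "(\<integral>\<^sup>+ t. (\<Sum>k. ennreal (cmod (h k t))) \<partial>circ) \<noteq> \<infinity>" by simp
  hence "AE t in circ. (\<Sum>k. ennreal (cmod (h k t))) \<noteq> \<infinity>"
    by (rule nn_integral_PInf_AE[rotated]) (use h(1) in measurable)
  hence ae: "AE t in circ. summable (\<lambda>k. cmod (h k t))"
    by eventually_elim (auto intro: summable_suminf_not_top)
  define H where "H t = (\<Sum>k. h k t)" for t
  have 1: "integrable circ H"
    unfolding H_def by (rule integrable_suminf[OF h(1) ae sn])
  have 2: "cint (\<lambda>t. H t * cis (real m * t)) = of_real (2 * pi) * G m" for m
  proof -
    have "(\<lambda>k. cint (\<lambda>t. h k t * cis (real m * t))) sums cint (\<lambda>t. \<Sum>k. h k t * cis (real m * t))"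
      by (rule sums_integral) (use ae sn in \<open>auto simp: norm_mult h integrable_circ_times_cis\<close>)
    moreover have "cint (\<lambda>t. \<Sum>k. h k t * cis (real m * t)) = cint (\<lambda>t. H t * cis (real m * t))"
    proof (rule Bochner_Integration.integral_cong_AE)
      show "AE t in circ. (\<Sum>k. h k t * cis (real m * t)) = H t * cis (real m * t)"
        using ae unfolding H_def
        by eventually_elim (metis suminf_mult2 summable_norm_cancel)
      show "(\<lambda>t. H t * cis (real m * t)) \<in> borel_measurable circ"
        by (rule borel_measurable_integrable[OF integrable_circ_times_cis[OF 1]])
      show "(\<lambda>t. \<Sum>k. h k t * cis (real m * t)) \<in> borel_measurable circ"
        by (intro borel_measurable_suminf borel_measurable_integrable[OF integrable_circ_times_cis[OF h(1)]])
    qed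
    ultimately have "(\<lambda>k. of_real (2 * pi) * g k m) sums cint (\<lambda>t. H t * cis (real m * t))"
      by (simp add: h)
    moreover have "(\<lambda>k. of_real (2 * pi) * g k m) sums (of_real (2 * pi) * G m)" by (rule sums_mult[OF G])
    ultimately show ?thesis by (rule sums_unique2)
  qed
  have "cint (\<lambda>t. cmod (H t)) \<le> cint (\<lambda>t. \<Sum>k. cmod (h k t))"
  proof (rule integral_mono_AE[OF integrable_norm[OF 1]])
    show "integrable circ (\<lambda>t. \<Sum>k. cmod (h k t))"
      by (rule integrable_suminf) (use ae sn h in auto)
    show "AE t in circ. cmod (H t) \<le> (\<Sum>k. cmod (h k t))"
      using ae unfolding H_def by eventually_elim (rule summable_norm)
  qed
  also have "\<dots> = (\<Sum>k. cint (\<lambda>t. cmod (h k t)))"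
    by (rule integral_suminf) (use ae sn h in auto)
  also have "\<dots> \<le> (\<Sum>k. 2 * pi * d k)"
    by (rule suminf_le[OF h(3) sn summable_mult[OF d]])
  also have "\<dots> = 2 * pi * suminf d" by (rule suminf_mult[OF d])
  finally show ?thesis using 1 2 unfolding analytic_part_def by blast
qed

lemma analytic_part_limit:
  fixes G :: "nat \<Rightarrow> nat \<Rightarrow> complex"
  assumes G0: "analytic_part (G 0) d" and G: "\<And>k. analytic_part (\<lambda>m. G (Suc k) m - G k m) (e k)"
    and e: "summable e" and lim: "\<And>m. (\<lambda>k. G k m) \<longlonglongrightarrow> g m"
  shows "analytic_part g (d + suminf e)"
proof -
  define f where "f k = (case k of 0 \<Rightarrow> G 0 | Suc j \<Rightarrow> (\<lambda>m. G (Suc j) m - G j m))" for k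
  define D where "D k = (case k of 0 \<Rightarrow> d | Suc j \<Rightarrow> e j)" for k
  have sD: "summable D" using e by (subst summable_Suc_iff[symmetric]) (simp add: D_def)
  have "suminf D = d + suminf e"
    using suminf_split_head[OF sD] by (simp add: D_def)
  moreover have "analytic_part g (suminf D)"
  proof (rule analytic_part_sums[OF _ sD])
    show "analytic_part (f k) (D k)" for k
      using G0 G by (cases k) (auto simp: f_def D_def)
    have "(\<Sum>k<Suc n. f k m) = G n m" for n m
      by (induction n) (auto simp: f_def)
    hence "(\<lambda>n. \<Sum>k<Suc n. f k m) \<longlonglongrightarrow> g m" for m using lim by simp
    thus "(\<lambda>k. f k m) sums g m" for m unfolding sums_def by (subst (asm) filterlim_sequentially_Suc)
  qed
  ultimately show ?thesis by simp
qed

text \<open>The trigonometric polynomial with these coefficients is a representative; Parseval gives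
  its \<open>L^2\<close> norm, which dominates the normalised \<open>L^1\<close> norm.\<close>

lemma analytic_part_finite_support:
  assumes fin: "\<And>m. m \<ge> N \<Longrightarrow> g m = 0" and s: "(\<Sum>m<N. (cmod (g m))\<^sup>2) \<le> s\<^sup>2" "s > 0"
  shows "analytic_part g s"
proof -
  define h where "h t = (\<Sum>n<N. g n * cis (of_int (- int n) * t))" for t
  have int: "integrable circ (\<lambda>t. c * cis (r * t))" for c r
    by (intro integrable_circ_continuous continuous_intros)
  have hi: "integrable circ h"
    unfolding h_def by (intro Bochner_Integration.integrable_sum int)
  have c: "cint (\<lambda>t. h t * cis (real m * t)) = of_real (2 * pi) * g m" for m
  proof -
    have "h t * cis (real m * t) = (\<Sum>n<N. g n * cis (of_int (int m - int n) * t))" for t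
      unfolding h_def by (simp only: sum_distrib_right mult.assoc cis_mult) (simp add: algebra_simps)
    hence "cint (\<lambda>t. h t * cis (real m * t)) = (\<Sum>n<N. g n * cint (\<lambda>t. cis (of_int (int m - int n) * t)))"
      by (simp only: integral_mult_right_zero Bochner_Integration.integral_sum[OF int])
    also have "\<dots> = (\<Sum>n<N. if m = n then of_real (2 * pi) * g n else 0)"
      unfolding integral_circ_cis by (intro sum.cong) auto
    also have "\<dots> = of_real (2 * pi) * g m" using fin[of m] by (simp add: sum.delta)
    finally show ?thesis .
  qed
  have h2: "integrable circ (\<lambda>t. (cmod (h t))\<^sup>2)"
    unfolding h_def by (intro integrable_circ_continuous continuous_intros)
  have "complex_of_real (cint (\<lambda>t. (cmod (h t))\<^sup>2)) = cint (\<lambda>t. h t * cnj (h t))"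
    unfolding integral_complex_of_real[symmetric] by (simp only: complex_norm_square)
  also have "\<dots> = cint (\<lambda>t. \<Sum>n<N. cnj (g n) * (h t * cis (real n * t)))"
    by (simp add: h_def[of "_::real"] sum_distrib_left mult_ac cis_cnj)
  also have "\<dots> = (\<Sum>n<N. cnj (g n) * (of_real (2 * pi) * g n))"
    by (subst Bochner_Integration.integral_sum) (auto intro!: integrable_mult_right integrable_circ_times_cis hi simp: c)
  also have "\<dots> = (\<Sum>n<N. of_real (2 * pi * (cmod (g n))\<^sup>2))"
    by (intro sum.cong refl) (simp add: complex_norm_square mult_ac del: of_real_power)
  finally have "complex_of_real (cint (\<lambda>t. (cmod (h t))\<^sup>2)) = of_real (\<Sum>n<N. 2 * pi * (cmod (g n))\<^sup>2)"
    by simp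
  hence e2: "cint (\<lambda>t. (cmod (h t))\<^sup>2) = 2 * pi * (\<Sum>n<N. (cmod (g n))\<^sup>2)"
    unfolding of_real_eq_iff by (simp add: sum_distrib_left)
  \<comment> \<open>Integrating \<open>2 s |h| \<le> |h|^2 + s^2\<close> plays the part of
    Cauchy-Schwarz and returns exactly \<open>s\<close>.\<close>
  have "cint (\<lambda>t. cmod (h t)) \<le> cint (\<lambda>t. (1 / (2 * s)) * (cmod (h t))\<^sup>2 + s / 2)"
  proof (rule integral_mono)
    show "cmod (h t) \<le> (1 / (2 * s)) * (cmod (h t))\<^sup>2 + s / 2" for t
      using s(2) sum_squares_bound[of "cmod (h t)" s] by (simp add: field_simps power2_eq_square)
    show "integrable circ (\<lambda>t. (1 / (2 * s)) * (cmod (h t))\<^sup>2 + s / 2)"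
      using h2 finite_measure.integrable_const[OF finite_measure_circ]
      by (intro Bochner_Integration.integrable_add integrable_mult_right)
  qed (rule integrable_norm[OF hi])
  also have "\<dots> = (1 / (2 * s)) * (2 * pi * (\<Sum>n<N. (cmod (g n))\<^sup>2)) + 2 * pi * (s / 2)"
    using h2 finite_measure.integrable_const[OF finite_measure_circ]
    by (subst Bochner_Integration.integral_add) (auto simp only: integral_mult_right_zero e2 integral_circ_const
        integrable_mult_right real_scaleR_def)
  also have "\<dots> \<le> (1 / (2 * s)) * (2 * pi * s\<^sup>2) + 2 * pi * (s / 2)"
    using s by (intro add_right_mono mult_left_mono) auto
  also have "\<dots> = 2 * pi * s" using s(2) by (simp add: field_simps power2_eq_square)
  finally show ?thesis using hi c unfolding analytic_part_def by blast
qed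

text \<open>Riesz-Fischer by blocks: the first block costs \<open>s\<close>, and the block after
  \<open>N k\<close> has square sum below \<open>(\<epsilon> / 2^(k+1))^2\<close>, so that all later
  ones together cost \<epsilon>.\<close>

lemma analytic_part_l2:
  assumes g: "summable (\<lambda>m. (cmod (g m))\<^sup>2)" and s: "(\<Sum>m. (cmod (g m))\<^sup>2) \<le> s\<^sup>2" "s > 0" and \<epsilon>: "\<epsilon> > 0"
  shows "analytic_part g (s + \<epsilon>)"
proof -
  let ?q = "\<lambda>m. (cmod (g m))\<^sup>2"
  have "\<exists>n. \<forall>a\<ge>n. \<forall>b. sum ?q {a..<b} < (\<epsilon> * (1/2) ^ Suc k)\<^sup>2" for k
  proof -
    have "(\<epsilon> * (1/2) ^ Suc k)\<^sup>2 > 0" using \<epsilon> by simp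
    from summable_Cauchy[THEN iffD1, OF g, rule_format, OF this] show ?thesis
      by (auto simp: sum_nonneg)
  qed
  then obtain n where n: "\<And>k a b. a \<ge> n k \<Longrightarrow> sum ?q {a..<b} < (\<epsilon> * (1/2) ^ Suc k)\<^sup>2" by metis
  \<comment> \<open>The sum makes \<open>N\<close> monotone and at least \<open>n k\<close>; the
    extra \<open>k\<close> drives it to infinity.\<close>
  define N where "N k = k + (\<Sum>j\<le>k. n j)" for k
  have Nk: "n k \<le> N k" for k
    unfolding N_def using member_le_sum[of k "{..k}" n] by (simp add: trans_le_add2)
  have N_le: "k \<le> N k" for k by (simp add: N_def)
  have N_mono: "N k \<le> N (Suc k)" for k by (simp add: N_def)
  define G where "G k m = (if m < N k then g m else 0)" for k m
  have "analytic_part g (s + (\<Sum>k. \<epsilon> * (1/2) ^ Suc k))"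
  proof (rule analytic_part_limit[where G=G])
    have "(\<Sum>m<N 0. (cmod (G 0 m))\<^sup>2) = sum ?q {..<N 0}" by (simp add: G_def)
    also have "\<dots> \<le> suminf ?q" by (rule sum_le_suminf[OF g]) auto
    finally show "analytic_part (G 0) s"
      using s by (intro analytic_part_finite_support[where N="N 0"]) (auto simp: G_def)
    show "analytic_part (\<lambda>m. G (Suc k) m - G k m) (\<epsilon> * (1/2) ^ Suc k)" for k
    proof (rule analytic_part_finite_support[where N="N (Suc k)"])
      have "(\<Sum>m<N (Suc k). (cmod (G (Suc k) m - G k m))\<^sup>2) = sum ?q {N k..<N (Suc k)}"
        by (rule sum.mono_neutral_cong_right) (auto simp: G_def)
      also have "\<dots> < (\<epsilon> * (1/2) ^ Suc k)\<^sup>2" by (rule n[OF Nk])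
      finally show "(\<Sum>m<N (Suc k). (cmod (G (Suc k) m - G k m))\<^sup>2) \<le> (\<epsilon> * (1/2) ^ Suc k)\<^sup>2" by simp
    qed (use \<epsilon> N_mono[of k] in \<open>auto simp: G_def\<close>)
    show "summable (\<lambda>k. \<epsilon> * (1/2) ^ Suc k)"
      by (intro summable_mult summable_Suc_iff[THEN iffD2] summable_geometric) simp
    show "(\<lambda>k. G k m) \<longlonglongrightarrow> g m" for m
    proof (rule tendsto_eventually)
      show "\<forall>\<^sub>F k in sequentially. G k m = g m"
        using eventually_gt_at_top[of m] by eventually_elim (use N_le in \<open>auto simp: G_def intro: less_le_trans\<close>)
    qed
  qed
  moreover have "(\<Sum>k. \<epsilon> * (1/2) ^ Suc k) = \<epsilon>"
    using sums_mult[OF power_half_series, of \<epsilon>] by (simp add: sums_iff)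
  ultimately show ?thesis by simp
qed

section \<open>Fejer means and when their boundedness yields a function\<close>

definition fejer :: "nat \<Rightarrow> (nat \<Rightarrow> complex) \<Rightarrow> nat \<Rightarrow> complex" where
  "fejer M g m = (if m < M then of_real (1 - real m / real M) * g m else 0)"

text \<open>Weaker in general than a bound by \<open>analytic_part\<close>: the coefficients of a
  point mass also satisfy such an estimate.\<close>

definition fejer_bounded :: "(nat \<Rightarrow> complex) \<Rightarrow> real \<Rightarrow> bool" where
  "fejer_bounded g \<delta> \<longleftrightarrow> (\<forall>M\<ge>1. analytic_part (fejer M g) \<delta>)"

lemma fejer_bounded_add:
  assumes "fejer_bounded g \<delta>" "fejer_bounded g' \<delta>'"
  shows "fejer_bounded (\<lambda>m. g m + g' m) (\<delta> + \<delta>')"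
proof -
  have "fejer M (\<lambda>m. g m + g' m) = (\<lambda>m. fejer M g m + fejer M g' m)" for M
    by (auto simp: fejer_def distrib_left)
  thus ?thesis using assms by (simp add: fejer_bounded_def analytic_part_add)
qed

lemma fejer_bounded_uminus:
  assumes "fejer_bounded g \<delta>" shows "fejer_bounded (\<lambda>m. - g m) \<delta>"
proof -
  have "fejer M (\<lambda>m. - g m) = (\<lambda>m. - fejer M g m)" for M by (auto simp: fejer_def)
  thus ?thesis using assms by (simp add: fejer_bounded_def analytic_part_uminus)
qed

lemma fejer_bounded_coeff:
  assumes "fejer_bounded g \<delta>" shows "cmod (g m) \<le> 2 * \<delta>"
proof -
  \<comment> \<open>With this length the Fejer weight at \<open>m\<close> is at least
    \<open>1/2\<close>, which explains the factor \<open>2\<close>.\<close>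
  let ?M = "2 * Suc m"
  have "cmod (fejer ?M g m) \<le> \<delta>"
    using assms by (intro analytic_part_coeff_le) (simp add: fejer_bounded_def)
  moreover have "cmod (fejer ?M g m) = \<bar>1 - real m / real ?M\<bar> * cmod (g m)"
    by (simp add: fejer_def norm_mult del: of_real_diff)
  moreover have "1/2 * cmod (g m) \<le> \<bar>1 - real m / real ?M\<bar> * cmod (g m)"
    by (intro mult_right_mono) (auto simp: field_simps)
  ultimately show ?thesis by linarith
qed

text \<open>For square-summable \<open>g\<close> the Fejer means converge in \<open>l^2\<close>,
  hence in the quotient norm; one late mean, bounded by \<delta>, and its small error represent
  \<open>g\<close>.\<close>

lemma fejer_bounded_l2:
  assumes F: "fejer_bounded g \<delta>" and g: "summable (\<lambda>m. (cmod (g m))\<^sup>2)" and \<epsilon>: "\<epsilon> > 0"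
  shows "analytic_part g (\<delta> + \<epsilon>)"
proof -
  let ?q = "\<lambda>m. (cmod (g m))\<^sup>2"
  \<comment> \<open>One half bounds the \<open>l^2\<close> error, the other is the slack demanded by
    \<open>analytic_part_l2\<close>.\<close>
  define s where "s = \<epsilon> / 2"
  have s: "s > 0" using \<epsilon> by (simp add: s_def)
  obtain N where N: "(\<Sum>m. ?q (m + N)) < s\<^sup>2 / 2"
  proof -
    have "s\<^sup>2 / 2 > 0" using s by simp
    from suminf_exist_split[OF this g] obtain N where "\<forall>n\<ge>N. norm (\<Sum>i. ?q (i + n)) < s\<^sup>2 / 2" by auto
    thus thesis using that[of N] by (auto simp: abs_less_iff)
  qed
  \<comment> \<open>The relative error of the Fejer mean at \<open>m < M\<close> is
    \<open>m / M\<close>. A large \<open>M\<close> controls the first \<open>N\<close> terms; the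
    choice of \<open>N\<close> controls the rest.\<close>
  obtain M :: nat where M: "M \<ge> 1" "(real N)\<^sup>2 * suminf ?q \<le> s\<^sup>2 / 2 * real M"
  proof -
    obtain M0 :: nat where M0: "real M0 > (real N)\<^sup>2 * suminf ?q / (s\<^sup>2 / 2)"
      using reals_Archimedean2 by blast
    have "(real N)\<^sup>2 * suminf ?q \<le> s\<^sup>2 / 2 * real M0"
      using M0 s by (simp add: field_simps)
    also have "\<dots> \<le> s\<^sup>2 / 2 * real (Suc M0)" by (intro mult_left_mono) auto
    finally show thesis by (intro that[of "Suc M0"]) auto
  qed
  define r where "r m = g m - fejer M g m" for m
  have small: "cmod (r m) = real m / real M * cmod (g m)" if "m < M" for m
  proof -
    have "r m = of_real (real m / real M) * g m" using that by (simp add: r_def fejer_def algebra_simps)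
    thus ?thesis by (simp add: norm_mult norm_divide)
  qed
  have rm: "(cmod (r m))\<^sup>2 \<le> ?q m" for m
  proof -
    have "cmod (r m) \<le> cmod (g m)"
    proof (cases "m < M")
      case True
      hence "cmod (r m) = real m / real M * cmod (g m)" by (rule small)
      also have "\<dots> \<le> 1 * cmod (g m)" using True by (intro mult_right_mono) auto
      finally show ?thesis by simp
    qed (simp add: r_def fejer_def)
    thus ?thesis by (intro power_mono) auto
  qed
  have rN: "(cmod (r m))\<^sup>2 \<le> (real N / real M)\<^sup>2 * ?q m" if "m < N" for m
  proof -
    have "cmod (r m) \<le> real N / real M * cmod (g m)"
    proof (cases "m < M")
      case True
      hence "cmod (r m) = real m / real M * cmod (g m)" by (rule small)
      also have "\<dots> \<le> real N / real M * cmod (g m)" using that by (intro mult_right_mono divide_right_mono) auto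
      finally show ?thesis .
    next
      case False
      have "1 * cmod (g m) \<le> real N / real M * cmod (g m)" using that False M by (intro mult_right_mono) auto
      thus ?thesis using False by (simp add: r_def fejer_def)
    qed
    thus ?thesis unfolding power_mult_distrib[symmetric] by (intro power_mono) auto
  qed
  have sr: "summable (\<lambda>m. (cmod (r m))\<^sup>2)"
    by (rule summable_comparison_test'[OF g, of 0]) (use rm in auto)
  have "(\<Sum>m. (cmod (r m))\<^sup>2) = (\<Sum>m. (cmod (r (m + N)))\<^sup>2) + (\<Sum>m<N. (cmod (r m))\<^sup>2)"
    by (rule suminf_split_initial_segment[OF sr])
  also have "(\<Sum>m. (cmod (r (m + N)))\<^sup>2) \<le> (\<Sum>m. ?q (m + N))"
    by (intro suminf_le rm summable_ignore_initial_segment sr g)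
  also have "\<dots> \<le> s\<^sup>2 / 2" using N by simp
  also have "(\<Sum>m<N. (cmod (r m))\<^sup>2) \<le> (\<Sum>m<N. (real N / real M)\<^sup>2 * ?q m)"
    by (intro sum_mono rN) auto
  also have "\<dots> \<le> (real N / real M)\<^sup>2 * suminf ?q"
    unfolding sum_distrib_left[symmetric] by (intro mult_left_mono sum_le_suminf[OF g]) auto
  also have "\<dots> = ((real N)\<^sup>2 * suminf ?q) / (real M)\<^sup>2" by (simp add: power_divide)
  also have "\<dots> \<le> (s\<^sup>2 / 2 * real M) / (real M)\<^sup>2" by (intro divide_right_mono M) auto
  also have "\<dots> = (s\<^sup>2 / 2) / real M" using M(1) by (simp add: power2_eq_square)
  also have "\<dots> \<le> (s\<^sup>2 / 2) / 1" using M(1) by (intro divide_left_mono) auto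
  finally have "(\<Sum>m. (cmod (r m))\<^sup>2) \<le> s\<^sup>2" by simp
  from analytic_part_l2[OF sr this s s] have "analytic_part r \<epsilon>" by (simp add: s_def)
  moreover have "analytic_part (fejer M g) \<delta>" using F M(1) by (simp add: fejer_bounded_def)
  ultimately have "analytic_part (\<lambda>m. fejer M g m + r m) (\<delta> + \<epsilon>)" by (rule analytic_part_add[rotated])
  thus ?thesis by (simp add: r_def)
qed

text \<open>Differences of approximants are square-summable with small Fejer bounds, hence small in
  the quotient norm by \<open>fejer_bounded_l2\<close>. The approximants are thus Cauchy there along
  a subsequence, and the coefficients identify the limit as \<open>g\<close>.\<close>

lemma fejer_bounded_limit:
  assumes F: "fejer_bounded g \<delta>" and G: "\<And>k. fejer_bounded (\<lambda>m. g m - G k m) (d k)" and d: "d \<longlonglongrightarrow> 0"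
    and l2: "\<And>k. summable (\<lambda>m. (cmod (G k m))\<^sup>2)" and \<epsilon>: "\<epsilon> > 0"
  shows "analytic_part g (\<delta> + \<epsilon>)"
proof -
  have "\<exists>j. d j < \<epsilon> / 8 * (1/2) ^ k" for k
  proof -
    have "\<epsilon> / 8 * (1/2) ^ k > 0" using \<epsilon> by simp
    from order_tendstoD(2)[OF d this] show ?thesis by (auto simp: eventually_sequentially)
  qed
  then obtain j where j: "\<And>k. d (j k) < \<epsilon> / 8 * (1/2) ^ k" by metis
  \<comment> \<open>The budget: increment \<open>k\<close> costs at most
    \<open>(1/8 + 1/16 + 1/8) \<epsilon> / 2^k\<close>, in all \<open>5 \<epsilon> / 8\<close>; the
    first approximant adds less than \<open>\<epsilon> / 4\<close> to \<delta>.\<close>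
  define e where "e k = \<epsilon> / 4 * (1/2) ^ k" for k :: nat
  have e: "e k > 0" for k using \<epsilon> by (simp add: e_def)
  have sub: "summable (\<lambda>m. (cmod (G a m - G b m))\<^sup>2)" for a b
  proof (rule summable_comparison_test'[where N=0])
    show "summable (\<lambda>m. 2 * (cmod (G a m))\<^sup>2 + 2 * (cmod (G b m))\<^sup>2)"
      by (intro summable_add summable_mult l2)
    show "norm ((cmod (G a m - G b m))\<^sup>2) \<le> 2 * (cmod (G a m))\<^sup>2 + 2 * (cmod (G b m))\<^sup>2" for m
      using norm_add_sq_le[of "G a m" "- G b m"] by simp
  qed
    have d0: "0 \<le> d k" for k
      using order.trans[OF norm_ge_zero fejer_bounded_coeff[OF G[of k], of 0]] by simp
    have se: "summable (\<lambda>k. \<epsilon> * (1/2) ^ k)" by (intro summable_mult summable_geometric) simp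
    have ss: "summable (\<lambda>k. d (j k) + d (j (Suc k)) + e (Suc k))"
    proof (rule summable_comparison_test'[OF se, of 0])
      fix k
      have "\<epsilon> / 8 * (1/2) ^ Suc k = \<epsilon> / 16 * (1/2) ^ k" "e (Suc k) = \<epsilon> / 8 * (1/2) ^ k" by (simp_all add: e_def)
      moreover have "0 < \<epsilon> * (1/2) ^ k" using \<epsilon> by simp
      ultimately show "norm (d (j k) + d (j (Suc k)) + e (Suc k)) \<le> \<epsilon> * (1/2) ^ k"
        using d0[of "j k"] d0[of "j (Suc k)"] j[of k] j[of "Suc k"] e[of "Suc k"] by simp
    qed
  have "analytic_part g ((\<delta> + d (j 0) + \<epsilon> / 8) + (\<Sum>k. d (j k) + d (j (Suc k)) + e (Suc k)))"
  proof (rule analytic_part_limit[where G="\<lambda>k. G (j k)"])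
    have "fejer_bounded (\<lambda>m. g m + - (g m - G (j 0) m)) (\<delta> + d (j 0))"
      by (intro fejer_bounded_add F fejer_bounded_uminus G)
    hence "fejer_bounded (G (j 0)) (\<delta> + d (j 0))" by simp
    thus "analytic_part (G (j 0)) (\<delta> + d (j 0) + \<epsilon> / 8)"
      by (rule fejer_bounded_l2[OF _ l2]) (use \<epsilon> in simp)
    show "analytic_part (\<lambda>m. G (j (Suc k)) m - G (j k) m) (d (j k) + d (j (Suc k)) + e (Suc k))" for k
    proof (rule fejer_bounded_l2[OF _ sub e])
      have "fejer_bounded (\<lambda>m. (g m - G (j k) m) + - (g m - G (j (Suc k)) m)) (d (j k) + d (j (Suc k)))"
        by (intro fejer_bounded_add fejer_bounded_uminus G)
      thus "fejer_bounded (\<lambda>m. G (j (Suc k)) m - G (j k) m) (d (j k) + d (j (Suc k)))" by simp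
    qed
    show "summable (\<lambda>k. d (j k) + d (j (Suc k)) + e (Suc k))" by (rule ss)
    show "(\<lambda>k. G (j k) m) \<longlonglongrightarrow> g m" for m
    proof (rule LIM_zero_cancel, rule Lim_null_comparison)
      show "\<forall>\<^sub>F k in sequentially. norm (G (j k) m - g m) \<le> 2 * (\<epsilon> / 8 * (1/2) ^ k)"
      proof (intro always_eventually allI)
        show "norm (G (j k) m - g m) \<le> 2 * (\<epsilon> / 8 * (1/2) ^ k)" for k
          using fejer_bounded_coeff[OF G[of "j k"], of m] j[of k] by (simp add: norm_minus_commute)
      qed
      show "(\<lambda>k. 2 * (\<epsilon> / 8 * (1/2) ^ k)) \<longlonglongrightarrow> 0"
        using tendsto_mult_right_zero[OF LIMSEQ_power_zero[of "1/2::real"], of "2 * (\<epsilon> / 8)"] by (simp add: mult.assoc)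
    qed
  qed
  moreover have "\<delta> + d (j 0) + \<epsilon> / 8 + (\<Sum>k. d (j k) + d (j (Suc k)) + e (Suc k)) \<le> \<delta> + \<epsilon>"
  proof -
    have "(\<Sum>k. d (j k) + d (j (Suc k)) + e (Suc k)) \<le> (\<Sum>k. \<epsilon> * 5 / 16 * (1/2) ^ k)"
    proof (rule suminf_le[OF _ ss])
      show "summable (\<lambda>k. \<epsilon> * 5 / 16 * (1/2) ^ k)" by (intro summable_mult summable_geometric) simp
      fix k
      have "\<epsilon> / 8 * (1/2) ^ Suc k = \<epsilon> / 16 * (1/2) ^ k" "e (Suc k) = \<epsilon> / 8 * (1/2) ^ k" by (simp_all add: e_def)
      thus "d (j k) + d (j (Suc k)) + e (Suc k) \<le> \<epsilon> * 5 / 16 * (1/2) ^ k"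
        using j[of k] j[of "Suc k"] by simp
    qed
    also have "\<dots> = \<epsilon> * 5 / 16 * 2" by (subst suminf_mult) (simp_all add: suminf_geometric)
    finally show ?thesis using j[of 0] \<epsilon> by simp
  qed
  ultimately show ?thesis by (rule analytic_part_mono)
qed

text \<open>
  Positivity of the Fejer sums of all \<open>a + b + c g + cnj c g'\<close> makes the Fejer sum of \<open>(g, g')\<close> a
  positive semidefinite form at each point; the Cauchy--Schwarz inequality bounds it by the
  arithmetic mean of its diagonal values, whose integral only sees the constant term.
\<close>

lemma fejer_bounded_positive:
  fixes a b g g' :: "nat \<Rightarrow> complex"
  assumes herm: "g' 0 = cnj (g 0)"
    and pos: "\<And>c z M. cmod c = 1 \<Longrightarrow> cmod z = 1 \<Longrightarrow> M \<ge> 1 \<Longrightarrow>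
      0 \<le> real M * Re (a 0 + b 0 + c * g 0 + cnj c * g' 0)
        + 2 * (\<Sum>m\<in>{1..<M}. real (M - m) * Re (z ^ m * (a m + b m + c * g m + cnj c * g' m)))"
  shows "fejer_bounded g (Re (a 0 + b 0) / 2)"
  unfolding fejer_bounded_def
proof (intro allI impI)
  fix M :: nat assume M: "M \<ge> 1"
  define w where "w m = complex_of_real (1 - real m / real M)" for m
  \<comment> \<open>Only the nonpositive frequencies are prescribed. The positive ones are filled
    with conjugates of \<open>g'\<close>, so that \<open>h t\<close> is the off-diagonal value of a
    Hermitian form.\<close>
  define h where "h t = g 0 + (\<Sum>n\<in>{1..<M}. w n * g n * cis (of_int (- int n) * t)
      + w n * cnj (g' n) * cis (of_int (int n) * t))" for t
  define \<beta> where "\<beta> t = (a 0 + b 0) + (\<Sum>n\<in>{1..<M}. 2 * w n * (a n + b n) * cis (of_int (- int n) * t))" for t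
  have int: "integrable circ (\<lambda>t. c * cis (r * t))" for c r
    by (intro integrable_circ_continuous continuous_intros)
  have hi: "integrable circ h" and \<beta>i: "integrable circ \<beta>"
    unfolding h_def \<beta>_def by (intro integrable_circ_continuous continuous_intros)+
  have c: "cint (\<lambda>t. h t * cis (real m * t)) = of_real (2 * pi) * fejer M g m" for m
  proof -
    have "h t * cis (real m * t) = g 0 * cis (of_int (int m) * t) + (\<Sum>n\<in>{1..<M}. w n * g n * cis (of_int (int m - int n) * t)
        + w n * cnj (g' n) * cis (of_int (int m + int n) * t))" for t
      unfolding h_def by (simp only: distrib_right sum_distrib_right mult.assoc cis_mult) (simp add: algebra_simps)
    hence "cint (\<lambda>t. h t * cis (real m * t))
        = g 0 * cint (\<lambda>t. cis (of_int (int m) * t))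
          + (\<Sum>n\<in>{1..<M}. w n * g n * cint (\<lambda>t. cis (of_int (int m - int n) * t))
              + w n * cnj (g' n) * cint (\<lambda>t. cis (of_int (int m + int n) * t)))"
      by (simp only: integral_mult_right_zero Bochner_Integration.integral_sum Bochner_Integration.integral_add
          int Bochner_Integration.integrable_sum Bochner_Integration.integrable_add)
    also have "\<dots> = (if m = 0 then 2 * pi * g 0 else 0) + (\<Sum>n\<in>{1..<M}. if m = n then 2 * pi * (w n * g n) else 0)"
      unfolding integral_circ_cis by (intro arg_cong2[where f="(+)"] sum.cong) auto
    also have "\<dots> = of_real (2 * pi) * fejer M g m"
      using M by (cases "m = 0") (auto simp: fejer_def sum.delta w_def)
    finally show ?thesis .
  qed
  have \<beta>0: "cint \<beta> = of_real (2 * pi) * (a 0 + b 0)"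
  proof -
    have "\<beta> = (\<lambda>t. (a 0 + b 0) * cis (of_int 0 * t) + (\<Sum>n\<in>{1..<M}. 2 * w n * (a n + b n) * cis (of_int (- int n) * t)))"
      by (simp add: \<beta>_def fun_eq_iff)
    hence "cint \<beta> = (a 0 + b 0) * cint (\<lambda>t. cis (of_int 0 * t))
        + (\<Sum>n\<in>{1..<M}. 2 * w n * (a n + b n) * cint (\<lambda>t. cis (of_int (- int n) * t)))"
      by (simp only: integral_mult_right_zero Bochner_Integration.integral_sum Bochner_Integration.integral_add
          int Bochner_Integration.integrable_sum Bochner_Integration.integrable_add)
    also have "\<dots> = of_real (2 * pi) * (a 0 + b 0)"
      unfolding integral_circ_cis by simp
    finally show ?thesis .
  qed
  have le: "cmod (h t) \<le> Re (\<beta> t) / 2" for t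
  proof -
    \<comment> \<open>The phase turning \<open>h t\<close> into \<open>- cmod (h t)\<close>, so that
      positivity becomes an upper bound for the modulus.\<close>
    define c where "c = (if h t = 0 then 1 else - cnj (h t) / cmod (h t))"
    have c: "cmod c = 1" "c * h t = - of_real (cmod (h t))"
      by (auto simp: c_def norm_divide power2_eq_square mult.commute[of "cnj _"] simp flip: complex_norm_square)
    define z where "z = cis (- t)"
    have z1: "cis (of_int (- int n) * t) = z ^ n" for n
    proof -
      have "of_int (- int n) * t = real n * (- t)" by simp
      thus ?thesis unfolding z_def Complex.DeMoivre by (simp only: Complex.DeMoivre)
    qed
    have "cis (of_int (int n) * t) = cnj (z ^ n)" for n
      unfolding z1[symmetric] by (simp add: cis_cnj)
    note z = z1 this
    have wM: "real M * Re (w n * x) = real (M - n) * Re x" if "n \<in> {1..<M}" for n x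
      using that M by (simp add: w_def of_nat_diff field_simps)
    have "real M * Re (\<beta> t) = real M * Re (a 0 + b 0) + (\<Sum>n\<in>{1..<M}. real M * Re (w n * (2 * (a n + b n) * z ^ n)))"
    proof -
      have "Re (\<beta> t) = Re (a 0 + b 0) + (\<Sum>n\<in>{1..<M}. Re (w n * (2 * (a n + b n) * z ^ n)))"
        unfolding \<beta>_def z by (simp only: plus_complex.sel Re_sum mult_ac)
      thus ?thesis by (simp only: distrib_left[of "real M"] sum_distrib_left[of "real M"])
    qed
    also have "\<dots> = real M * Re (a 0 + b 0) + 2 * (\<Sum>n\<in>{1..<M}. real (M - n) * Re (z ^ n * (a n + b n)))"
    proof -
      have r2: "Re (2 * x) = 2 * Re x" for x :: complex by simp
      show ?thesis
        unfolding sum_distrib_left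
      proof (intro arg_cong2[where f="(+)"] sum.cong refl)
        fix n assume n: "n \<in> {1..<M}"
        show "real M * Re (w n * (2 * (a n + b n) * z ^ n)) = 2 * (real (M - n) * Re (z ^ n * (a n + b n)))"
          unfolding wM[OF n] by (simp only: mult.assoc r2 mult.commute[of "z ^ n"] mult.left_commute[of _ "2::real"])
      qed
    qed
    finally have B: "real M * Re (\<beta> t) = real M * Re (a 0 + b 0) + 2 * (\<Sum>n\<in>{1..<M}. real (M - n) * Re (z ^ n * (a n + b n)))" .
    have "real M * Re (c * h t) = real M * Re (c * g 0)
        + (\<Sum>n\<in>{1..<M}. real M * Re (w n * (c * g n * z ^ n + c * cnj (g' n) * cnj (z ^ n))))"
    proof -
      have "c * h t = c * g 0 + (\<Sum>n\<in>{1..<M}. w n * (c * g n * z ^ n + c * cnj (g' n) * cnj (z ^ n)))"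
        unfolding h_def z by (simp only: distrib_left sum_distrib_left mult_ac)
      hence "Re (c * h t) = Re (c * g 0) + (\<Sum>n\<in>{1..<M}. Re (w n * (c * g n * z ^ n + c * cnj (g' n) * cnj (z ^ n))))"
        by (simp only: plus_complex.sel Re_sum)
      thus ?thesis by (simp only: distrib_left[of "real M"] sum_distrib_left[of "real M"])
    qed
    also have "\<dots> = real M * Re (c * g 0) + (\<Sum>n\<in>{1..<M}. real (M - n) * Re (z ^ n * (c * g n + cnj c * g' n)))"
    proof (intro arg_cong2[where f="(+)"] sum.cong refl)
      fix n assume "n \<in> {1..<M}"
      have "Re (c * cnj (g' n) * cnj (z ^ n)) = Re (cnj (cnj c * g' n * z ^ n))" by simp
      hence "Re (c * cnj (g' n) * cnj (z ^ n)) = Re (cnj c * g' n * z ^ n)" by (simp only: cnj.sel)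
      thus "real M * Re (w n * (c * g n * z ^ n + c * cnj (g' n) * cnj (z ^ n)))
          = real (M - n) * Re (z ^ n * (c * g n + cnj c * g' n))"
        unfolding wM[OF \<open>n \<in> _\<close>] by (simp only: plus_complex.sel distrib_left mult_ac)
    qed
    finally have H: "real M * Re (c * h t) = real M * Re (c * g 0)
        + (\<Sum>n\<in>{1..<M}. real (M - n) * Re (z ^ n * (c * g n + cnj c * g' n)))" .
    have "0 \<le> real M * Re (a 0 + b 0 + c * g 0 + cnj c * g' 0)
        + 2 * (\<Sum>m\<in>{1..<M}. real (M - m) * Re (z ^ m * (a m + b m + c * g m + cnj c * g' m)))"
      by (rule pos[OF c(1) _ M]) (simp add: z_def)
    also have "Re (a 0 + b 0 + c * g 0 + cnj c * g' 0) = Re (a 0 + b 0) + 2 * Re (c * g 0)"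
      unfolding herm by simp
    also have "(\<Sum>m\<in>{1..<M}. real (M - m) * Re (z ^ m * (a m + b m + c * g m + cnj c * g' m)))
        = (\<Sum>n\<in>{1..<M}. real (M - n) * Re (z ^ n * (a n + b n))) + (\<Sum>n\<in>{1..<M}. real (M - n) * Re (z ^ n * (c * g n + cnj c * g' n)))"
      unfolding sum.distrib[symmetric] by (intro sum.cong refl) (simp only: distrib_left plus_complex.sel add.assoc)
    finally have "0 \<le> real M * Re (\<beta> t) + 2 * (real M * Re (c * h t))"
      unfolding B H by (simp add: algebra_simps)
    also have "\<dots> = real M * (Re (\<beta> t) - 2 * cmod (h t))"
      unfolding c(2) by (simp add: algebra_simps)
    finally have "0 \<le> Re (\<beta> t) - 2 * cmod (h t)" using M by (simp add: zero_le_mult_iff)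
    thus ?thesis by simp
  qed
  have "cint (\<lambda>t. cmod (h t)) \<le> cint (\<lambda>t. Re (\<beta> t) / 2)"
    by (intro integral_mono integrable_norm hi le integrable_divide_zero integrable_Re \<beta>i)
  also have "\<dots> = 2 * pi * (Re (a 0 + b 0) / 2)"
    using integral_Re[OF \<beta>i] by (simp add: \<beta>0)
  finally show "analytic_part (fejer M g) (Re (a 0 + b 0) / 2)"
    using hi c unfolding analytic_part_def by blast
qed

section \<open>A sesquilinear form averaged over contractions\<close>

text \<open>The right-hand side dominates the squared norm of
  \<open>x + D x + ... + D^(M-1) x\<close>, with equality when \<open>D\<close> is an isometry. The
  induction writes the next sum as \<open>x\<close> plus \<open>D\<close> of the previous
  one.\<close>

lemma contraction_fejer_nonneg:
  fixes x :: "'b::real_inner"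
  assumes D: "linear D" "\<And>y. norm (D y) \<le> norm y"
  shows "0 \<le> real M * (norm x)\<^sup>2 + 2 * (\<Sum>m\<in>{1..<M}. real (M - m) * inner ((D ^^ m) x) x)"
proof -
  define a where "a k = (\<Sum>i<k. (D ^^ i) x)" for k
  have Da: "D (a k) = (\<Sum>i\<in>{1..<Suc k}. (D ^^ i) x)" for k
  proof -
    have "D (a k) = (\<Sum>i<k. (D ^^ Suc i) x)" by (simp add: a_def linear_sum[OF D(1)])
    also have "\<dots> = (\<Sum>i\<in>{1..<Suc k}. (D ^^ i) x)"
      by (rule sum.reindex_bij_witness[of _ "\<lambda>i. i - 1" Suc]) auto
    finally show ?thesis .
  qed
  have aS: "a (Suc k) = x + D (a k)" for k
    unfolding Da by (simp add: a_def lessThan_atLeast0 sum.atLeast_Suc_lessThan del: funpow.simps(2))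
  have step: "(norm (a (Suc k)))\<^sup>2 \<le> (norm (a k))\<^sup>2 + (norm x)\<^sup>2 + 2 * inner (D (a k)) x" for k
  proof -
    have "(norm (a (Suc k)))\<^sup>2 = (norm x)\<^sup>2 + 2 * inner (D (a k)) x + (norm (D (a k)))\<^sup>2"
      unfolding aS by (simp add: power2_norm_eq_inner inner_add_left inner_add_right inner_commute)
    moreover have "(norm (D (a k)))\<^sup>2 \<le> (norm (a k))\<^sup>2" by (intro power_mono D) auto
    ultimately show ?thesis by linarith
  qed
  have "(norm (a M))\<^sup>2 \<le> real M * (norm x)\<^sup>2 + 2 * (\<Sum>m\<in>{1..<M}. real (M - m) * inner ((D ^^ m) x) x)"
  proof (induction M)
    case 0
    show ?case by (simp add: a_def)
  next
    case (Suc M)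
    have "(\<Sum>m\<in>{1..<Suc M}. real (Suc M - m) * inner ((D ^^ m) x) x)
        = (\<Sum>m\<in>{1..<Suc M}. real (M - m) * inner ((D ^^ m) x) x + inner ((D ^^ m) x) x)"
      by (intro sum.cong refl) (auto simp: Suc_diff_le algebra_simps)
    also have "\<dots> = (\<Sum>m\<in>{1..<Suc M}. real (M - m) * inner ((D ^^ m) x) x) + inner (D (a M)) x"
      unfolding Da inner_sum_left sum.distrib ..
    also have "(\<Sum>m\<in>{1..<Suc M}. real (M - m) * inner ((D ^^ m) x) x) = (\<Sum>m\<in>{1..<M}. real (M - m) * inner ((D ^^ m) x) x)"
      by (rule sum.mono_neutral_right) auto
    finally have e: "(\<Sum>m\<in>{1..<Suc M}. real (Suc M - m) * inner ((D ^^ m) x) x)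
        = (\<Sum>m\<in>{1..<M}. real (M - m) * inner ((D ^^ m) x) x) + inner (D (a M)) x" .
    show ?case using step[of M] Suc unfolding e by (simp add: algebra_simps)
  qed
  thus ?thesis by (rule order.trans[OF zero_le_power2])
qed

text \<open>The last term measures the strict convexity of the norm; all decay used later stems from
  it.\<close>

lemma norm_convex_sq:
  fixes x y :: "'b::real_inner"
  shows "(norm ((1 - s) *\<^sub>R x + s *\<^sub>R y))\<^sup>2 = (1 - s) * (norm x)\<^sup>2 + s * (norm y)\<^sup>2 - s * (1 - s) * (norm (y - x))\<^sup>2"
  unfolding power2_norm_eq_inner
  by (simp add: inner_add_left inner_add_right inner_diff_left inner_diff_right inner_commute[of y x]
      power2_eq_square algebra_simps)

section \<open>Powers of convex combinations and divided differences\<close>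

definition blend :: "('b \<Rightarrow> 'b) \<Rightarrow> ('b \<Rightarrow> 'b) \<Rightarrow> real \<Rightarrow> 'b::real_vector \<Rightarrow> 'b" where
  "blend L R u x = u *\<^sub>R L x + (1 - u) *\<^sub>R R x"

text \<open>For commuting \<open>L\<close> and \<open>R\<close> this is the divided difference of
  \<open>z^(m+1)\<close>: multiplied by \<open>L - R\<close> it gives
  \<open>L^(m+1) - R^(m+1)\<close>.\<close>

definition power_sum :: "('b \<Rightarrow> 'b) \<Rightarrow> ('b \<Rightarrow> 'b) \<Rightarrow> nat \<Rightarrow> 'b::real_vector \<Rightarrow> 'b" where
  "power_sum L R m x = (\<Sum>d\<le>m. (L ^^ d) ((R ^^ (m - d)) x))"

lemma power_sum_Suc: "power_sum L R (Suc m) x = (L ^^ Suc m) x + power_sum L R m (R x)"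
proof -
  have "(\<Sum>d\<le>m. (L ^^ d) ((R ^^ (Suc m - d)) x)) = power_sum L R m (R x)"
    unfolding power_sum_def
    by (intro sum.cong refl) (simp add: Suc_diff_le funpow_swap1)
  thus ?thesis unfolding power_sum_def[of L R "Suc m"] by simp
qed

lemma power_sum_Suc':
  assumes "linear L"
  shows "power_sum L R (Suc m) x = (R ^^ Suc m) x + L (power_sum L R m x)"
proof -
  have "power_sum L R (Suc m) x = (R ^^ Suc m) x + (\<Sum>d\<le>m. (L ^^ Suc d) ((R ^^ (m - d)) x))"
    unfolding power_sum_def by (subst sum.atMost_Suc_shift) (simp del: funpow.simps(2))
  also have "(\<Sum>d\<le>m. (L ^^ Suc d) ((R ^^ (m - d)) x)) = L (power_sum L R m x)"
    by (simp add: power_sum_def linear_sum[OF assms])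
  finally show ?thesis .
qed

text \<open>
  The substitution \<open>u = v\<^sup>2\<close> matches \<open>weight\<close> below. The recursion in \<open>m\<close> comes from
  differentiating \<open>u (u L + (1 - u) R)\<^sup>m\<close>.
\<close>

lemma blend_integral:
  fixes L R :: "'b::chilbert_space \<Rightarrow> 'b"
  assumes L: "bounded_linear L" and R: "bounded_linear R" and comm: "\<And>x. L (R x) = R (L x)"
  shows "((\<lambda>v. (real (Suc m) * 2 * v) *\<^sub>R cinner ((blend L R (v\<^sup>2) ^^ m) x) y)
    has_integral cinner (power_sum L R m x) y) {0..1}"
proof (induction m arbitrary: x)
  case 0
  have "((\<lambda>v. (2 * v) *\<^sub>R cinner x y) has_integral (1\<^sup>2) *\<^sub>R cinner x y - (0\<^sup>2) *\<^sub>R cinner x y) {0..1}"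
    by (rule fundamental_theorem_of_calculus) (auto intro!: derivative_eq_intros)
  thus ?case by (simp add: power_sum_def)
next
  case (Suc m)
  interpret L: bounded_linear L by fact
  interpret R: bounded_linear R by fact
  let ?C = "blend L R"
  let ?D = "\<lambda>x. L x - R x"
  have Cadd: "?C u (a + b) = ?C u a + ?C u b" for u a b
    by (simp add: blend_def L.add R.add algebra_simps)
  have Csc: "?C u (r *\<^sub>R a) = r *\<^sub>R ?C u a" for u a r
    by (simp add: blend_def L.scaleR R.scaleR algebra_simps)
  have CD: "?D (?C u a) = ?C u (?D a)" for u a
    by (simp add: blend_def L.add R.add L.scaleR R.scaleR L.diff R.diff comm algebra_simps)
  have CDn: "?D ((?C u ^^ k) a) = (?C u ^^ k) (?D a)" for u k a
    by (induction k) (simp_all add: CD)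
  have deriv: "((\<lambda>v. (?C (v\<^sup>2) ^^ k) a) has_vector_derivative
      (2 * v * real k) *\<^sub>R (?C (v\<^sup>2) ^^ (k - 1)) (?D a)) (at v within {0..1})" for k a v
  proof (induction k)
    case 0
    show ?case by simp
  next
    case (Suc k)
    let ?f = "\<lambda>v. (?C (v\<^sup>2) ^^ k) a" and ?f' = "(2 * v * real k) *\<^sub>R (?C (v\<^sup>2) ^^ (k - 1)) (?D a)"
    have "((\<lambda>v. v\<^sup>2 *\<^sub>R L (?f v) + (1 - v\<^sup>2) *\<^sub>R R (?f v)) has_vector_derivative
        (v\<^sup>2 *\<^sub>R L ?f' + (2 * v) *\<^sub>R L (?f v)) + ((1 - v\<^sup>2) *\<^sub>R R ?f' + (- (2 * v)) *\<^sub>R R (?f v))) (at v within {0..1})"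
      by (intro has_vector_derivative_add has_vector_derivative_scaleR
          bounded_linear.has_vector_derivative[OF L Suc] bounded_linear.has_vector_derivative[OF R Suc])
        (auto intro!: derivative_eq_intros)
    also have "(v\<^sup>2 *\<^sub>R L ?f' + (2 * v) *\<^sub>R L (?f v)) + ((1 - v\<^sup>2) *\<^sub>R R ?f' + (- (2 * v)) *\<^sub>R R (?f v))
        = ?C (v\<^sup>2) ?f' + (2 * v) *\<^sub>R ?D (?f v)"
      by (simp add: blend_def algebra_simps)
    also have "?C (v\<^sup>2) ?f' = (2 * v * real k) *\<^sub>R (?C (v\<^sup>2) ^^ k) (?D a)"
      unfolding Csc by (cases k) auto
    also have "(2 * v * real k) *\<^sub>R (?C (v\<^sup>2) ^^ k) (?D a) + (2 * v) *\<^sub>R ?D (?f v)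
        = (2 * v * real (Suc k)) *\<^sub>R (?C (v\<^sup>2) ^^ (Suc k - 1)) (?D a)"
      unfolding CDn by (simp add: algebra_simps)
    moreover have "(?C (v\<^sup>2) ^^ Suc k) a = v\<^sup>2 *\<^sub>R L (?f v) + (1 - v\<^sup>2) *\<^sub>R R (?f v)" for v
      unfolding funpow.simps(2) o_apply by (rule blend_def)
    ultimately show ?case by (simp only:)
  qed
  let ?K' = "\<lambda>v. v\<^sup>2 *\<^sub>R cinner ((2 * v * real (Suc m)) *\<^sub>R (?C (v\<^sup>2) ^^ m) (?D x)) y + (2 * v) *\<^sub>R cinner ((?C (v\<^sup>2) ^^ Suc m) x) y"
  let ?F = "\<lambda>v. (real (Suc (Suc m)) * 2 * v) *\<^sub>R cinner ((?C (v\<^sup>2) ^^ Suc m) x) y - (real (Suc m) * 2 * v) *\<^sub>R cinner ((?C (v\<^sup>2) ^^ m) (R x)) y"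
  let ?K = "\<lambda>v. v\<^sup>2 *\<^sub>R cinner ((?C (v\<^sup>2) ^^ Suc m) x) y"
  have D: "(?K has_vector_derivative ?K' v) (at v within {0..1})" for v
    using deriv[of "Suc m" x v]
    by (intro has_vector_derivative_scaleR bounded_linear.has_vector_derivative[OF cinner.bounded_linear_left])
      (auto intro!: derivative_eq_intros)
  \<comment> \<open>Since \<open>u (L - R) = C - R\<close>, the \<open>u\<close>-derivative
    \<open>C^(m+1) + (m+1) u C^m (L - R)\<close> of \<open>u C^(m+1)\<close> equals
    \<open>(m+2) C^(m+1) - (m+1) C^m R\<close>. This is \<open>?F\<close> up to the factor
    \<open>2 v\<close> of the substitution, and it matches \<open>power_sum_Suc\<close>.\<close>
  have CS: "(?C u ^^ Suc m) x = u *\<^sub>R (?C u ^^ m) (?D x) + (?C u ^^ m) (R x)" for u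
  proof -
    have "(?C u ^^ k) (a + b) = (?C u ^^ k) a + (?C u ^^ k) b" "(?C u ^^ k) (r *\<^sub>R a) = r *\<^sub>R (?C u ^^ k) a" for k a b r
      by (induction k) (simp_all add: Cadd Csc)
    moreover have "?C u x = u *\<^sub>R ?D x + R x" by (simp add: blend_def algebra_simps)
    ultimately show ?thesis by (simp add: funpow_swap1)
  qed
  have eq: "?K' v
      = ?F v" for v
    unfolding CS by (simp add: cinner_add_left cinner.scaleR_left scaleR_conv_of_real algebra_simps)
  have "((\<lambda>v. ?K' v) has_integral ?K 1 - ?K 0) {0..1}"
    by (rule fundamental_theorem_of_calculus[OF _ D]) simp
  moreover have "?K 1 - ?K 0 = cinner ((L ^^ Suc m) x) y"
  proof -
    have "?C 1 = L" by (auto simp: blend_def)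
    thus ?thesis by simp
  qed
  ultimately have "((\<lambda>v. ?F v)
      has_integral cinner ((L ^^ Suc m) x) y) {0..1}"
    unfolding eq by simp
  from has_integral_add[OF this Suc[of "R x"]] show ?case
    unfolding power_sum_Suc cinner_add_left by simp
qed

section \<open>The averaged form attached to two contractions\<close>

locale contraction_pair =
  fixes T0 T :: "'a::chilbert_space \<Rightarrow>\<^sub>L 'a" and V :: "'a hs"
  assumes contraction_T0: "contraction T0" and contraction_T: "contraction T"
    and op_V: "op_of_hs V = T - T0"
begin

lemma linT0: "complex_linear T0" and linT: "complex_linear T"
  using contraction_T0 contraction_T by (auto simp: contraction_def)

definition path :: "real \<Rightarrow> 'a \<Rightarrow>\<^sub>L 'a" where
  "path s = T0 + s *\<^sub>R (T - T0)"

lemma path_linear: "complex_linear (path s)"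
  unfolding path_def by (intro complex_linear_add complex_linear_scaleR complex_linear_diff linT linT0)

lemma path_0 [simp]: "path 0 = T0" and path_1 [simp]: "path 1 = T"
  by (simp_all add: path_def)

lemma path_diff: "path b = path a + (b - a) *\<^sub>R op_of_hs V"
  by (simp add: path_def op_V algebra_simps)

lemma norm_path_le:
  assumes "0 \<le> s" "s \<le> 1" shows "norm (path s) \<le> 1"
proof -
  have "path s = (1 - s) *\<^sub>R T0 + s *\<^sub>R T" by (simp add: path_def algebra_simps)
  also have "norm \<dots> \<le> (1 - s) * norm T0 + s * norm T"
    using norm_triangle_ineq[of "(1 - s) *\<^sub>R T0" "s *\<^sub>R T"] assms by simp
  also have "\<dots> \<le> (1 - s) * 1 + s * 1"
    using contraction_T0 contraction_T assms by (intro add_mono mult_left_mono) (auto simp: contraction_def)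
  finally show ?thesis by simp
qed

definition cop :: "real \<times> real \<Rightarrow> 'a hs \<Rightarrow> 'a hs" where
  "cop p = blend (lmul (path ((fst p)\<^sup>2))) (\<lambda>X. rmul X (path ((fst p)\<^sup>2))) ((snd p)\<^sup>2)"

abbreviation Q :: "(real \<times> real) set" where
  "Q \<equiv> cbox (0, 0) (1, 1)"

text \<open>
  The measure \<open>(1 - s) du ds\<close> after the substitution \<open>s = w\<^sup>2\<close>, \<open>u = v\<^sup>2\<close>, with \<open>p = (w, v)\<close>: the square
  of this density absorbs the factor \<open>1 / (u s (1 - s))\<close> that \<open>defect_bound\<close> costs.
\<close>

definition weight :: "real \<times> real \<Rightarrow> real" where
  "weight p = 4 * fst p * snd p * (1 - (fst p)\<^sup>2)"

lemma QD: assumes "p \<in> Q" shows "0 \<le> fst p" "fst p \<le> 1" "0 \<le> snd p" "snd p \<le> 1"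
    "(fst p)\<^sup>2 \<le> 1" "(snd p)\<^sup>2 \<le> 1" "0 \<le> weight p"
proof -
  show 1: "0 \<le> fst p" "fst p \<le> 1" "0 \<le> snd p" "snd p \<le> 1"
    using assms by (cases p; auto simp: cbox_Pair_eq)+
  thus 2: "(fst p)\<^sup>2 \<le> 1" "(snd p)\<^sup>2 \<le> 1" by (simp_all add: power_le_one)
  show "0 \<le> weight p" using 1 2 by (simp add: weight_def)
qed

lemma lmul_path: "lmul (path b) X = lmul (path a) X + (b - a) *\<^sub>R lmul (op_of_hs V) X"
  by (rule hs_eqI, simp add: op_of_lmul path_linear op_of_hs_simps op_of_hs_linear op_left, subst path_diff[of b a], simp add: op_left)

lemma rmul_path: "rmul X (path b) = rmul X (path a) + (b - a) *\<^sub>R rmul X (op_of_hs V)"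
  by (rule hs_eqI, simp add: op_of_rmul path_linear op_of_hs_simps op_of_hs_linear op_left,
      subst path_diff[of b a], simp add: blinfun.add_left blinfun.add_right blinfun.scaleR_left blinfun.scaleR_right)

lemma continuous_cop_power: "continuous_on S (\<lambda>p. (cop p ^^ m) X)"
proof (induction m)
  case (Suc m)
  \<comment> \<open>Expanding \<open>path\<close> at \<open>0\<close> displays the dependence on
    \<open>p\<close> through polynomial coefficients and fixed bounded operators.\<close>
  have "continuous_on S (\<lambda>p. (snd p)\<^sup>2 *\<^sub>R (lmul (path 0) ((cop p ^^ m) X) + ((fst p)\<^sup>2 - 0) *\<^sub>R lmul (op_of_hs V) ((cop p ^^ m) X))
     + (1 - (snd p)\<^sup>2) *\<^sub>R (rmul ((cop p ^^ m) X) (path 0) + ((fst p)\<^sup>2 - 0) *\<^sub>R rmul ((cop p ^^ m) X) (op_of_hs V)))"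
    by (intro continuous_intros bounded_linear.continuous_on[OF bounded_linear_lmul]
        bounded_linear.continuous_on[OF bounded_linear_rmul] Suc)
  thus ?case
    unfolding lmul_path[symmetric] rmul_path[symmetric] funpow.simps(2) o_apply
    by (simp only: cop_def blend_def)
qed simp

lemma cop_linear: "linear (cop p)"
  by (rule linearI) (simp_all add: cop_def blend_def lmul_add rmul_add lmul_scaleR rmul_scaleR algebra_simps)

lemma cop_scaleC: "cop p (c *\<^sub>C X) = c *\<^sub>C cop p X"
  by (simp add: cop_def blend_def lmul_scaleC rmul_scaleC scaleC_add_right scaleC_real scaleC_scaleC mult.commute)

lemma cop_power_add: "(cop p ^^ m) (X + Y) = (cop p ^^ m) X + (cop p ^^ m) Y"
  by (induction m) (simp_all add: linear_add[OF cop_linear])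

lemma cop_power_scaleC: "(cop p ^^ m) (c *\<^sub>C X) = c *\<^sub>C (cop p ^^ m) X"
  by (induction m) (simp_all add: cop_scaleC)

lemma norm_lmul_contraction: "norm A \<le> 1 \<Longrightarrow> norm (lmul A X) \<le> norm X"
  using norm_lmul[of A X] mult_right_mono[of "norm A" 1 "norm X"] by simp

lemma norm_rmul_contraction: "norm A \<le> 1 \<Longrightarrow> norm (rmul X A) \<le> norm X"
  using norm_rmul[of X A] mult_left_mono[of "norm A" 1 "norm X"] by simp

lemma norm_cop:
  assumes "p \<in> Q" shows "norm (cop p X) \<le> norm X"
proof -
  let ?u = "(snd p)\<^sup>2"
  note q = QD[OF assms]
  have P: "norm (path ((fst p)\<^sup>2)) \<le> 1" using q by (intro norm_path_le) auto
  have "norm (cop p X) \<le> ?u * norm (lmul (path ((fst p)\<^sup>2)) X) + (1 - ?u) * norm (rmul X (path ((fst p)\<^sup>2)))"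
    unfolding cop_def blend_def using q by (intro norm_triangle_le) (simp add: mult_left_mono)
  also have "\<dots> \<le> ?u * norm X + (1 - ?u) * norm X"
    using q by (intro add_mono mult_left_mono norm_lmul_contraction norm_rmul_contraction P) auto
  finally show ?thesis by (simp add: algebra_simps)
qed

definition form :: "nat \<Rightarrow> 'a hs \<Rightarrow> 'a hs \<Rightarrow> complex" where
  "form m X Y = integral Q (\<lambda>p. weight p *\<^sub>R cinner ((cop p ^^ m) X) Y)"

lemma continuous_weight: "continuous_on S weight"
  unfolding weight_def by (intro continuous_intros)

lemmas form_continuous = continuous_intros cinner.continuous_on continuous_cop_power continuous_weight

lemma continuous_form_integrand: "continuous_on S (\<lambda>p. weight p *\<^sub>R cinner ((cop p ^^ m) X) Y)"
  by (intro form_continuous)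

lemma form_integrable: "(\<lambda>p. weight p *\<^sub>R cinner ((cop p ^^ m) X) Y) integrable_on Q"
  by (rule integrable_continuous[OF continuous_form_integrand])

lemma form_add_left: "form m (X + Y) Z = form m X Z + form m Y Z"
  unfolding form_def
  by (subst integral_add[OF form_integrable form_integrable, symmetric])
    (simp add: cop_power_add cinner_add_left scaleR_add_right)

lemma form_add_right: "form m X (Y + Z) = form m X Y + form m X Z"
  unfolding form_def
  by (subst integral_add[OF form_integrable form_integrable, symmetric])
    (simp add: cinner_add_right scaleR_add_right)

lemma form_scaleC_left: "form m (c *\<^sub>C X) Y = c * form m X Y"
proof -
  have "form m (c *\<^sub>C X) Y = integral Q (\<lambda>p. c * (weight p *\<^sub>R cinner ((cop p ^^ m) X) Y))"
    by (simp add: form_def cop_power_scaleC cinner_scaleC_left)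
  thus ?thesis by (simp only: form_def integral_mult_right)
qed

lemma form_scaleC_right: "form m X (c *\<^sub>C Y) = cnj c * form m X Y"
proof -
  have "form m X (c *\<^sub>C Y) = integral Q (\<lambda>p. cnj c * (weight p *\<^sub>R cinner ((cop p ^^ m) X) Y))"
    by (simp add: form_def cinner_scaleC_right)
  thus ?thesis by (simp only: form_def integral_mult_right)
qed

text \<open>In the variables \<open>s\<close> and \<open>u\<close> this is the integral of
  \<open>1 - s\<close> over the unit square.\<close>

lemma integral_weight: "integral Q weight = 1/2"
proof -
  have inner: "integral (cbox 0 1) (\<lambda>v. weight (w, v)) = 2 * w * (1 - w\<^sup>2)" for w
  proof -
    have "((\<lambda>v. weight (w, v)) has_integral (2 * w * (1 - w\<^sup>2) * 1\<^sup>2 - 2 * w * (1 - w\<^sup>2) * 0\<^sup>2)) {0..1}"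
      by (rule fundamental_theorem_of_calculus)
        (auto intro!: derivative_eq_intros simp: weight_def simp flip: has_real_derivative_iff_has_vector_derivative)
    thus ?thesis by (simp add: integral_unique)
  qed
  have "integral Q weight = integral (cbox 0 1) (\<lambda>w. integral (cbox 0 1) (\<lambda>v. weight (w, v)))"
    by (rule integral_prod_continuous[OF continuous_weight])
  also have "\<dots> = integral {0..1} (\<lambda>w. 2 * w * (1 - w\<^sup>2))" unfolding inner by simp
  also have "\<dots> = 1/2"
  proof -
    have "((\<lambda>w. 2 * w * (1 - w\<^sup>2)) has_integral ((1::real)\<^sup>2 - 1^4/2 - (0\<^sup>2 - 0^4/2))) {0..1}"
      by (rule fundamental_theorem_of_calculus)
        (auto intro!: derivative_eq_intros simp: algebra_simps power_numeral_reduce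
          simp flip: has_real_derivative_iff_has_vector_derivative)
    thus ?thesis by (simp add: integral_unique)
  qed
  finally show ?thesis .
qed

lemma form_0: "form 0 X Y = cinner X Y / 2"
proof -
  have "form 0 X Y = integral Q weight *\<^sub>R cinner X Y"
    unfolding form_def funpow.simps(1) id_apply
    by (rule integral_unique[OF has_integral_scaleR_left[OF integrable_integral]])
      (rule integrable_continuous[OF continuous_weight])
  thus ?thesis by (simp add: integral_weight scaleR_conv_of_real)
qed

text \<open>At each \<open>p\<close> the map \<open>z C\<close> is a contraction of the
  Hilbert-Schmidt space, so \<open>contraction_fejer_nonneg\<close> applies pointwise; the weight is
  nonnegative.\<close>

lemma form_positive:
  assumes z: "cmod z = 1"
  shows "0 \<le> real M * Re (form 0 Z Z) + 2 * (\<Sum>m\<in>{1..<M}. real (M - m) * Re (z ^ m * form m Z Z))"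
proof -
  let ?f = "\<lambda>m p. weight p * Re (z ^ m * cinner ((cop p ^^ m) Z) Z)"
  have fi: "?f m integrable_on Q" for m
    by (intro form_continuous integrable_continuous)
  have fe: "Re (z ^ m * form m Z Z) = integral Q (?f m)" for m
  proof -
    have "bounded_linear (\<lambda>x. Re (z ^ m * x))"
      by (intro bounded_linear_compose[OF bounded_linear_Re] bounded_linear_mult_right)
    from integral_linear[OF form_integrable this, of m Z Z] show ?thesis
      by (simp add: form_def o_def algebra_simps)
  qed
  have "real M * Re (form 0 Z Z) + 2 * (\<Sum>m\<in>{1..<M}. real (M - m) * Re (z ^ m * form m Z Z))
      = integral Q (\<lambda>p. real M * ?f 0 p + 2 * (\<Sum>m\<in>{1..<M}. real (M - m) * ?f m p))"
  proof (rule integral_unique[symmetric])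
    have h: "(?f m has_integral Re (z ^ m * form m Z Z)) Q" for m
      unfolding fe by (rule integrable_integral[OF fi])
    have "(?f 0 has_integral Re (form 0 Z Z)) Q" using h[of 0] by simp
    thus "((\<lambda>p. real M * ?f 0 p + 2 * (\<Sum>m\<in>{1..<M}. real (M - m) * ?f m p)) has_integral
      real M * Re (form 0 Z Z) + 2 * (\<Sum>m\<in>{1..<M}. real (M - m) * Re (z ^ m * form m Z Z))) Q"
      by (intro has_integral_add has_integral_mult_right has_integral_sum h) auto
  qed
  also have "\<dots> \<ge> 0"
  proof (rule integral_nonneg)
    show "(\<lambda>p. real M * ?f 0 p + 2 * (\<Sum>m\<in>{1..<M}. real (M - m) * ?f m p)) integrable_on Q"
      by (intro integrable_add integrable_on_mult_right integrable_sum fi) auto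
    fix p assume p: "p \<in> Q"
    define D where "D X = z *\<^sub>C cop p X" for X
    have Dm: "(D ^^ m) X = z ^ m *\<^sub>C (cop p ^^ m) X" for m X
      by (induction m) (simp_all add: scaleC_one D_def cop_scaleC scaleC_scaleC)
    have "0 \<le> real M * (norm Z)\<^sup>2 + 2 * (\<Sum>m\<in>{1..<M}. real (M - m) * inner ((D ^^ m) Z) Z)"
    proof (rule contraction_fejer_nonneg)
      show "linear D" unfolding D_def
        by (rule linear_compose[OF cop_linear bounded_linear.linear[OF bounded_linear_scaleC], unfolded o_def])
      show "norm (D y) \<le> norm y" for y using norm_cop[OF p, of y] z by (simp add: D_def norm_scaleC)
    qed
    hence "0 \<le> weight p * (real M * (norm Z)\<^sup>2 + 2 * (\<Sum>m\<in>{1..<M}. real (M - m) * Re (z ^ m * cinner ((cop p ^^ m) Z) Z)))"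
      unfolding inner_eq_Re_cinner Dm cinner_scaleC_left using QD(7)[OF p] by simp
    thus "0 \<le> real M * ?f 0 p + 2 * (\<Sum>m\<in>{1..<M}. real (M - m) * ?f m p)"
      by (simp add: cinner_self distrib_left sum_distrib_left mult_ac)
  qed
  finally show ?thesis .
qed

text \<open>Positivity at \<open>c X + Y\<close> for all unimodular \<open>c\<close> feeds
  \<open>fejer_bounded_positive\<close>. The diagonal values at index \<open>0\<close> are half the
  squared norms, which produces the divisor \<open>4\<close>.\<close>

lemma form_fejer_bounded: "fejer_bounded (\<lambda>m. form m X Y) (((norm X)\<^sup>2 + (norm Y)\<^sup>2) / 4)"
proof -
  have "fejer_bounded (\<lambda>m. form m X Y) (Re (form 0 X X + form 0 Y Y) / 2)"
  proof (rule fejer_bounded_positive[where g'="\<lambda>m. form m Y X"])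
    show "form 0 Y X = cnj (form 0 X Y)" by (simp add: form_0 cinner_commute')
    fix c z :: complex and M :: nat assume c: "cmod c = 1" and z: "cmod z = 1" and M: "M \<ge> 1"
    have "c * cnj c = 1" using c by (simp flip: complex_norm_square)
    hence cc: "cnj c * (c * x) = x" for x by (simp flip: mult.assoc add: mult.commute)
    have "form m (c *\<^sub>C X + Y) (c *\<^sub>C X + Y) = form m X X + form m Y Y + c * form m X Y + cnj c * form m Y X" for m
      by (simp add: form_add_left form_add_right form_scaleC_left form_scaleC_right distrib_left cc)
    from form_positive[OF z, of M "c *\<^sub>C X + Y", unfolded this]
    show "0 \<le> real M * Re (form 0 X X + form 0 Y Y + c * form 0 X Y + cnj c * form 0 Y X)
        + 2 * (\<Sum>m\<in>{1..<M}. real (M - m) * Re (z ^ m * (form m X X + form m Y Y + c * form m X Y + cnj c * form m Y X)))" .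
  qed
  moreover have "Re (form 0 X X + form 0 Y Y) / 2 = ((norm X)\<^sup>2 + (norm Y)\<^sup>2) / 4"
    by (simp add: form_0 cinner_self)
  ultimately show ?thesis by (simp only:)
qed

section \<open>Square summability of the moments of \<open>V P\<close>\<close>

definition cop_adj :: "real \<times> real \<Rightarrow> 'a hs \<Rightarrow> 'a hs" where
  "cop_adj p = blend (lmul (op_adjoint (path ((fst p)\<^sup>2)))) (\<lambda>X. rmul X (op_adjoint (path ((fst p)\<^sup>2)))) ((snd p)\<^sup>2)"

lemma cinner_cop: "cinner (cop p X) Y = cinner X (cop_adj p Y)"
  by (simp add: cop_def cop_adj_def blend_def cinner_add_left cinner_add_right cinner.scaleR_left
      cinner.scaleR_right cinner_lmul cinner_rmul path_linear)

lemma cinner_cop_power: "cinner ((cop p ^^ m) X) Y = cinner X ((cop_adj p ^^ m) Y)"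
  by (induction m arbitrary: Y) (simp_all add: cinner_cop funpow_swap1[of "cop_adj p"])

lemma adj_path: "op_adjoint (path s) = (1 - s) *\<^sub>R op_adjoint T0 + s *\<^sub>R op_adjoint T"
proof -
  have "path s = (1 - s) *\<^sub>R T0 + s *\<^sub>R T" by (simp add: path_def algebra_simps)
  thus ?thesis by (simp add: adjoint_add adjoint_scaleR complex_linear_scaleR linT linT0)
qed

lemma norm_adj_le_1: "complex_linear A \<Longrightarrow> norm A \<le> 1 \<Longrightarrow> norm (op_adjoint A) \<le> 1"
  using norm_adjoint_le[of A] by simp

text \<open>The adjoint of \<open>T_s\<close> is a convex combination of two contractions, so left
  multiplication loses \<open>s (1 - s)\<close> times the square of their difference. Right
  multiplication is merely a contraction, so the loss enters with weight \<open>u\<close>.\<close>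

lemma defect_bound:
  assumes p: "p \<in> Q"
  shows "(snd p)\<^sup>2 * ((fst p)\<^sup>2 * (1 - (fst p)\<^sup>2)) * (norm (lmul (op_adjoint (op_of_hs V)) Z))\<^sup>2
    \<le> (norm Z)\<^sup>2 - (norm (cop_adj p Z))\<^sup>2"
proof -
  let ?s = "(fst p)\<^sup>2" and ?u = "(snd p)\<^sup>2"
  note q = QD[OF p]
  let ?x = "lmul (op_adjoint T0) Z" and ?y = "lmul (op_adjoint T) Z"
  have lA: "complex_linear (op_adjoint T0)" "complex_linear (op_adjoint T)"
    by (simp_all add: complex_linear_adjoint linT linT0)
  have VA: "op_adjoint (op_of_hs V) = op_adjoint T - op_adjoint T0"
    unfolding op_V using adjoint_add[OF linT complex_linear_uminus[OF linT0]] adjoint_scaleR[OF linT0, of "-1"] by simp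
  have yx: "lmul (op_adjoint (op_of_hs V)) Z = ?y - ?x"
    by (rule hs_eqI) (simp add: VA op_of_lmul lA complex_linear_diff op_of_hs_simps blinfun.diff_left)
  have l: "lmul (op_adjoint (path ?s)) Z = (1 - ?s) *\<^sub>R ?x + ?s *\<^sub>R ?y"
    by (rule hs_eqI) (simp add: op_of_lmul complex_linear_adjoint path_linear lA op_of_hs_simps op_left, simp add: adj_path op_left)
  have nx: "(norm ?x)\<^sup>2 \<le> (norm Z)\<^sup>2" "(norm ?y)\<^sup>2 \<le> (norm Z)\<^sup>2"
    using contraction_T0 contraction_T
    by (auto intro!: power_mono norm_lmul_contraction norm_adj_le_1 simp: contraction_def)
  have "(norm (lmul (op_adjoint (path ?s)) Z))\<^sup>2 = (1 - ?s) * (norm ?x)\<^sup>2 + ?s * (norm ?y)\<^sup>2 - ?s * (1 - ?s) * (norm (?y - ?x))\<^sup>2"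
    unfolding l by (rule norm_convex_sq)
  also have "\<dots> \<le> (1 - ?s) * (norm Z)\<^sup>2 + ?s * (norm Z)\<^sup>2 - ?s * (1 - ?s) * (norm (?y - ?x))\<^sup>2"
    using q nx by (intro diff_right_mono add_mono mult_left_mono) auto
  also have "\<dots> = (norm Z)\<^sup>2 - ?s * (1 - ?s) * (norm (?y - ?x))\<^sup>2" by (simp add: algebra_simps)
  finally have 1: "(norm (lmul (op_adjoint (path ?s)) Z))\<^sup>2 \<le> (norm Z)\<^sup>2 - ?s * (1 - ?s) * (norm (?y - ?x))\<^sup>2" .
  have 2: "(norm (rmul Z (op_adjoint (path ?s))))\<^sup>2 \<le> (norm Z)\<^sup>2"
    using q by (intro power_mono norm_rmul_contraction norm_adj_le_1 path_linear norm_path_le) auto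
  have "(norm (cop_adj p Z))\<^sup>2 = (norm ((1 - ?u) *\<^sub>R rmul Z (op_adjoint (path ?s)) + ?u *\<^sub>R lmul (op_adjoint (path ?s)) Z))\<^sup>2"
    by (simp add: cop_adj_def blend_def add.commute)
  also have "\<dots> \<le> (1 - ?u) * (norm (rmul Z (op_adjoint (path ?s))))\<^sup>2 + ?u * (norm (lmul (op_adjoint (path ?s)) Z))\<^sup>2"
    unfolding norm_convex_sq using q by simp
  also have "\<dots> \<le> (1 - ?u) * (norm Z)\<^sup>2 + ?u * ((norm Z)\<^sup>2 - ?s * (1 - ?s) * (norm (?y - ?x))\<^sup>2)"
    using q 1 2 by (intro add_mono mult_left_mono) auto
  finally show ?thesis unfolding yx by (simp add: algebra_simps)
qed

text \<open>Moving \<open>V\<close> across the pairing leaves the adjoint of \<open>V\<close> acting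
  on the orbit of \<open>Y\<close>. By \<open>defect_bound\<close> its weighted squares telescope at
  each \<open>p\<close>, uniformly in \<open>p\<close>, and the bound survives integration.\<close>

lemma form_square_summable:
  assumes P: "X = lmul (op_of_hs V) P"
  shows "summable (\<lambda>m. (cmod (form m X Y))\<^sup>2)"
proof -
  let ?f = "\<lambda>m p. weight p *\<^sub>R cinner ((cop p ^^ m) X) Y"
  let ?K = "16 * (norm P)\<^sup>2 * (norm Y)\<^sup>2"
  have pt: "(\<Sum>m<N. (cmod (?f m p))\<^sup>2) \<le> ?K" if p: "p \<in> Q" for p N
  proof -
    note q = QD[OF p]
    let ?k = "(snd p)\<^sup>2 * ((fst p)\<^sup>2 * (1 - (fst p)\<^sup>2))"
    have k: "0 \<le> ?k" using q by simp
    have w: "(weight p)\<^sup>2 \<le> 16 * ?k"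
    proof -
      have "(weight p)\<^sup>2 = (16 * ?k) * (1 - (fst p)\<^sup>2)"
        by (simp add: weight_def power_mult_distrib) (simp add: power2_eq_square)
      also have "\<dots> \<le> (16 * ?k) * 1" using k by (intro mult_left_mono) auto
      finally show ?thesis by simp
    qed
    let ?Z = "\<lambda>m. (cop_adj p ^^ m) Y"
    let ?D = "\<lambda>m. norm (lmul (op_adjoint (op_of_hs V)) (?Z m))"
    have "(cmod (?f m p))\<^sup>2 \<le> 16 * (norm P)\<^sup>2 * ((norm (?Z m))\<^sup>2 - (norm (?Z (Suc m)))\<^sup>2)" for m
    proof -
      have "cmod (cinner ((cop p ^^ m) X) Y) = cmod (cinner P (lmul (op_adjoint (op_of_hs V)) (?Z m)))"
        unfolding cinner_cop_power P by (simp add: cinner_lmul op_of_hs_linear)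
      also have "\<dots> \<le> norm P * ?D m" by (rule cmod_cinner_le)
      finally have "(cmod (cinner ((cop p ^^ m) X) Y))\<^sup>2 \<le> (norm P * ?D m)\<^sup>2"
        by (intro power_mono) auto
      hence "(cmod (?f m p))\<^sup>2 \<le> (16 * ?k) * (norm P * ?D m)\<^sup>2"
        unfolding norm_scaleR power_mult_distrib power2_abs using k by (intro mult_mono w) auto
      also have "\<dots> = 16 * (norm P)\<^sup>2 * (?k * (?D m)\<^sup>2)"
        by (simp add: power_mult_distrib mult_ac)
      also have "\<dots> \<le> 16 * (norm P)\<^sup>2 * ((norm (?Z m))\<^sup>2 - (norm (?Z (Suc m)))\<^sup>2)"
        unfolding funpow.simps(2) o_apply by (intro mult_left_mono defect_bound[OF p]) auto
      finally show ?thesis .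
    qed
    hence "(\<Sum>m<N. (cmod (?f m p))\<^sup>2) \<le> (\<Sum>m<N. 16 * (norm P)\<^sup>2 * ((norm (?Z m))\<^sup>2 - (norm (?Z (Suc m)))\<^sup>2))"
      by (rule sum_mono)
    also have "\<dots> = 16 * (norm P)\<^sup>2 * ((norm (?Z 0))\<^sup>2 - (norm (?Z N))\<^sup>2)"
      using sum_lessThan_telescope'[of "\<lambda>m. (norm (?Z m))\<^sup>2" N] by (simp only: sum_distrib_left[symmetric])
    also have "\<dots> \<le> 16 * (norm P)\<^sup>2 * ((norm (?Z 0))\<^sup>2 - 0)"
      by (intro mult_left_mono diff_left_mono) auto
    finally show ?thesis by simp
  qed
  have "Henstock_Kurzweil_Integration.content Q = 1"
    unfolding content_Pair by simp
  hence area: "integral Q (\<lambda>_. c) = c" for c :: real by simp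
  have fi: "(\<lambda>p. (cmod (?f m p))\<^sup>2) integrable_on Q" for m
    by (intro form_continuous integrable_continuous)
  have cs: "(cmod (form m X Y))\<^sup>2 \<le> integral Q (\<lambda>p. (cmod (?f m p))\<^sup>2)" for m
  proof -
    define l where "l = integral Q (\<lambda>p. cmod (?f m p))"
    have ci: "(\<lambda>p. cmod (?f m p)) integrable_on Q"
      by (intro form_continuous integrable_continuous)
    have "cmod (form m X Y) \<le> l"
      unfolding form_def l_def by (rule integral_norm_bound_integral[OF form_integrable ci]) simp
    hence "(cmod (form m X Y))\<^sup>2 \<le> l\<^sup>2" by (intro power_mono) auto
    \<comment> \<open>Cauchy-Schwarz on a square of area one: integrate
      \<open>2 l f \<le> f^2 + l^2\<close> with \<open>l\<close> the mean of
      \<open>f\<close>.\<close>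
    moreover have "2 * l * l \<le> integral Q (\<lambda>p. (cmod (?f m p))\<^sup>2) + l\<^sup>2"
    proof -
      have "2 * l * l = integral Q (\<lambda>p. 2 * l * cmod (?f m p))"
        by (simp add: l_def)
      also have "\<dots> \<le> integral Q (\<lambda>p. (cmod (?f m p))\<^sup>2 + l\<^sup>2)"
      proof (rule integral_le)
        show "2 * l * cmod (?f m p) \<le> (cmod (?f m p))\<^sup>2 + l\<^sup>2" for p
          using sum_squares_bound[of "cmod (?f m p)" l] by (simp add: mult_ac)
      qed (intro integrable_on_mult_right ci integrable_add fi integrable_const)+
      also have "\<dots> = integral Q (\<lambda>p. (cmod (?f m p))\<^sup>2) + l\<^sup>2"
        by (subst integral_add[OF fi integrable_const]) (simp only: area)
      finally show ?thesis .
    qed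
    ultimately show ?thesis by (simp add: power2_eq_square)
  qed
  have bnd: "(\<Sum>m<N. (cmod (form m X Y))\<^sup>2) \<le> ?K" for N
  proof -
    have "(\<Sum>m<N. (cmod (form m X Y))\<^sup>2) \<le> (\<Sum>m<N. integral Q (\<lambda>p. (cmod (?f m p))\<^sup>2))"
      by (intro sum_mono cs)
    also have "\<dots> = integral Q (\<lambda>p. \<Sum>m<N. (cmod (?f m p))\<^sup>2)"
      by (rule integral_sum[OF _ fi, symmetric]) simp
    also have "\<dots> \<le> integral Q (\<lambda>_. ?K)"
      by (rule integral_le[OF integrable_sum[OF finite_lessThan fi] integrable_const pt])
    finally show ?thesis by (simp only: area)
  qed
  show ?thesis
  proof (rule bounded_imp_summable)
    show "(\<Sum>m\<le>n. (cmod (form m X Y))\<^sup>2) \<le> ?K" for n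
      using bnd[of "Suc n"] by (simp only: lessThan_Suc_atMost)
  qed simp
qed

end

section \<open>Traces of second order remainders\<close>

lemma op_power_0 [simp]: "op_power A 0 = id_blinfun"
  by (simp add: op_power_def)

lemma op_power_Suc: "op_power A (Suc n) = A o\<^sub>L op_power A n"
  by (simp add: op_power_def)

lemma op_power_Suc_apply [simp]: "op_power A (Suc n) x = A (op_power A n x)"
  by (simp add: op_power_Suc)

lemma op_power_commute: "op_power A n (A x) = A (op_power A n x)"
  by (induction n) simp_all

lemma op_power_add: "op_power A (m + n) x = op_power A m (op_power A n x)"
  by (induction m) simp_all

lemma complex_linear_op_power: "complex_linear A \<Longrightarrow> complex_linear (op_power A n)"
  by (induction n) (simp_all add: op_power_Suc complex_linear_compose)

lemma rmul_funpow: "complex_linear A \<Longrightarrow> ((\<lambda>X. rmul X A) ^^ n) X = rmul X (op_power A n)"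
  by (induction n) (auto intro!: hs_eqI simp: op_of_rmul complex_linear_op_power op_power_commute)

text \<open>Caratheodory's criterion: the algebra below provides exact difference identities with
  continuous quotients.\<close>

lemma vector_derivative_of_quotient:
  fixes f g :: "real \<Rightarrow> 'b::real_normed_vector"
  assumes q: "\<And>b. f b - f s = (b - s) *\<^sub>R g b" and g: "continuous (at s within S) g"
  shows "(f has_vector_derivative g s) (at s within S)"
  unfolding has_vector_derivative_def has_derivative_iff_norm
proof (intro conjI bounded_linear_scaleR_left)
  have "((\<lambda>b. norm (g b - g s)) \<longlongrightarrow> 0) (at s within S)"
    using g unfolding continuous_within by (intro tendsto_norm_zero LIM_zero)
  moreover have "\<forall>\<^sub>F b in at s within S. norm (g b - g s) = norm (f b - f s - (b - s) *\<^sub>R g s) / norm (b - s)"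
    unfolding eventually_at_filter
    by (intro always_eventually) (simp add: q flip: scaleR_diff_right)
  ultimately show "((\<lambda>b. norm (f b - f s - (b - s) *\<^sub>R g s) / norm (b - s)) \<longlongrightarrow> 0) (at s within S)"
    by (rule Lim_transform_eventually)
qed

lemma continuous_UNIV_within: "continuous_on UNIV g \<Longrightarrow> continuous (at s within S) g"
  using continuous_on_eq_continuous_within[of UNIV g] continuous_within_subset by blast

text \<open>Convergence is part of the relation, whereas \<open>op_trace\<close> takes the value
  \<open>0\<close> on a divergent sum.\<close>

definition has_trace :: "'a::chilbert_space \<Rightarrow>\<^sub>L 'a \<Rightarrow> complex \<Rightarrow> bool" where
  "has_trace A t \<longleftrightarrow> ((\<lambda>e. cinner (A e) e) has_sum t) some_onb"

lemma has_trace_op_trace: "has_trace A t \<Longrightarrow> op_trace A = t"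
  by (simp add: has_trace_def op_trace_def infsumI)

lemma has_trace_unique: "has_trace A t \<Longrightarrow> has_trace A t' \<Longrightarrow> t = t'"
  using has_trace_op_trace by blast

lemma has_trace_0 [simp]: "has_trace 0 0"
  by (simp add: has_trace_def cinner.zero_left)

lemma has_trace_add: "has_trace A s \<Longrightarrow> has_trace B t \<Longrightarrow> has_trace (A + B) (s + t)"
  unfolding has_trace_def blinfun.add_left cinner_add_left by (rule has_sum_add)

lemma has_trace_scaleC: "has_trace A t \<Longrightarrow> has_trace (op_scaleC c A) (c * t)"
  unfolding has_trace_def op_scaleC.rep_eq cinner_scaleC_left by (rule has_sum_cmult_right)

lemma has_trace_scaleR: "has_trace A t \<Longrightarrow> has_trace (r *\<^sub>R A) (of_real r * t)"
  using has_trace_scaleC[of A t "of_real r"] by (simp add: op_scaleC_of_real)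

lemma has_trace_sum: "(\<And>i. i \<in> I \<Longrightarrow> has_trace (A i) (t i)) \<Longrightarrow> has_trace (\<Sum>i\<in>I. A i) (\<Sum>i\<in>I. t i)"
  by (induction I rule: infinite_finite_induct) (auto intro: has_trace_add)

lemma has_trace_compose: "has_trace (op_of_hs X o\<^sub>L op_of_hs Y) (cinner Y (hs_adj X))"
  using has_sum_infsum[OF trace_summable[of X Y]] op_trace_compose[of X Y]
  by (simp add: has_trace_def op_trace_def)

lemma cinner_rmul_adj: "complex_linear A \<Longrightarrow> cinner (rmul V A) (hs_adj X) = cinner (lmul A X) (hs_adj V)"
  using cinner_hs_adj[of "hs_adj V" "lmul A X"]
  by (simp add: hs_adj_lmul cinner_rmul)

lemma cinner_adj_lmul: "complex_linear A \<Longrightarrow> cinner Y (hs_adj (lmul A V)) = cinner (rmul Y A) (hs_adj V)"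
  by (simp add: hs_adj_lmul cinner_rmul)

text \<open>\<open>P\<close> projects to the span of finitely many basis vectors, so the error is
  the tail of the series for the norm of \<open>X\<close>. Placing \<open>P\<close> on the right
  gives the shape wanted by \<open>form_square_summable\<close>.\<close>

lemma hs_finite_rank_approx:
  fixes X :: "'a::chilbert_space hs"
  assumes "\<epsilon> > 0"
  obtains P where "norm (X - lmul (op_of_hs X) P) < \<epsilon>"
proof -
  let ?B = "some_onb :: 'a set" and ?f = "\<lambda>e. (norm (op_of_hs X e))\<^sup>2"
  have B: "orthonormal ?B" by (rule is_onb_orthonormal[OF is_onb_some_onb])
  have "(sum ?f \<longlongrightarrow> (norm X)\<^sup>2) (finite_subsets_at_top ?B)"
    using norm_hs_has_sum[of X] by (simp add: has_sum_def)
  hence "\<forall>\<^sub>F F in finite_subsets_at_top ?B. dist (sum ?f F) ((norm X)\<^sup>2) < \<epsilon>\<^sup>2"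
    by (rule tendstoD) (use assms in simp)
  then obtain F where F: "finite F" "F \<subseteq> ?B" "dist (sum ?f F) ((norm X)\<^sup>2) < \<epsilon>\<^sup>2"
    by (auto simp: eventually_finite_subsets_at_top)
  define p where "p x = (\<Sum>e\<in>F. cinner x e *\<^sub>C e)" for x
  have "bounded_linear (\<lambda>x. cinner x e *\<^sub>C e)" for e :: 'a
  proof (rule bounded_linear_intro[where K="norm e * norm e"])
    show "norm (cinner x e *\<^sub>C e) \<le> norm x * (norm e * norm e)" for x
      using mult_right_mono[OF cmod_cinner_le[of x e], of "norm e"] by (simp add: norm_scaleC mult.assoc)
  qed (simp_all add: cinner_add_left scaleC_add_left scaleC_real cinner_scaleC_left scaleC_scaleC cinner.scaleR_left scaleR_conv_of_real)
  hence bl: "bounded_linear p" unfolding p_def by (rule bounded_linear_sum)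
  define Q where "Q = Blinfun p"
  have Q: "Q x = p x" for x unfolding Q_def by (simp add: bounded_linear_Blinfun_apply bl)
  have Qe: "Q e = (if e \<in> F then e else 0)" if "e \<in> ?B" for e
  proof -
    have "Q e = (\<Sum>f\<in>F. if e = f then e else 0)"
      unfolding Q p_def using B F that
      by (intro sum.cong refl) (auto simp: orthonormal_def subset_iff scaleC_one)
    thus ?thesis using F by (simp add: sum.delta')
  qed
  have "hilbert_schmidt Q"
    unfolding hilbert_schmidt_iff
  proof
    show "complex_linear Q"
      by (simp add: complex_linear_def Q p_def cinner_scaleC_left complex_vector.scale_sum_right scaleC_scaleC)
    have "(\<lambda>e. (norm (Q e))\<^sup>2) summable_on ?B \<longleftrightarrow> (\<lambda>e. (norm (Q e))\<^sup>2) summable_on F"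
      by (rule summable_on_cong_neutral) (use F Qe in auto)
    thus "(\<lambda>e. (norm (Q e))\<^sup>2) summable_on ?B" using F by simp
  qed
  then obtain P where P: "op_of_hs P = Q" by (metis Abs_hs_inverse mem_Collect_eq)
  have "(norm (X - lmul (op_of_hs X) P))\<^sup>2 = (\<Sum>\<^sub>\<infinity>e\<in>?B - F. ?f e)"
    unfolding norm_hs_sq
    by (rule infsum_cong_neutral)
      (use F Qe in \<open>auto simp: op_of_hs_simps op_of_lmul op_of_hs_linear blinfun.diff_left P\<close>)
  also have "\<dots> = (norm X)\<^sup>2 - sum ?f F"
    unfolding norm_hs_sq using F by (subst infsum_Diff) (auto simp: op_of_hs_summable)
  also have "\<dots> < \<epsilon>\<^sup>2" using F(3) by (simp add: dist_real_def)
  finally have "norm (X - lmul (op_of_hs X) P) < \<epsilon>" by (rule power2_less_imp_less) (use assms in simp)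
  thus thesis by (rule that)
qed

section \<open>Divided differences of powers along the segment\<close>

context contraction_pair
begin

abbreviation pw :: "real \<Rightarrow> nat \<Rightarrow> 'a \<Rightarrow>\<^sub>L 'a" where
  "pw s \<equiv> op_power (path s)"

text \<open>\<open>T\<^sub>b\<^sup>n - T\<^sub>a\<^sup>n = (b - a) dq a b n\<close>, and \<open>dq a a n\<close> is the derivative of \<open>T\<^sub>s\<^sup>n\<close> at \<open>s = a\<close>.\<close>

primrec dq :: "real \<Rightarrow> real \<Rightarrow> nat \<Rightarrow> 'a hs" where
  "dq a b 0 = 0"
| "dq a b (Suc n) = lmul (path b) (dq a b n) + rmul V (pw a n)"

lemma path_power_linear: "complex_linear (pw a n)"
  by (rule complex_linear_op_power[OF path_linear])

lemma op_dq_Suc: "op_of_hs (dq a b (Suc n)) x = path b (op_of_hs (dq a b n) x) + op_of_hs V (pw a n x)"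
  by (simp add: op_of_hs_simps op_of_lmul op_of_rmul path_linear path_power_linear blinfun.add_left)

lemma path_apply: "path b x = path a x + (b - a) *\<^sub>R op_of_hs V x"
  by (subst path_diff[of b a]) (simp add: op_left)

lemma power_path_dq: "pw b n x = pw a n x + (b - a) *\<^sub>R op_of_hs (dq a b n) x"
proof (induction n)
  case (Suc n)
  have "pw b (Suc n) x = path b (pw a n x) + (b - a) *\<^sub>R path b (op_of_hs (dq a b n) x)"
    by (simp add: Suc op_right)
  also have "path b (pw a n x) = path a (pw a n x) + (b - a) *\<^sub>R op_of_hs V (pw a n x)"
    by (rule path_apply)
  finally show ?case by (simp add: op_dq_Suc scaleR_add_right del: dq.simps)
qed (simp add: op_of_hs_simps)

lemma dq_chain: "(b - a) *\<^sub>R dq a b n = (s - a) *\<^sub>R dq a s n + (b - s) *\<^sub>R dq s b n"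
proof (rule hs_eqI)
  fix x
  have "(b - a) *\<^sub>R op_of_hs (dq a b n) x = (s - a) *\<^sub>R op_of_hs (dq a s n) x + (b - s) *\<^sub>R op_of_hs (dq s b n) x"
    using power_path_dq[of b n x a] power_path_dq[of s n x a] power_path_dq[of b n x s] by simp
  thus "op_of_hs ((b - a) *\<^sub>R dq a b n) x = op_of_hs ((s - a) *\<^sub>R dq a s n + (b - s) *\<^sub>R dq s b n) x"
    by (simp add: op_of_hs_simps op_left)
qed

text \<open>The Leibniz rule for divided differences. The factor \<open>b - a\<close> is kept
  because the identity is read off from differences of powers.\<close>

lemma dq_product: "(b - a) *\<^sub>R dq a b (k + j)
  = (b - a) *\<^sub>R (lmul (pw b k) (dq a b j) + rmul (dq a b k) (pw a j))"
proof (rule hs_eqI)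
  fix x
  have "pw b (k + j) x = pw b k (pw a j x + (b - a) *\<^sub>R op_of_hs (dq a b j) x)"
    unfolding op_power_add using power_path_dq[of b j x a] by simp
  also have "\<dots> = pw a (k + j) x + (b - a) *\<^sub>R op_of_hs (dq a b k) (pw a j x)
      + (b - a) *\<^sub>R pw b k (op_of_hs (dq a b j) x)"
    unfolding op_power_add[of "path a"] using power_path_dq[of b k "pw a j x" a]
    by (simp add: op_right)
  finally show "op_of_hs ((b - a) *\<^sub>R dq a b (k + j)) x = op_of_hs ((b - a) *\<^sub>R (lmul (pw b k) (dq a b j)
      + rmul (dq a b k) (pw a j))) x"
    using power_path_dq[of b "k + j" x a]
    by (simp add: op_of_hs_simps op_left op_of_lmul op_of_rmul path_power_linear
        scaleR_add_right)
qed

lemma continuous_dq: "continuous_on S (\<lambda>b. dq a b n)"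
proof (induction n)
  case (Suc n)
  have "continuous_on S (\<lambda>b. lmul (path 0) (dq a b n) + (b - 0) *\<^sub>R lmul (op_of_hs V) (dq a b n) + rmul V (pw a n))"
    by (intro continuous_intros bounded_linear.continuous_on[OF bounded_linear_lmul] Suc)
  thus ?case unfolding lmul_path[symmetric] by simp
qed simp

lemma dq_diag: "dq a a (Suc n) = power_sum (lmul (path a)) (\<lambda>X. rmul X (path a)) n V"
proof (induction n)
  case 0
  show ?case by (intro hs_eqI) (simp add: power_sum_def op_of_hs_simps op_of_rmul)
next
  case (Suc n)
  show ?case
    unfolding power_sum_Suc'[OF bounded_linear.linear[OF bounded_linear_lmul]] Suc[symmetric]
      rmul_funpow[OF path_linear] dq.simps(2)[of a a "Suc n"] by (simp add: add.commute)
qed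

lemma dq_diag_sum: "op_of_hs (dq a a n) = (\<Sum>j<n. pw a j o\<^sub>L op_of_hs V o\<^sub>L pw a (n - 1 - j))"
proof (induction n)
  case 0
  show ?case by (simp add: op_of_hs_simps)
next
  case (Suc n)
  show ?case
  proof (rule blinfun_eqI)
    fix x
    show "op_of_hs (dq a a (Suc n)) x = (\<Sum>j<Suc n. pw a j o\<^sub>L op_of_hs V o\<^sub>L pw a (Suc n - 1 - j)) x"
      unfolding op_dq_Suc Suc sum.lessThan_Suc_shift
      by (simp add: blinfun.sum_left blinfun.sum_right blinfun.add_left)
  qed
qed

text \<open>Changing the two powers around \<open>V\<close> one after the other turns each summand
  of \<open>dq_diag_sum\<close> into products of two Hilbert-Schmidt operators, to which cyclicity
  of the trace applies.\<close>

lemma trace_dq_diag: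
  "has_trace (op_of_hs (dq b b n) - op_of_hs (dq a a n)) (of_nat n * (of_real (b - a) * cinner (dq a b (n - 1)) (hs_adj V)))"
proof -
  let ?k = "\<lambda>j. n - 1 - j"
  let ?A = "\<lambda>j. pw a j" and ?B = "\<lambda>j. pw b j"
  let ?X = "\<lambda>j. (b - a) *\<^sub>R ((op_of_hs (dq a b j) o\<^sub>L op_of_hs (rmul V (?B (?k j))))
      + (op_of_hs (lmul (?A j) V) o\<^sub>L op_of_hs (dq a b (?k j))))"
  let ?t = "\<lambda>j. of_real (b - a) * (cinner (rmul V (?B (?k j))) (hs_adj (dq a b j))
      + cinner (dq a b (?k j)) (hs_adj (lmul (?A j) V)))"
  have "has_trace (\<Sum>j<n. ?X j) (\<Sum>j<n. ?t j)"
    by (intro has_trace_sum has_trace_scaleR has_trace_add has_trace_compose)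
  also have "(\<Sum>j<n. ?X j) = op_of_hs (dq b b n) - op_of_hs (dq a a n)"
    unfolding dq_diag_sum sum_subtractf[symmetric]
  proof (intro sum.cong refl blinfun_eqI)
    fix j x
    have "?B j (op_of_hs V (?B (?k j) x)) = ?A j (op_of_hs V (?B (?k j) x))
        + (b - a) *\<^sub>R op_of_hs (dq a b j) (op_of_hs V (?B (?k j) x))"
      by (rule power_path_dq)
    moreover have "?A j (op_of_hs V (?B (?k j) x)) = ?A j (op_of_hs V (?A (?k j) x))
        + (b - a) *\<^sub>R ?A j (op_of_hs V (op_of_hs (dq a b (?k j)) x))"
      using power_path_dq[of b "?k j" x a] by (simp add: op_right)
    ultimately show "?X j x = ((?B j o\<^sub>L op_of_hs V o\<^sub>L ?B (?k j)) - (?A j o\<^sub>L op_of_hs V o\<^sub>L ?A (?k j))) x"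
      by (simp add: op_left op_of_lmul op_of_rmul
          path_power_linear scaleR_add_right)
  qed
  \<comment> \<open>After the cyclic rearrangement the Leibniz rule reassembles
    \<open>dq a b (n - 1)\<close> in every summand, so all \<open>n\<close> traces agree.\<close>
  also have "(\<Sum>j<n. ?t j) = (\<Sum>j<n. of_real (b - a) * cinner (dq a b (n - 1)) (hs_adj V))"
  proof (intro sum.cong refl)
    fix j assume "j \<in> {..<n}"
    hence j: "?k j + j = n - 1" by simp
    have "?t j = cinner ((b - a) *\<^sub>R (lmul (?B (?k j)) (dq a b j) + rmul (dq a b (?k j)) (?A j))) (hs_adj V)"
      by (simp only: cinner_rmul_adj[OF path_power_linear] cinner_adj_lmul[OF path_power_linear]
          cinner.scaleR_left cinner_add_left scaleR_conv_of_real)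
    also have "\<dots> = cinner ((b - a) *\<^sub>R dq a b (n - 1)) (hs_adj V)"
      unfolding dq_product[symmetric] j ..
    finally show "?t j = of_real (b - a) * cinner (dq a b (n - 1)) (hs_adj V)"
      by (simp only: cinner.scaleR_left scaleR_conv_of_real)
  qed
  finally show ?thesis by simp
qed

section \<open>Taylor remainders of powers and their traces\<close>

text \<open>The second order Taylor remainder of the power divided by \<open>(b - a)^2\<close>, see
  \<open>power_path_rem\<close>, displayed as a sum of products of two Hilbert-Schmidt
  operators.\<close>

definition rem :: "real \<Rightarrow> real \<Rightarrow> nat \<Rightarrow> 'a \<Rightarrow>\<^sub>L 'a" where
  "rem a b n = (\<Sum>j<n. op_of_hs (lmul (pw a (n - 1 - j)) V) o\<^sub>L op_of_hs (dq a b j))"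

definition trem :: "real \<Rightarrow> real \<Rightarrow> nat \<Rightarrow> complex" where
  "trem a b n = (\<Sum>j<n. cinner (dq a b j) (hs_adj (lmul (pw a (n - 1 - j)) V)))"

lemma has_trace_rem: "has_trace (rem a b n) (trem a b n)"
  unfolding rem_def trem_def by (intro has_trace_sum has_trace_compose)

lemma rem_Suc: "rem a b (Suc n) x = path a (rem a b n x) + op_of_hs V (op_of_hs (dq a b n) x)"
proof -
  have "(\<Sum>j<n. pw a (n - j) (op_of_hs V (op_of_hs (dq a b j) x)))
      = (\<Sum>j<n. path a (pw a (n - 1 - j) (op_of_hs V (op_of_hs (dq a b j) x))))"
    by (intro sum.cong refl) (metis Suc_diff_Suc diff_Suc_eq_diff_pred lessThan_iff op_power_Suc_apply)
  thus ?thesis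
    by (simp add: rem_def op_of_lmul path_power_linear blinfun.sum_left blinfun.sum_right blinfun.add_left)
qed

lemma dq_rem: "op_of_hs (dq a b n) x = op_of_hs (dq a a n) x + (b - a) *\<^sub>R rem a b n x"
proof (induction n)
  case 0
  show ?case by (simp add: rem_def)
next
  case (Suc n)
  have "path b (op_of_hs (dq a b n) x) = path a (op_of_hs (dq a b n) x) + (b - a) *\<^sub>R op_of_hs V (op_of_hs (dq a b n) x)"
    by (rule path_apply)
  also have "path a (op_of_hs (dq a b n) x) = path a (op_of_hs (dq a a n) x) + (b - a) *\<^sub>R path a (rem a b n x)"
    by (subst Suc) (simp add: op_right)
  finally show ?case unfolding op_dq_Suc rem_Suc by (simp add: scaleR_add_right)
qed

lemma power_path_rem: "pw b n x = pw a n x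
    + (b - a) *\<^sub>R op_of_hs (dq a a n) x + ((b - a)\<^sup>2) *\<^sub>R rem a b n x"
  by (subst power_path_dq[of b n x a], subst dq_rem) (simp add: scaleR_add_right power2_eq_square)

text \<open>Expanding \<open>T_b^n\<close> at \<open>0\<close> directly and by way of
  \<open>s\<close> gives remainders that differ by \<open>b - s\<close> times a difference of first
  derivatives, whose trace is \<open>trace_dq_diag\<close>.\<close>

lemma trem_chain: "of_real (b\<^sup>2) * trem 0 b n = of_real (s\<^sup>2) * trem 0 s n + of_real ((b - s)\<^sup>2) * trem s b n
    + of_real (b - s) * (of_nat n * (of_real s * cinner (dq 0 s (n - 1)) (hs_adj V)))"
proof -
  let ?r = "(s\<^sup>2) *\<^sub>R rem 0 s n + ((b - s)\<^sup>2) *\<^sub>R rem s b n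
      + (b - s) *\<^sub>R (op_of_hs (dq s s n) - op_of_hs (dq 0 0 n))"
  have "((b\<^sup>2) *\<^sub>R rem 0 b n) x = ?r x" for x
    using power_path_rem[of b n x 0] power_path_rem[of s n x 0] power_path_rem[of b n x s]
    by (simp add: op_left algebra_simps)
  hence "(b\<^sup>2) *\<^sub>R rem 0 b n = ?r" by (rule blinfun_eqI)
  moreover have "has_trace ?r (of_real (s\<^sup>2) * trem 0 s n + of_real ((b - s)\<^sup>2) * trem s b n
    + of_real (b - s) * (of_nat n * (of_real (s - 0) * cinner (dq 0 s (n - 1)) (hs_adj V))))"
    by (intro has_trace_add has_trace_scaleR has_trace_rem trace_dq_diag)
  moreover have "has_trace ((b\<^sup>2) *\<^sub>R rem 0 b n) (of_real (b\<^sup>2) * trem 0 b n)"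
    by (intro has_trace_scaleR has_trace_rem)
  ultimately show ?thesis using has_trace_unique by simp
qed

lemma trem_derivative:
  "((\<lambda>s. of_real (s\<^sup>2) * trem 0 s n) has_vector_derivative
    of_nat n * (of_real s * cinner (dq 0 s (n - 1)) (hs_adj V))) (at s within S)"
proof -
  let ?g = "\<lambda>b. of_real (b - s) * trem s b n + of_nat n * (of_real s * cinner (dq 0 s (n - 1)) (hs_adj V))"
  have "((\<lambda>s. of_real (s\<^sup>2) * trem 0 s n) has_vector_derivative ?g s) (at s within S)"
  proof (rule vector_derivative_of_quotient[where g="?g"])
    fix b
    show "of_real (b\<^sup>2) * trem 0 b n - of_real (s\<^sup>2) * trem 0 s n = (b - s) *\<^sub>R ?g b"
      unfolding trem_chain[of b n s] by (simp add: scaleR_conv_of_real power2_eq_square algebra_simps)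
    have "continuous_on UNIV ?g"
      unfolding trem_def by (intro continuous_intros cinner.continuous_on continuous_dq)
    thus "continuous (at s within S) ?g" by (rule continuous_UNIV_within)
  qed
  thus ?thesis by simp
qed

lemma first_order_derivative:
  "((\<lambda>s. of_real s * cinner (dq 0 s n) Y) has_vector_derivative cinner (dq s s n) Y) (at s within S)"
proof (rule vector_derivative_of_quotient[where g="\<lambda>b. cinner (dq s b n) Y"])
  fix b
  have "cinner ((b - 0) *\<^sub>R dq 0 b n) Y = cinner ((s - 0) *\<^sub>R dq 0 s n + (b - s) *\<^sub>R dq s b n) Y"
    by (rule arg_cong[OF dq_chain])
  thus "of_real b * cinner (dq 0 b n) Y - of_real s * cinner (dq 0 s n) Y = (b - s) *\<^sub>R cinner (dq s b n) Y"
    by (simp add: cinner_add_left cinner.scaleR_left scaleR_conv_of_real)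
  have "continuous_on UNIV (\<lambda>b. cinner (dq s b n) Y)"
    by (intro continuous_intros cinner.continuous_on continuous_dq)
  thus "continuous (at s within S) (\<lambda>b. cinner (dq s b n) Y)"
    using continuous_UNIV_within by blast
qed

abbreviation coef :: "nat \<Rightarrow> complex" where
  "coef m \<equiv> form m V (hs_adj V)"

text \<open>Taylor's formula with integral remainder for \<open>\<rho>(s) = s^2 trem 0 s n\<close>,
  \<open>n = m + 2\<close>: the second derivative is \<open>n\<close> times the pairing of
  \<open>dq s s (n - 1)\<close> with \<open>hs_adj V\<close>, and \<open>blend_integral\<close>
  makes it \<open>n (n - 1)\<close> times the average over \<open>u\<close>.\<close>

lemma form_trem: "of_nat (m + 2) * (of_nat (m + 1) * coef m) = trem 0 1 (m + 2)"
proof -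
  let ?\<theta> = "\<lambda>s. cinner (dq s s (Suc m)) (hs_adj V)"
  let ?n = "m + 2"
  \<comment> \<open>The density \<open>(1 - s) ds\<close> in the variable \<open>w\<close>, divided
    by the factor \<open>m + 1\<close> that accompanies the power sum.\<close>
  let ?c = "\<lambda>w. 2 * w * (1 - w\<^sup>2) / real (Suc m)"
  have inner: "integral (cbox 0 1) (\<lambda>v. weight (w, v) *\<^sub>R cinner ((cop (w, v) ^^ m) V) (hs_adj V))
      = ?c w *\<^sub>R ?\<theta> (w\<^sup>2)" for w
  proof -
    let ?L = "lmul (path (w\<^sup>2))" and ?R = "\<lambda>X. rmul X (path (w\<^sup>2))"
    have "((\<lambda>v. (real (Suc m) * 2 * v) *\<^sub>R cinner ((blend ?L ?R (v\<^sup>2) ^^ m) V) (hs_adj V))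
        has_integral cinner (power_sum ?L ?R m V) (hs_adj V)) {0..1}"
      by (rule blend_integral[OF bounded_linear_lmul bounded_linear_rmul])
        (auto intro!: hs_eqI simp: op_of_lmul op_of_rmul path_linear)
    hence "((\<lambda>v. ?c w *\<^sub>R ((real (Suc m) * 2 * v) *\<^sub>R cinner ((blend ?L ?R (v\<^sup>2) ^^ m) V) (hs_adj V)))
        has_integral ?c w *\<^sub>R ?\<theta> (w\<^sup>2)) {0..1}"
      unfolding dq_diag by (rule has_integral_cmul)
    moreover have "?c w *\<^sub>R ((real (Suc m) * 2 * v) *\<^sub>R cinner ((blend ?L ?R (v\<^sup>2) ^^ m) V) (hs_adj V))
        = weight (w, v) *\<^sub>R cinner ((cop (w, v) ^^ m) V) (hs_adj V)" for v
    proof -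
      have "?c w * (real (Suc m) * 2 * v) = weight (w, v)"
        by (simp add: weight_def del: of_nat_Suc)
      thus ?thesis unfolding scaleR_scaleR cop_def by simp
    qed
    ultimately show ?thesis by (simp add: integral_unique)
  qed
  have "coef m = integral (cbox 0 1) (\<lambda>w. integral (cbox 0 1) (\<lambda>v. weight (w, v) *\<^sub>R cinner ((cop (w, v) ^^ m) V) (hs_adj V)))"
    unfolding form_def by (rule integral_prod_continuous[OF continuous_form_integrand])
  also have "\<dots> = integral {0..1} (\<lambda>w. ?c w *\<^sub>R ?\<theta> (w\<^sup>2))"
    unfolding inner by simp
  finally have 1: "coef m = integral {0..1} (\<lambda>w. ?c w *\<^sub>R ?\<theta> (w\<^sup>2))" .
  let ?e = "\<lambda>s. of_real s * cinner (dq 0 s (Suc m)) (hs_adj V)" and ?\<rho> = "\<lambda>s. of_real (s\<^sup>2) * trem 0 s ?n"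
  \<comment> \<open>Integration by parts: \<open>(1 - s) \<rho>' + \<rho>\<close> has
    \<open>s\<close>-derivative \<open>(1 - s) \<rho>''\<close>; here \<open>s = w^2\<close>. It
    vanishes at \<open>0\<close> and equals the wanted trace at \<open>1\<close>.\<close>
  let ?K = "\<lambda>w. (1 - w\<^sup>2) *\<^sub>R (of_nat ?n * ?e (w\<^sup>2)) + ?\<rho> (w\<^sup>2)"
  have sq: "((\<lambda>w. w\<^sup>2) has_vector_derivative 2 * w) (at w within {0..1})" for w :: real
    by (auto intro!: derivative_eq_intros simp flip: has_real_derivative_iff_has_vector_derivative)
  have e': "((\<lambda>w. ?e (w\<^sup>2)) has_vector_derivative (2 * w) *\<^sub>R ?\<theta> (w\<^sup>2)) (at w within {0..1})" for w
    using vector_diff_chain_within[OF sq first_order_derivative] by (simp add: o_def del: dq.simps)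
  have r': "((\<lambda>w. ?\<rho> (w\<^sup>2)) has_vector_derivative (2 * w) *\<^sub>R (of_nat ?n * ?e (w\<^sup>2))) (at w within {0..1})" for w
    using vector_diff_chain_within[OF sq trem_derivative[of ?n]] by (simp add: o_def del: dq.simps)
  have "(?K has_vector_derivative ((1 - w\<^sup>2) *\<^sub>R (of_nat ?n * ((2 * w) *\<^sub>R ?\<theta> (w\<^sup>2))) + (- (2 * w)) *\<^sub>R (of_nat ?n * ?e (w\<^sup>2)))
      + (2 * w) *\<^sub>R (of_nat ?n * ?e (w\<^sup>2))) (at w within {0..1})" for w
    by (intro has_vector_derivative_add has_vector_derivative_scaleR r' has_vector_derivative_mult_right e')
      (auto intro!: derivative_eq_intros)
  moreover have "((1 - w\<^sup>2) *\<^sub>R (of_nat ?n * ((2 * w) *\<^sub>R ?\<theta> (w\<^sup>2))) + (- (2 * w)) *\<^sub>R (of_nat ?n * ?e (w\<^sup>2)))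
      + (2 * w) *\<^sub>R (of_nat ?n * ?e (w\<^sup>2)) = (of_nat ?n * of_nat (Suc m)) * (?c w *\<^sub>R ?\<theta> (w\<^sup>2))" for w
  proof -
    have "((1 - w\<^sup>2) *\<^sub>R (N * ((2 * w) *\<^sub>R X)) + (- (2 * w)) *\<^sub>R (N * E)) + (2 * w) *\<^sub>R (N * E)
        = (N * of_nat (Suc m)) * (?c w *\<^sub>R X)" for N X E :: complex
      by (simp add: scaleR_conv_of_real field_simps del: of_nat_Suc)
    thus ?thesis .
  qed
  ultimately have K: "(?K has_vector_derivative (of_nat ?n * of_nat (Suc m)) * (?c w *\<^sub>R ?\<theta> (w\<^sup>2))) (at w within {0..1})" for w
    by (simp only:)
  have "((\<lambda>w. (of_nat ?n * of_nat (Suc m)) * (?c w *\<^sub>R ?\<theta> (w\<^sup>2))) has_integral ?K 1 - ?K 0) {0..1}"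
    by (rule fundamental_theorem_of_calculus[OF _ K]) simp
  hence "(of_nat ?n * of_nat (Suc m)) * coef m = ?K 1 - ?K 0"
    unfolding 1 by (subst integral_mult_right[symmetric]) (rule integral_unique)
  also have "?K 1 - ?K 0 = trem 0 1 ?n" by simp
  finally show ?thesis by (simp add: mult.assoc)
qed

section \<open>From powers to polynomials\<close>

lemma op_poly_derivative:
  "((\<lambda>s. op_poly p (T0 + s *\<^sub>R (T - T0))) has_vector_derivative
    (\<Sum>i\<le>degree p. op_scaleC (coeff p i) (op_of_hs (dq 0 0 i)))) (at 0 within {0..1})"
  unfolding op_poly_def path_def[symmetric]
proof (intro has_vector_derivative_sum bounded_linear.has_vector_derivative[OF bounded_linear_op_scaleC])
  fix i
  show "((\<lambda>s. pw s i) has_vector_derivative op_of_hs (dq 0 0 i)) (at 0 within {0..1})"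
  proof (rule vector_derivative_of_quotient[where g="\<lambda>b. op_of_hs (dq 0 b i)"])
    show "pw b i - pw 0 i = (b - 0) *\<^sub>R op_of_hs (dq 0 b i)" for b
      by (rule blinfun_eqI, simp only: op_left, subst power_path_dq[of b i _ 0], simp)
    have "bounded_linear (op_of_hs :: 'a hs \<Rightarrow> _)"
      by (rule bounded_linear_intro[where K=1]) (simp_all add: op_of_hs_simps norm_op_of_hs_le)
    hence "continuous_on UNIV (\<lambda>b. op_of_hs (dq 0 b i))"
      by (rule bounded_linear.continuous_on) (rule continuous_dq)
    thus "continuous (at 0 within {0..1}) (\<lambda>b. op_of_hs (dq 0 b i))" by (rule continuous_UNIV_within)
  qed
qed

lemma remainder2_eq: "remainder2 p T0 T = (\<Sum>i\<le>degree p. op_scaleC (coeff p i) (rem 0 1 i))"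
proof -
  have "op_poly p T - op_poly p T0 - remainder2 p T0 T = (\<Sum>i\<le>degree p. op_scaleC (coeff p i) (op_of_hs (dq 0 0 i)))"
    by (rule vector_derivative_unique_within_closed_interval[where a=0 and b=1 and x="0::real",
          unfolded cbox_interval, OF _ _ remainder2_derivative op_poly_derivative]) auto
  hence "remainder2 p T0 T = op_poly p T - op_poly p T0 - (\<Sum>i\<le>degree p. op_scaleC (coeff p i) (op_of_hs (dq 0 0 i)))"
    by (simp add: algebra_simps)
  also have "\<dots> = (\<Sum>i\<le>degree p. op_scaleC (coeff p i) (rem 0 1 i))"
    unfolding op_poly_def sum_subtractf[symmetric]
  proof (intro sum.cong refl blinfun_eqI)
    fix i x
    have "op_power T i x = op_power T0 i x + op_of_hs (dq 0 0 i) x + rem 0 1 i x"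
      using power_path_rem[of 1 i x 0] by simp
    thus "(op_scaleC (coeff p i) (op_power T i) - op_scaleC (coeff p i) (op_power T0 i) - op_scaleC (coeff p i) (op_of_hs (dq 0 0 i))) x
        = op_scaleC (coeff p i) (rem 0 1 i) x"
      by (simp add: blinfun.diff_left op_scaleC.rep_eq scaleC_add_right)
  qed
  finally show ?thesis .
qed

lemma trace_class_remainder2: "trace_class (remainder2 p T0 T)"
proof -
  \<comment> \<open>The polynomial coefficient is absorbed into the left factor, so that one finite
    sum of products remains.\<close>
  let ?X = "\<lambda>(i, j). coeff p i *\<^sub>C lmul (pw 0 (i - 1 - j)) V"
  have "remainder2 p T0 T = (\<Sum>i\<le>degree p. \<Sum>j<i. op_of_hs (?X (i, j)) o\<^sub>L op_of_hs (dq 0 1 j))"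
    unfolding remainder2_eq rem_def
    by (intro sum.cong refl blinfun_eqI)
      (simp add: blinfun.sum_left op_scaleC.rep_eq complex_vector.scale_sum_right scaleC_hs.rep_eq)
  also have "\<dots> = (\<Sum>q\<in>Sigma {..degree p} lessThan. op_of_hs (?X q) o\<^sub>L op_of_hs (dq 0 1 (snd q)))"
    by (subst sum.Sigma) (auto intro!: sum.cong)
  finally show ?thesis
    by (simp only:) (rule trace_class_sum_products, simp)
qed

lemma op_trace_remainder2: "op_trace (remainder2 p T0 T) = (\<Sum>i\<le>degree p. coeff p i * trem 0 1 i)"
  unfolding remainder2_eq
  by (intro has_trace_op_trace has_trace_sum has_trace_scaleC has_trace_rem)

lemma form_analytic_part:
  assumes "\<epsilon> > 0"
  shows "analytic_part coef ((norm V)\<^sup>2 / 2 + \<epsilon>)"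
proof -
  let ?Y = "hs_adj V"
  have "\<exists>P. norm (V - lmul (op_of_hs V) P) < (1 / real (Suc k))\<^sup>2" for k
    by (rule hs_finite_rank_approx[of "(1 / real (Suc k))\<^sup>2" V]) auto
  \<comment> \<open>The quadratic rate leaves room for the scaling by \<open>c = Suc k\<close>
    below.\<close>
  then obtain P where P: "\<And>k. norm (V - lmul (op_of_hs V) (P k)) < (1 / real (Suc k))\<^sup>2" by metis
  define W where "W k = lmul (op_of_hs V) (P k)" for k
  define d where "d k = (1 + (norm V)\<^sup>2) / 4 * (1 / real (Suc k))\<^sup>2" for k
  have "fejer_bounded (\<lambda>m. form m V ?Y) (((norm V)\<^sup>2 + (norm ?Y)\<^sup>2) / 4)"
    by (rule form_fejer_bounded)
  hence F: "fejer_bounded (\<lambda>m. form m V ?Y) ((norm V)\<^sup>2 / 2)" by (simp add: norm_hs_adj)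
  have D: "fejer_bounded (\<lambda>m. form m V ?Y - form m (W k) ?Y) (d k)" for k
  proof -
    \<comment> \<open>Scaling the arguments by \<open>c\<close> and \<open>1 / c\<close> leaves the
      form unchanged, while the bound by a sum of squares becomes small in both of its
      terms.\<close>
    define c where "c = real (Suc k)"
    have c: "c > 0" by (simp add: c_def)
    have eq: "form m V ?Y - form m (W k) ?Y = form m (of_real c *\<^sub>C (V - W k)) (of_real (1 / c) *\<^sub>C ?Y)" for m
      using form_add_left[of m "V - W k" "W k" ?Y] c by (simp add: form_scaleC_left form_scaleC_right)
    have "fejer_bounded (\<lambda>m. form m (of_real c *\<^sub>C (V - W k)) (of_real (1 / c) *\<^sub>C ?Y))
        (((norm (of_real c *\<^sub>C (V - W k)))\<^sup>2 + (norm (of_real (1 / c) *\<^sub>C ?Y))\<^sup>2) / 4)"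
      by (rule form_fejer_bounded)
    hence "fejer_bounded (\<lambda>m. form m V ?Y - form m (W k) ?Y)
        (((norm (of_real c *\<^sub>C (V - W k)))\<^sup>2 + (norm (of_real (1 / c) *\<^sub>C ?Y))\<^sup>2) / 4)"
      by (simp only: eq)
    moreover have "((norm (of_real c *\<^sub>C (V - W k)))\<^sup>2 + (norm (of_real (1 / c) *\<^sub>C ?Y))\<^sup>2) / 4 \<le> d k"
    proof -
      have "norm (of_real c *\<^sub>C (V - W k)) = c * norm (V - W k)" using c by (simp add: norm_scaleC)
      also have "\<dots> \<le> c * (1 / c)\<^sup>2" using P[of k] c unfolding c_def W_def by (intro mult_left_mono less_imp_le) auto
      also have "\<dots> = 1 / c" using c by (simp add: power2_eq_square)
      finally have "(norm (of_real c *\<^sub>C (V - W k)))\<^sup>2 \<le> (1 / c)\<^sup>2" by (intro power_mono) auto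
      moreover have "(norm (of_real (1 / c) *\<^sub>C ?Y))\<^sup>2 = (1 / c)\<^sup>2 * (norm V)\<^sup>2"
        using c by (simp add: norm_scaleC norm_hs_adj power_mult_distrib power_divide norm_divide)
      ultimately show ?thesis by (simp add: d_def c_def distrib_right algebra_simps)
    qed
    ultimately show ?thesis
      unfolding fejer_bounded_def by (blast intro: analytic_part_mono)
  qed
  have "(\<lambda>k. (1 + (norm V)\<^sup>2) / 4 * (1 / real (Suc k))\<^sup>2) \<longlonglongrightarrow> (1 + (norm V)\<^sup>2) / 4 * 0\<^sup>2"
    by (intro tendsto_intros LIMSEQ_Suc[OF lim_1_over_n])
  hence d0: "d \<longlonglongrightarrow> 0" by (simp add: d_def[abs_def])
  show ?thesis
    by (rule fejer_bounded_limit[OF F D d0 form_square_summable assms]) (simp add: W_def)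
qed

end

section \<open>Functions on the circle\<close>

lemma set_integrable_circ: "set_integrable lebesgue {0..2*pi} f \<longleftrightarrow> integrable circ f"
  for f :: "real \<Rightarrow> complex"
  by (simp add: set_integrable_def integrable_restrict_space)

lemma set_lebesgue_integral_circ: "(LINT t:{0..2*pi}|lebesgue. f t) = cint f"
  for f :: "real \<Rightarrow> 'b::{banach, second_countable_topology}"
  by (simp add: set_lebesgue_integral_def integral_restrict_space)

lemma circle_integral_eq: "circle_integral f = cint (\<lambda>t. f (cis t) * (\<i> * cis t))"
  unfolding circle_integral_def by (rule set_lebesgue_integral_circ)

lemma L1_circle_iff: "L1_circle f \<longleftrightarrow> integrable circ (\<lambda>t. f (cis t))"
  unfolding L1_circle_def by (rule set_integrable_circ)

lemma L1_circle_norm_eq: "L1_circle_norm f = cint (\<lambda>t. cmod (f (cis t)))"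
  unfolding L1_circle_norm_def by (rule set_lebesgue_integral_circ)

lemma fourier_coeff_eq:
  "fourier_coeff f n = cint (\<lambda>t. f (cis t) * cis (- (of_int n * t))) / of_real (2 * pi)"
  unfolding fourier_coeff_def set_lebesgue_integral_circ ..

lemma circle_integral_power:
  assumes "L1_circle \<eta>"
  shows "circle_integral (\<lambda>z. c * z ^ m * \<eta> z) = c * circle_integral (\<lambda>z. z ^ m * \<eta> z)"
    "circle_integral (\<lambda>z. z ^ m * \<eta> z) = \<i> * cint (\<lambda>t. \<eta> (cis t) * cis (real (Suc m) * t))"
    "integrable circ (\<lambda>t. c * cis t ^ m * \<eta> (cis t) * (\<i> * cis t))"
proof -
  have p: "cis t ^ m * \<eta> (cis t) * (\<i> * cis t) = \<i> * (\<eta> (cis t) * cis (real (Suc m) * t))" for t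
  proof -
    have "cis t ^ m * cis t = cis (real (Suc m) * t)"
      unfolding Complex.DeMoivre cis_mult by (simp add: distrib_right add.commute)
    thus ?thesis by (simp add: mult_ac)
  qed
  show "circle_integral (\<lambda>z. z ^ m * \<eta> z) = \<i> * cint (\<lambda>t. \<eta> (cis t) * cis (real (Suc m) * t))"
    unfolding circle_integral_eq p by (rule integral_mult_right_zero)
  show "circle_integral (\<lambda>z. c * z ^ m * \<eta> z) = c * circle_integral (\<lambda>z. z ^ m * \<eta> z)"
    unfolding circle_integral_eq mult.assoc[of c] by (rule integral_mult_right_zero)
  show "integrable circ (\<lambda>t. c * cis t ^ m * \<eta> (cis t) * (\<i> * cis t))"
    unfolding mult.assoc[of c] p using assms unfolding L1_circle_iff
    by (intro integrable_mult_right integrable_circ_times_cis)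
qed

lemma circle_integral_poly:
  assumes "L1_circle \<eta>"
  shows "circle_integral (\<lambda>z. poly q z * \<eta> z) = (\<Sum>m\<le>degree q. coeff q m * circle_integral (\<lambda>z. z ^ m * \<eta> z))"
proof -
  have "poly q z * \<eta> z * w = (\<Sum>m\<le>degree q. coeff q m * z ^ m * \<eta> z * w)" for z w
    by (simp add: poly_altdef sum_distrib_right)
  hence "circle_integral (\<lambda>z. poly q z * \<eta> z) = (\<Sum>m\<le>degree q. circle_integral (\<lambda>z. coeff q m * z ^ m * \<eta> z))"
    unfolding circle_integral_eq
    by (simp only: Bochner_Integration.integral_sum circle_integral_power(3)[OF assms])
  thus ?thesis by (simp only: circle_integral_power(1)[OF assms])
qed

text \<open>Padding with zero coefficients up to \<open>degree p\<close> gives the index range in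
  which the trace is expressed.\<close>

lemma sum_second_derivative:
  fixes p :: "complex poly"
  shows "(\<Sum>m\<le>degree (pderiv (pderiv p)). coeff (pderiv (pderiv p)) m * f m)
    = (\<Sum>m\<le>degree p. coeff p (m + 2) * (of_nat (m + 2) * (of_nat (m + 1) * f m)))"
proof -
  have c: "coeff (pderiv (pderiv p)) m = of_nat (m + 1) * (of_nat (m + 2) * coeff p (m + 2))" for m
    by (simp add: coeff_pderiv del: of_nat_Suc)
  have "(\<Sum>m\<le>degree (pderiv (pderiv p)). coeff (pderiv (pderiv p)) m * f m)
      = (\<Sum>m\<le>degree p. coeff (pderiv (pderiv p)) m * f m)"
    by (rule sum.mono_neutral_left) (auto simp: degree_pderiv coeff_eq_0)
  thus ?thesis unfolding c by (simp only: mult_ac)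
qed

section \<open>The trace formula as a moment problem, its solutions and their uniqueness\<close>

context contraction_pair
begin

lemma op_trace_remainder2_form: "op_trace (remainder2 p T0 T)
  = (\<Sum>m\<le>degree p. coeff p (m + 2) * (of_nat (m + 2) * (of_nat (m + 1) * coef m)))"
proof -
  \<comment> \<open>Remainders of constant and linear polynomials vanish, which permits the index
    shift by two.\<close>
  have z: "trem 0 1 0 = 0" "trem 0 1 (Suc 0) = 0"
    by (simp_all add: trem_def cinner.zero_left)
  have "op_trace (remainder2 p T0 T) = (\<Sum>i\<le>degree p + 2. coeff p i * trem 0 1 i)"
    unfolding op_trace_remainder2 by (rule sum.mono_neutral_left) (auto simp: coeff_eq_0)
  also have "\<dots> = (\<Sum>m\<le>degree p. coeff p (m + 2) * trem 0 1 (m + 2))"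
    by (simp add: numeral_2_eq_2 sum.atMost_Suc_shift z del: sum.atMost_Suc)
  finally show ?thesis unfolding form_trem .
qed

text \<open>Both sides of the formula are linear in the coefficients of \<open>p\<close>, and the
  monomial of degree \<open>m + 2\<close> isolates the moment \<open>m\<close>.\<close>

lemma trace_formula_iff:
  assumes \<eta>: "L1_circle \<eta>"
  shows "second_order_trace_formula T0 T \<eta> \<longleftrightarrow> (\<forall>m. circle_integral (\<lambda>z. z ^ m * \<eta> z) = coef m)"
proof
  assume "\<forall>m. circle_integral (\<lambda>z. z ^ m * \<eta> z) = coef m"
  thus "second_order_trace_formula T0 T \<eta>"
    unfolding second_order_trace_formula_def circle_integral_poly[OF \<eta>] sum_second_derivative op_trace_remainder2_form
    by simp
next
  assume s: "second_order_trace_formula T0 T \<eta>"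
  show "\<forall>m. circle_integral (\<lambda>z. z ^ m * \<eta> z) = coef m"
  proof
    fix m
    let ?p = "monom 1 (m + 2) :: complex poly"
    have single: "(\<Sum>j\<le>degree ?p. coeff ?p (j + 2) * f j) = f m" for f
    proof -
      have "(\<Sum>j\<le>degree ?p. coeff ?p (j + 2) * f j) = (\<Sum>j\<le>degree ?p. if j = m then f j else 0)"
        by (intro sum.cong) auto
      thus ?thesis by (simp add: degree_monom_eq)
    qed
    have "op_trace (remainder2 ?p T0 T) = circle_integral (\<lambda>z. poly (pderiv (pderiv ?p)) z * \<eta> z)"
      using s by (simp only: second_order_trace_formula_def)
    hence "of_nat (m + 2) * (of_nat (m + 1) * coef m)
        = of_nat (m + 2) * (of_nat (m + 1) * circle_integral (\<lambda>z. z ^ m * \<eta> z))"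
      unfolding circle_integral_poly[OF \<eta>] sum_second_derivative op_trace_remainder2_form single .
    thus "circle_integral (\<lambda>z. z ^ m * \<eta> z) = coef m"
      by (simp del: of_nat_Suc of_nat_add)
  qed
qed

lemma trace_formula_exists:
  assumes "analytic_part coef \<delta>"
  shows "\<exists>\<eta>. L1_circle \<eta> \<and> second_order_trace_formula T0 T \<eta> \<and> L1_circle_norm \<eta> \<le> \<delta>"
proof -
  obtain h where h: "integrable circ h"
    "\<And>m. cint (\<lambda>t. h t * cis (real m * t)) = of_real (2 * pi) * coef m"
    "cint (\<lambda>t. cmod (h t)) \<le> 2 * pi * \<delta>"
    using assms by (auto simp: analytic_part_def)
  \<comment> \<open>The factor \<open>cis (- t)\<close> offsets the \<open>cis t\<close> in
    \<open>dz\<close>, and \<open>1 / (2 pi i)\<close> removes the remaining constants; it also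
    cancels the \<open>2 pi\<close> in the norm bound.\<close>
  define k where "k t = h t * cis ((- 1) * t) * (1 / (of_real (2 * pi) * \<i>))" for t
  define \<eta> where "\<eta> z = k (Arg2pi z)" for z
  have ki: "integrable circ k"
    unfolding k_def by (intro integrable_mult_left integrable_circ_times_cis h)
  have \<eta>k: "\<eta> (cis t) = k t" if "0 \<le> t" "t < 2 * pi" for t
  proof -
    have "Arg2pi (cis t) = t"
      using Arg2pi_unique[of 1 t "cis t"] that by (simp add: cis_conv_exp)
    thus ?thesis by (simp add: \<eta>_def)
  qed
  have ae: "AE t in circ. \<eta> (cis t) = k t"
  proof -
    have "{2 * pi} \<in> null_sets lebesgue" by simp
    from AE_not_in[OF this] have "AE t in lebesgue. t \<noteq> 2 * pi" by simp
    hence "AE t in lebesgue. t \<in> {0..2*pi} \<longrightarrow> \<eta> (cis t) = k t"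
      by eventually_elim (use \<eta>k in force)
    thus ?thesis by (simp add: AE_restrict_space_iff)
  qed
  \<comment> \<open>\<open>Arg2pi\<close> never takes the value \<open>2 * pi\<close>, so at this
    endpoint \<eta> has the value belonging to \<open>t = 0\<close>; \<open>k\<close> is corrected
    at that point.\<close>
  have complete: "(\<lambda>t. \<eta> (cis t)) \<in> borel_measurable circ"
  proof -
    have 1: "(\<lambda>t. if t = 2 * pi then \<eta> 1 else k t) \<in> borel_measurable circ"
    proof (rule measurable_If[OF _ borel_measurable_integrable[OF ki]])
      have "{t \<in> space circ. t = 2 * pi} = {2 * pi}" by auto
      thus "{t \<in> space circ. t = 2 * pi} \<in> sets circ" by (simp add: sets_restrict_space_iff)
    qed simp
    show ?thesis
      by (rule measurable_cong[THEN iffD2, OF _ 1]) (use \<eta>k in auto)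
  qed
  have L: "L1_circle \<eta>"
    unfolding L1_circle_iff
    using ki complete ae by (subst integrable_cong_AE) (auto intro: borel_measurable_integrable)
  have "circle_integral (\<lambda>z. z ^ m * \<eta> z) = coef m" for m
  proof -
    have kh: "k t * cis (real (Suc m) * t) = (h t * cis (real m * t)) * (1 / (of_real (2 * pi) * \<i>))" for t
    proof -
      have "cis ((- 1) * t) * cis (real (Suc m) * t) = cis (real m * t)"
        unfolding cis_mult by (simp add: distrib_right)
      thus ?thesis by (simp add: k_def mult_ac)
    qed
    have "cint (\<lambda>t. \<eta> (cis t) * cis (real (Suc m) * t)) = cint (\<lambda>t. k t * cis (real (Suc m) * t))"
    proof (rule integral_cong_AE)
      show "AE t in circ. \<eta> (cis t) * cis (real (Suc m) * t) = k t * cis (real (Suc m) * t)"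
        using ae by eventually_elim simp
    qed (use L ki in \<open>auto simp: L1_circle_iff intro!: borel_measurable_integrable integrable_circ_times_cis\<close>)
    also have "\<dots> = of_real (2 * pi) * coef m * (1 / (of_real (2 * pi) * \<i>))"
      unfolding kh by (simp only: integral_mult_left_zero h)
    finally show ?thesis unfolding circle_integral_power(2)[OF L] by (simp add: field_simps)
  qed
  hence "second_order_trace_formula T0 T \<eta>" using trace_formula_iff[OF L] by blast
  moreover have "L1_circle_norm \<eta> \<le> \<delta>"
  proof -
    have "L1_circle_norm \<eta> = cint (\<lambda>t. cmod (k t))"
      unfolding L1_circle_norm_eq
    proof (rule integral_cong_AE)
      show "AE t in circ. cmod (\<eta> (cis t)) = cmod (k t)" using ae by eventually_elim simp
    qed (use complete ki in \<open>auto intro!: borel_measurable_norm borel_measurable_integrable\<close>)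
    also have "\<dots> = cint (\<lambda>t. cmod (h t)) * (1 / (2 * pi))"
      by (simp add: k_def norm_mult norm_divide)
    also have "\<dots> \<le> 2 * pi * \<delta> * (1 / (2 * pi))" by (intro mult_right_mono h) auto
    finally show ?thesis by simp
  qed
  ultimately show ?thesis using L by blast
qed

text \<open>The moment of \<open>z^m\<close> is a constant multiple of the Fourier coefficient at
  \<open>-(m+1)\<close>, and these indices exhaust the negative integers.\<close>

lemma trace_formula_unique:
  assumes "L1_circle \<eta>" "second_order_trace_formula T0 T \<eta>"
    and "L1_circle \<eta>'" "second_order_trace_formula T0 T \<eta>'"
  shows "H1_circle (\<lambda>z. \<eta> z - \<eta>' z)"
  unfolding H1_circle_def
proof (intro conjI allI impI)
  show L: "L1_circle (\<lambda>z. \<eta> z - \<eta>' z)"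
    using assms unfolding L1_circle_iff by (intro Bochner_Integration.integrable_diff)
  fix n :: int assume "n < 0"
  then obtain m where n: "n = - int (Suc m)" using negD by blast
  have i: "\<i> * cint (\<lambda>t. \<zeta> (cis t) * cis (real (Suc m) * t)) = coef m"
    if "L1_circle \<zeta>" "second_order_trace_formula T0 T \<zeta>" for \<zeta>
    using that trace_formula_iff circle_integral_power(2)[OF that(1), of m] by simp
  have "cint (\<lambda>t. (\<eta> (cis t) - \<eta>' (cis t)) * cis (real (Suc m) * t))
      = cint (\<lambda>t. \<eta> (cis t) * cis (real (Suc m) * t)) - cint (\<lambda>t. \<eta>' (cis t) * cis (real (Suc m) * t))"
    unfolding left_diff_distrib
    using assms unfolding L1_circle_iff by (intro Bochner_Integration.integral_diff integrable_circ_times_cis)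
  also have "\<dots> = 0"
  proof -
    have "\<i> * cint (\<lambda>t. \<eta> (cis t) * cis (real (Suc m) * t))
        = \<i> * cint (\<lambda>t. \<eta>' (cis t) * cis (real (Suc m) * t))"
      unfolding i[OF assms(1,2)] i[OF assms(3,4)] ..
    thus ?thesis unfolding mult_cancel_left by simp
  qed
  finally show "fourier_coeff (\<lambda>z. \<eta> z - \<eta>' z) n = 0"
    unfolding fourier_coeff_eq n by (simp add: algebra_simps)
qed

lemma trace_formula_exists_bounded:
  assumes "\<epsilon> > 0"
  shows "\<exists>\<eta>. L1_circle \<eta> \<and> second_order_trace_formula T0 T \<eta> \<and> L1_circle_norm \<eta> \<le> (1/2 + \<epsilon>) * (norm V)\<^sup>2"
proof (rule trace_formula_exists)
  show "analytic_part coef ((1/2 + \<epsilon>) * (norm V)\<^sup>2)"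
  \<comment> \<open>For \<open>V = 0\<close> the slack \<open>\<epsilon> * (norm V)^2\<close> is
    zero; the zero function serves.\<close>
  proof (cases "V = 0")
    case True
    have "form m 0 Y = 0" for m Y using form_scaleC_left[of m 0 0 Y] by simp
    hence eq: "coef = (\<lambda>_. 0)" using True by simp
    show ?thesis unfolding eq analytic_part_def by (intro exI[of _ "\<lambda>_. 0"]) (simp add: True)
  next
    case False
    hence "\<epsilon> * (norm V)\<^sup>2 > 0" using assms by simp
    from form_analytic_part[OF this] show ?thesis by (simp add: distrib_right)
  qed
qed

end

text \<open>The corner is \<open>U\<close> composed with the inclusion \<open>J\<close> of the
  coordinate \<open>0\<close> and the coordinate projection \<open>P\<close>, so the ideal property
  applies.\<close>

lemma hilbert_schmidt_corner:
  fixes U :: "'a::chilbert_space ell2Z \<Rightarrow>\<^sub>L 'a ell2Z" and A :: "'a \<Rightarrow>\<^sub>L 'a"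
  assumes U: "hilbert_schmidt U" and A: "\<And>v. A v = coord (U (single 0 v)) 0"
  shows "hilbert_schmidt A"
proof -
  define J where "J = Blinfun (single 0 :: 'a \<Rightarrow> _)"
  define P where "P = Blinfun (\<lambda>x :: 'a ell2Z. coord x 0)"
  have J: "J v = single 0 v" for v by (simp add: J_def bounded_linear_Blinfun_apply bounded_linear_single)
  have P: "P x = coord x 0" for x by (simp add: P_def bounded_linear_Blinfun_apply bounded_linear_coord)
  have "complex_linear J"
    by (auto simp: complex_linear_def J scaleC_ell2Z.rep_eq single.rep_eq complex_vector.scale_zero_right intro!: ell2Z_eqI)
  moreover have "complex_linear P" by (simp add: complex_linear_def P scaleC_ell2Z.rep_eq)
  ultimately have "hilbert_schmidt (P o\<^sub>L (U o\<^sub>L J))"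
    using U by (intro hilbert_schmidt_compose_left hilbert_schmidt_compose_right)
  moreover have "P o\<^sub>L (U o\<^sub>L J) = A" by (rule blinfun_eqI) (simp add: A J P)
  ultimately show ?thesis by simp
qed

theorem theorem6p3:
  fixes T T0 :: "'a::chilbert_space \<Rightarrow>\<^sub>L 'a"
  assumes "separable_space (euclidean :: 'a topology)"
    and "\<nexists>B :: 'a set. finite B \<and> complex_vector.span B = UNIV"
    and "contraction T" and "contraction T0"
    and "hilbert_schmidt (schaeffer T - schaeffer T0)"
  shows "(\<forall>p. trace_class (remainder2 p T0 T))
    \<and> (\<exists>\<eta>. L1_circle \<eta> \<and> second_order_trace_formula T0 T \<eta>)
    \<and> (\<forall>\<eta> \<eta>'. L1_circle \<eta> \<and> second_order_trace_formula T0 T \<eta> \<and>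
              L1_circle \<eta>' \<and> second_order_trace_formula T0 T \<eta>'
              \<longrightarrow> H1_circle (\<lambda>z. \<eta> z - \<eta>' z))
    \<and> (\<forall>\<epsilon>>0. \<exists>\<eta>. L1_circle \<eta> \<and> second_order_trace_formula T0 T \<eta>
              \<and> L1_circle_norm \<eta> \<le> (1/2 + \<epsilon>) * (hs_norm (T - T0))\<^sup>2)"
proof -
  have "hilbert_schmidt (T - T0)"
  proof (rule hilbert_schmidt_corner[OF assms(5)])
    fix v
    have "coord (schaeffer A (single 0 v)) 0 = A v" for A :: "'a \<Rightarrow>\<^sub>L 'a"
      using has_block_matrix_schaeffer[of A] by (simp add: has_block_matrix_def schaeffer_entry_def)
    thus "(T - T0) v = coord ((schaeffer T - schaeffer T0) (single 0 v)) 0"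
      by (simp add: blinfun.diff_left coord_simps)
  qed
  then obtain V where V: "op_of_hs V = T - T0" by (metis Abs_hs_inverse mem_Collect_eq)
  interpret contraction_pair T0 T V by unfold_locales (use assms V in auto)
  have n: "norm V = hs_norm (T - T0)" using norm_hs_eq[of V] V by simp
  \<comment> \<open>The plain existence clause is the bounded one at
    \<open>\<epsilon> = 1\<close>.\<close>
  show ?thesis
    using trace_class_remainder2 trace_formula_exists_bounded trace_formula_unique
      trace_formula_exists_bounded[of 1] unfolding n by (meson zero_less_one)
qed

end
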